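(* Let $T>0$, $n\ge1$, and let $W=\{W(t),t\in[0,T]\}$ be a standard Brownian motion. For each $m\ge 1$ let $W^{(m)}=\{W^{(m)}(t),t\in[0,T]\}$ be a version of the uniform transport process $$m^{1/2}(-1)^A\int_0^t(-1)^{N(um)}\,du,\qquad t\in[0,T],$$ where $N=\{N(t),t\ge0\}$ is a standard Poisson process and $A\sim\mathrm{Bernoulli}(\tfrac12)$ is independent of $N$, all the $W^{(m)}$ being defined on the same probability space as $W$ and such that $$\lim_{m\to\infty}\sup_{s\in[0,T]}|W^{(m)}(s)-W(s)|=0\quad\text{almost surely.}$$ Let $f:[0,T]^n\to\mathbb{R}$ be of the form $$f(x_1,\ldots,x_n)=f_1(x_1)\cdots f_n(x_n)\,I_{\{x_1\le\cdots\le x_n\}},$$ where for each $i\in\{1,\ldots,n\}$ the function $f_i:[0,T]\to\mathbb{R}$ has a continuous derivative on $[0,T]$. Let $$J_n^{(m)}(t)=\int_0^t\int_0^{s_n}\cdots\int_0^{s_2}f_n(s_n)\cdots f_1(s_1)\,dW^{(m)}(s_1)\cdots dW^{(m)}(s_n)$$ and let $$I_n^S(t)=\int_0^t\int_0^{s_n}\cdots\int_0^{s_2}f_n(s_n)\cdots f_1(s_1)\,d^\circ W(s_1)\cdots d^\circ W(s_n)$$ be (the continuous version of) the multiple Stratonovich integral. Then $$\lim_{m\to\infty}\sup_{s\in[0,T]}|J_n^{(m)}(s)-I_n^S(s)|=0\quad\text{almost surely.}$$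
   Context: "Version" means that $W^{(m)}$ is a process with continuous paths having the same law (on $C[0,T]$) as the displayed uniform transport process. The ordinary integrals are pathwise Riemann–Stieltjes integrals and are defined iteratively by $J_1^{(m)}(t)=\int_0^t f_1(s)\,dW^{(m)}(s)$ and $J_k^{(m)}(t)=\int_0^t f_k(s)J_{k-1}^{(m)}(s)\,dW^{(m)}(s)$ for $k\in\{2,\ldots,n\}$. The symbol $d^\circ W$ denotes the Stratonovich integral: for a continuous process $X$ adapted to the filtration of $W$ for which the quadratic covariation $[X,W]$ exists, $\int_0^t X(s)\,d^\circ W(s)=\int_0^tX(s)\,dW(s)+\tfrac12[X,W]_t$, where $dW$ denotes the Itô integral. The multiple Stratonovich integral $I_n^S$ coincides with the iterated Stratonovich integral $Y_n$, where $Y_1(t)=\int_0^tf_1(s)\,d^\circ W(s)$ and $Y_k(t)=\int_0^tf_k(s)Y_{k-1}(s)\,d^\circ W(s)$ for $k\in\{2,\ldots,n\}$; all these integrals have continuous versions, which are the ones used. *)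

theory Defs
  imports "HOL-Probability.Probability"
begin

definition partition_seq :: "real \<Rightarrow> real \<Rightarrow> nat \<Rightarrow> (nat \<Rightarrow> real) \<Rightarrow> bool" where
  "partition_seq a b N \<tau> \<longleftrightarrow> \<tau> 0 = a \<and> \<tau> N = b \<and> (\<forall>i<N. \<tau> i \<le> \<tau> (Suc i))"

definition mesh_less :: "real \<Rightarrow> nat \<Rightarrow> (nat \<Rightarrow> real) \<Rightarrow> bool" where
  "mesh_less \<delta> N \<tau> \<longleftrightarrow> (\<forall>i<N. \<tau> (Suc i) - \<tau> i < \<delta>)"

definition has_rs_integral ::
  "(real \<Rightarrow> real) \<Rightarrow> (real \<Rightarrow> real) \<Rightarrow> real \<Rightarrow> real \<Rightarrow> real \<Rightarrow> bool" where
  "has_rs_integral g w a b I \<longleftrightarrow>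
     (\<forall>\<epsilon>>0. \<exists>\<delta>>0. \<forall>N \<tau> \<xi>.
        partition_seq a b N \<tau> \<and> mesh_less \<delta> N \<tau> \<and> (\<forall>i<N. \<xi> i \<in> {\<tau> i..\<tau> (Suc i)}) \<longrightarrow>
        \<bar>(\<Sum>i<N. g (\<xi> i) * (w (\<tau> (Suc i)) - w (\<tau> i))) - I\<bar> < \<epsilon>)"

definition rs_integral :: "(real \<Rightarrow> real) \<Rightarrow> (real \<Rightarrow> real) \<Rightarrow> real \<Rightarrow> real \<Rightarrow> real" where
  "rs_integral g w a b = (THE I. has_rs_integral g w a b I)"

text \<open>The families \<open>f 1, f 2, \<dots>\<close> are indexed from 1, as in the iterated integrals; the value for
  \<open>k = 0\<close> is a dummy that is never used.\<close>

fun iterated_rs_integral ::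
  "(nat \<Rightarrow> real \<Rightarrow> real) \<Rightarrow> (real \<Rightarrow> real) \<Rightarrow> nat \<Rightarrow> real \<Rightarrow> real" where
  "iterated_rs_integral f w 0 t = 0"
| "iterated_rs_integral f w (Suc 0) t = rs_integral (f 1) w 0 t"
| "iterated_rs_integral f w (Suc (Suc k)) t =
     rs_integral (\<lambda>s. f (Suc (Suc k)) s * iterated_rs_integral f w (Suc k) s) w 0 t"

definition continuous_process :: "'a measure \<Rightarrow> real \<Rightarrow> (real \<Rightarrow> 'a \<Rightarrow> real) \<Rightarrow> bool" where
  "continuous_process M T X \<longleftrightarrow>
     (\<forall>t\<in>{0..T}. X t \<in> borel_measurable M) \<and>
     (\<forall>\<omega>\<in>space M. continuous_on {0..T} (\<lambda>t. X t \<omega>))"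

definition brownian_motion :: "'a measure \<Rightarrow> real \<Rightarrow> (real \<Rightarrow> 'a \<Rightarrow> real) \<Rightarrow> bool" where
  "brownian_motion M T W \<longleftrightarrow>
     continuous_process M T W \<and>
     (AE \<omega> in M. W 0 \<omega> = 0) \<and>
     (\<forall>N \<tau>. partition_seq 0 T N \<tau> \<longrightarrow>
        prob_space.indep_vars M (\<lambda>_. borel) (\<lambda>i \<omega>. W (\<tau> (Suc i)) \<omega> - W (\<tau> i) \<omega>) {..<N}) \<and>
     (\<forall>s t. 0 \<le> s \<and> s < t \<and> t \<le> T \<longrightarrow>
        distributed M lborel (\<lambda>\<omega>. W t \<omega> - W s \<omega>) (normal_density 0 (sqrt (t - s))))"

definition poisson_process :: "'b measure \<Rightarrow> (real \<Rightarrow> 'b \<Rightarrow> nat) \<Rightarrow> bool" where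
  "poisson_process P N \<longleftrightarrow>
     (\<forall>t\<ge>0. N t \<in> measurable P (count_space UNIV)) \<and>
     (\<forall>\<omega>\<in>space P. N 0 \<omega> = 0 \<and> mono_on {0..} (\<lambda>t. N t \<omega>) \<and>
        (\<forall>t\<ge>0. continuous (at_right t) (\<lambda>s. real (N s \<omega>)))) \<and>
     (\<forall>b\<ge>0. \<forall>k \<tau>. partition_seq 0 b k \<tau> \<longrightarrow>
        prob_space.indep_vars P (\<lambda>_. count_space UNIV)
          (\<lambda>i \<omega>. N (\<tau> (Suc i)) \<omega> - N (\<tau> i) \<omega>) {..<k}) \<and>
     (\<forall>s t. 0 \<le> s \<and> s < t \<longrightarrow>
        distr P (count_space UNIV) (\<lambda>\<omega>. N t \<omega> - N s \<omega>) = measure_pmf (poisson_pmf (t - s)))"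

definition uniform_transport ::
  "(real \<Rightarrow> 'b \<Rightarrow> nat) \<Rightarrow> ('b \<Rightarrow> bool) \<Rightarrow> nat \<Rightarrow> real \<Rightarrow> 'b \<Rightarrow> real" where
  "uniform_transport N A m t \<omega> =
     sqrt (real m) * (-1) ^ (of_bool (A \<omega>) :: nat) *
       integral {0..t} (\<lambda>u. (-1) ^ N (u * real m) \<omega>)"

text \<open>The space \<open>C[0,T]\<close> with its sup metric (functions are \<^const>\<open>undefined\<close> outside
  \<open>[0,T]\<close>) and its Borel \<open>\<sigma>\<close>-algebra.\<close>

definition C_metric :: "real \<Rightarrow> (real \<Rightarrow> real) metric" where
  "C_metric T = cfunspace (top_of_set {0..T}) euclidean_metric"

definition C_borel :: "real \<Rightarrow> (real \<Rightarrow> real) measure" where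
  "C_borel T = sigma (mspace (C_metric T)) {U. openin (mtopology_of (C_metric T)) U}"

definition path_law ::
  "'a measure \<Rightarrow> real \<Rightarrow> (real \<Rightarrow> 'a \<Rightarrow> real) \<Rightarrow> (real \<Rightarrow> real) measure" where
  "path_law M T X = distr M (C_borel T) (\<lambda>\<omega>. \<lambda>t\<in>{0..T}. X t \<omega>)"

definition is_version ::
  "'a measure \<Rightarrow> (real \<Rightarrow> 'a \<Rightarrow> real) \<Rightarrow> 'b measure \<Rightarrow> (real \<Rightarrow> 'b \<Rightarrow> real) \<Rightarrow> real \<Rightarrow> bool" where
  "is_version M X P Z T \<longleftrightarrow> continuous_process M T X \<and> path_law M T X = path_law P T Z"

text \<open>The filtration of \<open>W\<close> is augmented by the null sets, since stochastic integrals are only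
  determined up to indistinguishability.\<close>

definition aug_filtration :: "'a measure \<Rightarrow> (real \<Rightarrow> 'a \<Rightarrow> real) \<Rightarrow> real \<Rightarrow> 'a measure" where
  "aug_filtration M W t =
     sigma (space M)
       ({W s -` B \<inter> space M | s B. s \<in> {0..t} \<and> B \<in> sets borel} \<union> null_sets M)"

definition adapted ::
  "'a measure \<Rightarrow> real \<Rightarrow> (real \<Rightarrow> 'a \<Rightarrow> real) \<Rightarrow> (real \<Rightarrow> 'a \<Rightarrow> real) \<Rightarrow> bool" where
  "adapted M T W X \<longleftrightarrow> (\<forall>t\<in>{0..T}. X t \<in> borel_measurable (aug_filtration M W t))"

definition converges_in_prob ::
  "'a measure \<Rightarrow> (nat \<Rightarrow> 'a \<Rightarrow> real) \<Rightarrow> ('a \<Rightarrow> real) \<Rightarrow> bool" where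
  "converges_in_prob M X Z \<longleftrightarrow>
     (\<forall>j. X j \<in> borel_measurable M) \<and> Z \<in> borel_measurable M \<and>
     (\<forall>\<epsilon>>0. (\<lambda>j. measure M {\<omega>\<in>space M. \<bar>X j \<omega> - Z \<omega>\<bar> > \<epsilon>}) \<longlonglongrightarrow> 0)"

text \<open>A triple \<open>(N, \<tau>, \<xi>)\<close> stands for the elementary predictable process
  \<open>\<Sum>i<N. \<xi> i \<cdot> 1\<close> on \<open>(\<tau> i, \<tau> (i+1)]\<close>.\<close>

definition simple_process ::
  "'a measure \<Rightarrow> real \<Rightarrow> (real \<Rightarrow> 'a \<Rightarrow> real) \<Rightarrow> nat \<Rightarrow> (nat \<Rightarrow> real) \<Rightarrow> (nat \<Rightarrow> 'a \<Rightarrow> real) \<Rightarrow> bool"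
  where
  "simple_process M T W N \<tau> \<xi> \<longleftrightarrow>
     partition_seq 0 T N \<tau> \<and>
     (\<forall>i<N. \<xi> i \<in> borel_measurable (aug_filtration M W (\<tau> i)) \<and>
        (\<exists>B. \<forall>\<omega>\<in>space M. \<bar>\<xi> i \<omega>\<bar> \<le> B))"

definition simple_value ::
  "nat \<Rightarrow> (nat \<Rightarrow> real) \<Rightarrow> (nat \<Rightarrow> 'a \<Rightarrow> real) \<Rightarrow> real \<Rightarrow> 'a \<Rightarrow> real" where
  "simple_value N \<tau> \<xi> s \<omega> = (\<Sum>i<N. \<xi> i \<omega> * indicat_real {\<tau> i<..\<tau> (Suc i)} s)"

definition simple_integral ::
  "(real \<Rightarrow> 'a \<Rightarrow> real) \<Rightarrow> nat \<Rightarrow> (nat \<Rightarrow> real) \<Rightarrow> (nat \<Rightarrow> 'a \<Rightarrow> real) \<Rightarrow> real \<Rightarrow> 'a \<Rightarrow> real" where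
  "simple_integral W N \<tau> \<xi> t \<omega> =
     (\<Sum>i<N. \<xi> i \<omega> * (W (min (\<tau> (Suc i)) t) \<omega> - W (min (\<tau> i) t) \<omega>))"

text \<open>\<open>Z\<close> is a continuous version of the Ito integral of the continuous adapted process \<open>X\<close>,
  defined by extension from simple integrands.\<close>

definition is_ito_integral ::
  "'a measure \<Rightarrow> real \<Rightarrow> (real \<Rightarrow> 'a \<Rightarrow> real) \<Rightarrow> (real \<Rightarrow> 'a \<Rightarrow> real) \<Rightarrow> (real \<Rightarrow> 'a \<Rightarrow> real) \<Rightarrow> bool"
  where
  "is_ito_integral M T W X Z \<longleftrightarrow>
     continuous_process M T X \<and> adapted M T W X \<and> continuous_process M T Z \<and>
     (\<exists>N \<tau> \<xi>.
        (\<forall>j. simple_process M T W (N j) (\<tau> j) (\<xi> j)) \<and>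
        converges_in_prob M
          (\<lambda>j \<omega>. integral {0..T} (\<lambda>s. (simple_value (N j) (\<tau> j) (\<xi> j) s \<omega> - X s \<omega>)\<^sup>2))
          (\<lambda>_. 0) \<and>
        (\<forall>t\<in>{0..T}.
           converges_in_prob M (\<lambda>j. simple_integral W (N j) (\<tau> j) (\<xi> j) t) (Z t)))"

definition is_covariation ::
  "'a measure \<Rightarrow> real \<Rightarrow> (real \<Rightarrow> 'a \<Rightarrow> real) \<Rightarrow> (real \<Rightarrow> 'a \<Rightarrow> real) \<Rightarrow> (real \<Rightarrow> 'a \<Rightarrow> real) \<Rightarrow> bool"
  where
  "is_covariation M T X W Q \<longleftrightarrow>
     (\<forall>t\<in>{0..T}. Q t \<in> borel_measurable M \<and>
       (\<forall>\<epsilon>>0. \<forall>\<eta>>0. \<exists>\<delta>>0. \<forall>N \<tau>. partition_seq 0 t N \<tau> \<and> mesh_less \<delta> N \<tau> \<longrightarrow>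
          measure M {\<omega>\<in>space M.
            \<bar>(\<Sum>i<N. (X (\<tau> (Suc i)) \<omega> - X (\<tau> i) \<omega>) * (W (\<tau> (Suc i)) \<omega> - W (\<tau> i) \<omega>)) - Q t \<omega>\<bar>
              > \<epsilon>} < \<eta>))"

definition is_stratonovich_integral ::
  "'a measure \<Rightarrow> real \<Rightarrow> (real \<Rightarrow> 'a \<Rightarrow> real) \<Rightarrow> (real \<Rightarrow> 'a \<Rightarrow> real) \<Rightarrow> (real \<Rightarrow> 'a \<Rightarrow> real) \<Rightarrow> bool"
  where
  "is_stratonovich_integral M T W X Y \<longleftrightarrow>
     continuous_process M T Y \<and>
     (\<exists>Z Q. is_ito_integral M T W X Z \<and> is_covariation M T X W Q \<and>
        (\<forall>t\<in>{0..T}. AE \<omega> in M. Y t \<omega> = Z t \<omega> + Q t \<omega> / 2))"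

definition is_multiple_stratonovich_integral ::
  "'a measure \<Rightarrow> real \<Rightarrow> (real \<Rightarrow> 'a \<Rightarrow> real) \<Rightarrow> (nat \<Rightarrow> real \<Rightarrow> real) \<Rightarrow> nat \<Rightarrow> (real \<Rightarrow> 'a \<Rightarrow> real) \<Rightarrow> bool"
  where
  "is_multiple_stratonovich_integral M T W f n I \<longleftrightarrow>
     (\<exists>Y. is_stratonovich_integral M T W (\<lambda>s \<omega>. f 1 s) (Y 1) \<and>
        (\<forall>k\<in>{2..n}. is_stratonovich_integral M T W (\<lambda>s \<omega>. f k s * Y (k - 1) s \<omega>) (Y k)) \<and>
        I = Y n)"

definition C1_on_interval :: "real \<Rightarrow> (real \<Rightarrow> real) \<Rightarrow> bool" where
  "C1_on_interval T g \<longleftrightarrow>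
     (\<exists>g'. (\<forall>x\<in>{0..T}. (g has_real_derivative g' x) (at x within {0..T})) \<and>
        continuous_on {0..T} g')"

end

theory Submission
  imports Defs
begin

text \<open>
  Integration by parts shows that, for a fixed continuous path \<open>w\<close>, the iterated integral is a
  polynomial in \<open>w(t)\<close> whose coefficients involve \<open>w\<close> only through ordinary integrals; the
  resulting functional \<open>S\<^sub>n[w]\<close> is continuous in the uniform norm. Its increments agree with the
  trapezoid rule up to an error \<open>o(\<Delta>t + (\<Delta>w)\<^sup>2)\<close>. For the paths of the transport process, which
  are almost surely Lipschitz, this makes \<open>S\<^sub>n\<close> the iterated Riemann--Stieltjes integral. For
  Brownian paths, trapezoid sums along suitable partitions converge to the Stratonovich integral
  (the Ito part by an isometry estimate, the correction by the covariation), while \<open>\<Sum>(\<Delta>W)\<^sup>2\<close> stays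
  bounded along a subsequence, so \<open>S\<^sub>n[W]\<close> is the multiple Stratonovich integral. The theorem is
  then the continuity of \<open>S\<^sub>n\<close>.
\<close>

section \<open>Trapezoid rule along a fixed path\<close>

text \<open>The left-point rule misses \<open>F b - F a\<close> by about half of \<open>F''\<close>
  times the squared step, and along a Brownian path these terms add up to the Ito correction. The
  trapezoid rule cancels them and leaves a remainder governed by the oscillation of
  \<open>F''\<close>, which vanishes with the mesh by continuity of the path alone. Hence the error
  budget is a small multiple of \<Delta>t + (\<Delta>w)^2 and not a power of the mesh: its total
  over a partition stays under control on both sides, so one statement about a fixed path serves
  both. The Lipschitz constant of the m-th transport path grows like the square root of m, and no
  rate of convergence is given. Lipschitz bounds therefore only identify the iterated integral for
  each single m; the passage to the limit uses nothing but uniform convergence. The Ito integral is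
  accessible only as a limit in probability of integrals of simple processes, so sums along a
  prescribed partition are not at hand. The partitions are instead produced by refining those of the
  simple processes.\<close>

lemma trapezoid_rule_error:
  fixes F p q :: "real \<Rightarrow> real"
  assumes F: "\<And>x. (F has_real_derivative p x) (at x)"
    and p: "\<And>x. (p has_real_derivative q x) (at x)"
    and close: "\<And>x y. a \<le> x \<Longrightarrow> x \<le> y \<Longrightarrow> y \<le> b \<Longrightarrow> \<bar>q x - q y\<bar> \<le> e"
    and "a \<le> b"
  shows "\<bar>F b - F a - (p a + p b) / 2 * (b - a)\<bar> \<le> e * (b - a)\<^sup>2"
proof (cases "a = b")
  case False
  then have ab: "a < b" using \<open>a \<le> b\<close> by simp
  define h where "h x = F x - F a - (p a + p x) / 2 * (x - a)" for x
  have h': "(h has_real_derivative ((p x - p a) / 2 - q x * (x - a) / 2)) (at x)" for x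
    unfolding h_def by (auto intro!: derivative_eq_intros F p simp: field_simps)
  \<comment> \<open>The mean value theorem for \<open>h\<close>, and then for \<open>p\<close>,
    turns the error into a difference of two values of \<open>q\<close>. A bound on the oscillation
    of \<open>q\<close> is therefore enough; no third derivative is involved.\<close>
  obtain z where z: "a < z" "z < b" "h b - h a = (b - a) * ((p z - p a) / 2 - q z * (z - a) / 2)"
    using MVT2[of a b h "\<lambda>x. (p x - p a) / 2 - q x * (x - a) / 2"] ab h' by blast
  obtain y where y: "a < y" "y < z" "p z - p a = (z - a) * q y"
    using MVT2[of a z p q] z p by blast
  have eq: "h b = (b - a) * ((z - a) * (q y - q z) / 2)"
    using z y by (simp add: h_def field_simps)
  have e: "\<bar>q y - q z\<bar> \<le> e" using close y z by auto
  then have "0 \<le> e" by linarith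
  have "\<bar>h b\<bar> = (b - a) * ((z - a) * \<bar>q y - q z\<bar> / 2)"
    unfolding eq using ab z by (simp add: abs_mult)
  also have "\<dots> \<le> (b - a) * ((b - a) * e)"
    using ab z e \<open>0 \<le> e\<close>
    by (intro mult_left_mono order.trans[OF _ mult_mono[of "z - a" "b - a" "\<bar>q y - q z\<bar>" e]]) auto
  finally show ?thesis by (simp add: h_def power2_eq_square mult_ac)
qed simp

text \<open>Only increments of \<open>S\<close> occur, no integral. Summed over a partition, the
  inequality compares the trapezoid sum with the telescoped \<open>S\<close> up to
  \<open>\<epsilon>\<close> times the length plus the sum of the squared increments of
  \<open>w\<close>. The constant of integration stays free and is fixed elsewhere by
  \<open>S 0 = 0\<close>.\<close>

definition stratonovich_primitive ::
    "real \<Rightarrow> (real \<Rightarrow> real) \<Rightarrow> (real \<Rightarrow> real) \<Rightarrow> (real \<Rightarrow> real) \<Rightarrow> bool" where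
  "stratonovich_primitive T w G S \<longleftrightarrow>
     (\<forall>\<epsilon>>0. \<exists>\<delta>>0. \<forall>s t. 0 \<le> s \<and> s \<le> t \<and> t \<le> T \<and> t - s < \<delta> \<longrightarrow>
        \<bar>S t - S s - (G s + G t) / 2 * (w t - w s)\<bar> \<le> \<epsilon> * ((t - s) + (w t - w s)\<^sup>2))"

lemma stratonovich_primitiveE:
  assumes "stratonovich_primitive T w G S" "\<epsilon> > 0"
  obtains \<delta> where "\<delta> > 0"
    "\<And>s t. 0 \<le> s \<Longrightarrow> s \<le> t \<Longrightarrow> t \<le> T \<Longrightarrow> t - s < \<delta> \<Longrightarrow>
        \<bar>S t - S s - (G s + G t) / 2 * (w t - w s)\<bar> \<le> \<epsilon> * ((t - s) + (w t - w s)\<^sup>2)"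
  using assms unfolding stratonovich_primitive_def by meson

text \<open>Needed because the integrand process coincides with its polynomial form only on
  \<open>{0..T}\<close>, and only for almost every path.\<close>

lemma stratonovich_primitive_cong:
  assumes "stratonovich_primitive T w G S" "\<And>t. t \<in> {0..T} \<Longrightarrow> H t = G t"
  shows "stratonovich_primitive T w H S"
  unfolding stratonovich_primitive_def
proof (intro allI impI)
  fix e :: real assume "e > 0"
  with assms(1) obtain d where "d > 0" "\<And>s t. 0 \<le> s \<Longrightarrow> s \<le> t \<Longrightarrow> t \<le> T \<Longrightarrow> t - s < d \<Longrightarrow>
        \<bar>S t - S s - (G s + G t) / 2 * (w t - w s)\<bar> \<le> e * ((t - s) + (w t - w s)\<^sup>2)"
    by (rule stratonovich_primitiveE) blast
  then show "\<exists>\<delta>>0. \<forall>s t. 0 \<le> s \<and> s \<le> t \<and> t \<le> T \<and> t - s < \<delta> \<longrightarrow>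
        \<bar>S t - S s - (H s + H t) / 2 * (w t - w s)\<bar> \<le> e * ((t - s) + (w t - w s)\<^sup>2)"
    by (intro exI[of _ d]) (simp add: assms(2))
qed

lemma stratonovich_primitive_add:
  assumes 1: "stratonovich_primitive T w G1 S1" and 2: "stratonovich_primitive T w G2 S2"
  shows "stratonovich_primitive T w (\<lambda>t. G1 t + G2 t) (\<lambda>t. S1 t + S2 t)"
  unfolding stratonovich_primitive_def
proof (intro allI impI)
  fix e :: real assume "e > 0"
  then have e: "e / 2 > 0" by simp
  obtain d1 where d1: "d1 > 0" "\<And>s t. 0 \<le> s \<Longrightarrow> s \<le> t \<Longrightarrow> t \<le> T \<Longrightarrow> t - s < d1 \<Longrightarrow>
        \<bar>S1 t - S1 s - (G1 s + G1 t) / 2 * (w t - w s)\<bar> \<le> e / 2 * ((t - s) + (w t - w s)\<^sup>2)"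
    by (rule stratonovich_primitiveE[OF 1 e]) blast
  obtain d2 where d2: "d2 > 0" "\<And>s t. 0 \<le> s \<Longrightarrow> s \<le> t \<Longrightarrow> t \<le> T \<Longrightarrow> t - s < d2 \<Longrightarrow>
        \<bar>S2 t - S2 s - (G2 s + G2 t) / 2 * (w t - w s)\<bar> \<le> e / 2 * ((t - s) + (w t - w s)\<^sup>2)"
    by (rule stratonovich_primitiveE[OF 2 e]) blast
  show "\<exists>d>0. \<forall>s t. 0 \<le> s \<and> s \<le> t \<and> t \<le> T \<and> t - s < d \<longrightarrow>
        \<bar>S1 t + S2 t - (S1 s + S2 s) - (G1 s + G2 s + (G1 t + G2 t)) / 2 * (w t - w s)\<bar>
          \<le> e * ((t - s) + (w t - w s)\<^sup>2)"
  proof (intro exI[of _ "min d1 d2"] conjI allI impI)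
    fix s t assume st: "0 \<le> s \<and> s \<le> t \<and> t \<le> T \<and> t - s < min d1 d2"
    have "S1 t + S2 t - (S1 s + S2 s) - (G1 s + G2 s + (G1 t + G2 t)) / 2 * (w t - w s)
       = (S1 t - S1 s - (G1 s + G1 t) / 2 * (w t - w s)) + (S2 t - S2 s - (G2 s + G2 t) / 2 * (w t - w s))"
      by (simp add: field_simps)
    moreover have "e * ((t - s) + (w t - w s)\<^sup>2)
        = e / 2 * ((t - s) + (w t - w s)\<^sup>2) + e / 2 * ((t - s) + (w t - w s)\<^sup>2)" by simp
    ultimately show "\<bar>S1 t + S2 t - (S1 s + S2 s) - (G1 s + G2 s + (G1 t + G2 t)) / 2 * (w t - w s)\<bar>
          \<le> e * ((t - s) + (w t - w s)\<^sup>2)"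
      using d1(2)[of s t] d2(2)[of s t] st by linarith
  qed (use d1 d2 in auto)
qed

lemma stratonovich_primitive_sum:
  assumes "finite A" "\<And>i. i \<in> A \<Longrightarrow> stratonovich_primitive T w (G i) (S i)"
  shows "stratonovich_primitive T w (\<lambda>t. \<Sum>i\<in>A. G i t) (\<lambda>t. \<Sum>i\<in>A. S i t)"
  using assms
proof (induction A rule: finite_induct)
  case empty
  show ?case unfolding stratonovich_primitive_def
    by (auto intro!: exI[of _ 1] add_nonneg_nonneg mult_nonneg_nonneg)
qed (simp add: stratonovich_primitive_add)

lemma continuous_on_uniformD:
  fixes h :: "real \<Rightarrow> real"
  assumes "continuous_on {a..b} h" "e > 0"
  obtains d where "d > 0" "\<And>x y. x \<in> {a..b} \<Longrightarrow> y \<in> {a..b} \<Longrightarrow> \<bar>y - x\<bar> < d \<Longrightarrow> \<bar>h y - h x\<bar> < e"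
  using compact_uniformly_continuous[OF assms(1)] assms(2)
  unfolding uniformly_continuous_on_def dist_real_def by (meson compact_Icc)

lemma continuous_on_bound:
  fixes h :: "real \<Rightarrow> real"
  assumes "continuous_on {a..b} h"
  obtains K where "K \<ge> 1" "\<And>x. x \<in> {a..b} \<Longrightarrow> \<bar>h x\<bar> \<le> K"
proof -
  have "bounded (h ` {a..b})"
    using compact_continuous_image[OF assms compact_Icc] by (rule compact_imp_bounded)
  then obtain K where "\<forall>x\<in>{a..b}. \<bar>h x\<bar> \<le> K" unfolding bounded_iff by auto
  then show ?thesis by (intro that[of "max 1 K"]) (auto simp: le_max_iff_disj)
qed

text \<open>Stratonovich integration by parts for \<open>g(t) F'(w(t))\<close>: the term \<open>g(t) F(w(t))\<close> has the right
  rough increments and only the smooth correction \<open>\<integral> g' F(w)\<close> has to be subtracted.\<close>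

lemma stratonovich_primitive_by_parts:
  fixes F p q g g' w :: "real \<Rightarrow> real"
  assumes F: "\<And>x. (F has_real_derivative p x) (at x)"
    and p: "\<And>x. (p has_real_derivative q x) (at x)"
    and q: "continuous_on UNIV q"
    and g: "\<And>x. x \<in> {0..T} \<Longrightarrow> (g has_real_derivative g' x) (at x within {0..T})"
    and g': "continuous_on {0..T} g'"
    and w: "continuous_on {0..T} w"
  shows "stratonovich_primitive T w (\<lambda>t. g t * p (w t))
           (\<lambda>t. g t * F (w t) - integral {0..t} (\<lambda>r. g' r * F (w r)))"
  unfolding stratonovich_primitive_def
proof (intro allI impI)
  fix e :: real assume e: "e > 0"
  have cF: "continuous_on A F" and cp: "continuous_on A p" for A
    using F p by (meson DERIV_continuous_on has_field_derivative_at_within)+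
  have cg: "continuous_on {0..T} g" using g by (meson DERIV_continuous_on)
  have cFw: "continuous_on {0..T} (\<lambda>r. F (w r))"
    by (rule continuous_on_compose2[OF cF w subset_UNIV])
  have cpw: "continuous_on {0..T} (\<lambda>r. p (w r))"
    by (rule continuous_on_compose2[OF cp w subset_UNIV])
  obtain K1 where K1: "K1 \<ge> 1" "\<And>x. x \<in> {0..T} \<Longrightarrow> \<bar>g x\<bar> \<le> K1"
    by (rule continuous_on_bound[OF cg]) blast
  obtain K2 where K2: "K2 \<ge> 1" "\<And>x. x \<in> {0..T} \<Longrightarrow> \<bar>g' x\<bar> \<le> K2"
    by (rule continuous_on_bound[OF g']) blast
  obtain K3 where K3: "K3 \<ge> 1" "\<And>x. x \<in> {0..T} \<Longrightarrow> \<bar>p (w x)\<bar> \<le> K3"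
    by (rule continuous_on_bound[OF cpw]) blast
  obtain R where R: "R \<ge> 1" "\<And>x. x \<in> {0..T} \<Longrightarrow> \<bar>w x\<bar> \<le> R"
    by (rule continuous_on_bound[OF w]) blast
  \<comment> \<open>Three remainders arise below, one for each tolerance: \<open>e / K1\<close> for
    the trapezoid error of \<open>F\<close>, which is multiplied by a value of \<open>g\<close>;
    \<open>e / (K2 * K3)\<close> for the change of \<open>g\<close> inside the trapezoid;
    \<open>e / (2 * K2)\<close> for the integral correction. \<open>R\<close> confines the path to a
    compact interval on which \<open>q\<close> is uniformly continuous.\<close>
  have "e / K1 > 0" using e K1 by simp
  then obtain d0 where d0: "d0 > 0"
    "\<And>x y. x \<in> {-R..R} \<Longrightarrow> y \<in> {-R..R} \<Longrightarrow> \<bar>y - x\<bar> < d0 \<Longrightarrow> \<bar>q y - q x\<bar> < e / K1"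
    using continuous_on_uniformD[OF continuous_on_subset[OF q subset_UNIV]] by metis
  have "min d0 (e / (K2 * K3)) > 0" using d0 e K2 K3 by simp
  then obtain d1 where d1: "d1 > 0" "\<And>x y. x \<in> {0..T} \<Longrightarrow> y \<in> {0..T} \<Longrightarrow> \<bar>y - x\<bar> < d1 \<Longrightarrow>
      \<bar>w y - w x\<bar> < min d0 (e / (K2 * K3))"
    using continuous_on_uniformD[OF w] by metis
  have "e / (2 * K2) > 0" using e K2 by simp
  then obtain d2 where d2: "d2 > 0" "\<And>x y. x \<in> {0..T} \<Longrightarrow> y \<in> {0..T} \<Longrightarrow> \<bar>y - x\<bar> < d2 \<Longrightarrow>
      \<bar>F (w y) - F (w x)\<bar> < e / (2 * K2)"
    using continuous_on_uniformD[OF cFw] by metis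
  let ?S = "\<lambda>t. g t * F (w t) - integral {0..t} (\<lambda>r. g' r * F (w r))"
  let ?G = "\<lambda>t. g t * p (w t)"
  show "\<exists>d>0. \<forall>s t. 0 \<le> s \<and> s \<le> t \<and> t \<le> T \<and> t - s < d \<longrightarrow>
      \<bar>?S t - ?S s - (?G s + ?G t) / 2 * (w t - w s)\<bar> \<le> e * ((t - s) + (w t - w s)\<^sup>2)"
  proof (intro exI[of _ "min d1 d2"] conjI allI impI)
    fix s t assume "0 \<le> s \<and> s \<le> t \<and> t \<le> T \<and> t - s < min d1 d2"
    then have st: "0 \<le> s" "s \<le> t" "t \<le> T" "t - s < d1" "t - s < d2" by auto
    then have sub: "{s..t} \<subseteq> {0..T}" and mem: "s \<in> {0..T}" "t \<in> {0..T}" by auto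
    have dw: "\<bar>w t - w s\<bar> < d0" "\<bar>w t - w s\<bar> < e / (K2 * K3)"
      using d1(2)[of s t] st by auto
    have I1: "(g' has_integral (g t - g s)) {s..t}"
      using st by (intro fundamental_theorem_of_calculus)
        (auto simp: has_real_derivative_iff_has_vector_derivative[symmetric]
           intro!: has_field_derivative_subset[OF g sub])
    have int: "(\<lambda>r. g' r * F (w r)) integrable_on {a..b}" if "0 \<le> a" "b \<le> T" for a b
      using that by (intro integrable_continuous_interval continuous_intros
          continuous_on_subset[OF g'] continuous_on_subset[OF cFw]) auto
    have I2: "((\<lambda>r. g' r * F (w r)) has_integral
        (integral {0..t} (\<lambda>r. g' r * F (w r)) - integral {0..s} (\<lambda>r. g' r * F (w r)))) {s..t}"
      using
        integrable_integral[OF int[OF st(1,3)]]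
        Henstock_Kurzweil_Integration.integral_combine[OF st(1,2) int[OF order_refl st(3)]]
      by (metis add_diff_cancel_left')
    \<comment> \<open>This is the integral of \<open>g' r * (F (w t) - F (w r))\<close> over
      \<open>{s..t}\<close>, hence small compared with \<open>t - s\<close>, since \<open>F\<close>
      is uniformly continuous along the path.\<close>
    let ?I = "(g t - g s) * F (w t)
        - (integral {0..t} (\<lambda>r. g' r * F (w r)) - integral {0..s} (\<lambda>r. g' r * F (w r)))"
    have I3: "((\<lambda>r. g' r * F (w t) - g' r * F (w r)) has_integral ?I) {s..t}"
      by (intro has_integral_diff has_integral_mult_left I1 I2)
    have bI: "\<bar>?I\<bar> \<le> e / 2 * (t - s)"
    proof -
      have "norm ?I \<le> K2 * (e / (2 * K2)) * measure lborel (cbox s t)"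
      proof (rule has_integral_bound[where f = "\<lambda>r. g' r * F (w t) - g' r * F (w r)"])
        show "((\<lambda>r. g' r * F (w t) - g' r * F (w r)) has_integral ?I) (cbox s t)"
          using I3 by simp
      next
        fix r assume "r \<in> cbox s t"
        then have r: "r \<in> {0..T}" "\<bar>t - r\<bar> < d2" using st by auto
        have "norm (g' r * F (w t) - g' r * F (w r)) = \<bar>g' r\<bar> * \<bar>F (w t) - F (w r)\<bar>"
          by (simp flip: abs_mult right_diff_distrib)
        also have "\<dots> \<le> K2 * (e / (2 * K2))"
          using K2 r d2(2)[OF r(1) mem(2) r(2)] by (intro mult_mono) auto
        finally show "norm (g' r * F (w t) - g' r * F (w r)) \<le> K2 * (e / (2 * K2))" .
      qed (use e K2 in auto)
      then show ?thesis using K2 st by simp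
    qed
    have bg: "\<bar>g t - g s\<bar> \<le> K2 * (t - s)"
      using has_integral_bound[of K2 g' "g t - g s" s t] I1 K2 sub st by auto
    have bT: "\<bar>(g t - g s) * p (w t) / 2 * (w t - w s)\<bar> \<le> e / 2 * (t - s)"
    proof -
      have "\<bar>(g t - g s) * p (w t) / 2 * (w t - w s)\<bar>
          = \<bar>g t - g s\<bar> * \<bar>p (w t)\<bar> * \<bar>w t - w s\<bar> / 2" by (simp add: abs_mult)
      also have "\<dots> \<le> (K2 * (t - s)) * K3 * (e / (K2 * K3)) / 2"
        using bg K3 K2 mem st dw e by (intro divide_right_mono mult_mono) auto
      also have "\<dots> = e / 2 * (t - s)" using K2 K3 by (simp add: field_simps)
      finally show ?thesis .
    qed
    have bq: "\<bar>F (w t) - F (w s) - (p (w s) + p (w t)) / 2 * (w t - w s)\<bar> \<le> e / K1 * (w t - w s)\<^sup>2"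
    proof -
      have q1: "\<bar>q x - q y\<bar> \<le> e / K1" if "w s \<le> x \<and> y \<le> w t \<or> w t \<le> x \<and> y \<le> w s" "x \<le> y" for x y
      proof -
        have "\<bar>w t\<bar> \<le> R" "\<bar>w s\<bar> \<le> R" using R mem by auto
        then have "x \<in> {-R..R}" "y \<in> {-R..R}" "\<bar>x - y\<bar> < d0" using that dw by auto
        then show ?thesis using d0(2)[of y x] by fastforce
      qed
      \<comment> \<open>The trapezoid estimate wants ordered end points, but the path may move
        downwards. Exchanging the end points only changes the sign of the error.\<close>
      consider "w s \<le> w t" | "w t \<le> w s" by linarith
      then show ?thesis
      proof cases
        case 1
        then show ?thesis by (intro trapezoid_rule_error[OF F p]) (use q1 in auto)
      next
        case 2
        then have "\<bar>F (w s) - F (w t) - (p (w t) + p (w s)) / 2 * (w s - w t)\<bar> \<le> e / K1 * (w s - w t)\<^sup>2"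
          by (intro trapezoid_rule_error[OF F p]) (use q1 in auto)
        moreover have "F (w s) - F (w t) - (p (w t) + p (w s)) / 2 * (w s - w t)
            = - (F (w t) - F (w s) - (p (w s) + p (w t)) / 2 * (w t - w s))" by (simp add: field_simps)
        ultimately show ?thesis by (simp only: abs_minus_cancel power2_commute)
      qed
    qed
    have bQ: "\<bar>g s * (F (w t) - F (w s) - (p (w s) + p (w t)) / 2 * (w t - w s))\<bar> \<le> e * (w t - w s)\<^sup>2"
    proof -
      have "\<bar>g s * (F (w t) - F (w s) - (p (w s) + p (w t)) / 2 * (w t - w s))\<bar>
          \<le> K1 * (e / K1 * (w t - w s)\<^sup>2)"
        unfolding abs_mult using K1 mem bq by (intro mult_mono) auto
      then show ?thesis using K1 by simp
    qed
    \<comment> \<open>Freezing \<open>g\<close> at time \<open>s\<close> isolates the rough part in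
      the first summand; the other two contain only increments of \<open>g\<close>.\<close>
    have "?S t - ?S s - (?G s + ?G t) / 2 * (w t - w s)
        = g s * (F (w t) - F (w s) - (p (w s) + p (w t)) / 2 * (w t - w s)) + ?I
          - (g t - g s) * p (w t) / 2 * (w t - w s)"
      by (simp add: field_simps)
    moreover have tri: "\<bar>x\<bar> \<le> A + B + C" if "x = a + b - c" "\<bar>a\<bar> \<le> A" "\<bar>b\<bar> \<le> B" "\<bar>c\<bar> \<le> C"
      for x a b c A B C :: real using that by linarith
    ultimately have "\<bar>?S t - ?S s - (?G s + ?G t) / 2 * (w t - w s)\<bar>
        \<le> e * (w t - w s)\<^sup>2 + e / 2 * (t - s) + e / 2 * (t - s)"
      using bI bT bQ by blast
    also have "\<dots> = e * ((t - s) + (w t - w s)\<^sup>2)" by (simp add: field_simps)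
    finally show "\<bar>?S t - ?S s - (?G s + ?G t) / 2 * (w t - w s)\<bar> \<le> e * ((t - s) + (w t - w s)\<^sup>2)" .
  qed (use d1 d2 in auto)
qed

section \<open>Partitions and the Riemann-Stieltjes integral\<close>

lemma partition_seq_mono:
  assumes "partition_seq a b N \<tau>" "i \<le> j" "j \<le> N"
  shows "\<tau> i \<le> \<tau> j"
  using assms(2,3)
proof (induction j rule: dec_induct)
  case (step j)
  then show ?case using assms(1) unfolding partition_seq_def by (metis Suc_le_eq less_imp_le_nat order_trans)
qed simp

lemma partition_seq_range:
  assumes "partition_seq a b N \<tau>" "i \<le> N"
  shows "a \<le> \<tau> i" "\<tau> i \<le> b"
  using partition_seq_mono[OF assms(1), of 0 i] partition_seq_mono[OF assms(1), of i N] assms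
  by (auto simp: partition_seq_def)

lemma partition_seq_step:
  assumes "partition_seq a b N \<tau>" "i < N"
  shows "a \<le> \<tau> i" "\<tau> i \<le> \<tau> (Suc i)" "\<tau> (Suc i) \<le> b"
  using partition_seq_range[OF assms(1)] partition_seq_mono[OF assms(1), of i "Suc i"] assms by auto

lemma partition_seq_telescope:
  assumes "partition_seq a b N \<tau>"
  shows "(\<Sum>i<N. h (\<tau> (Suc i)) - h (\<tau> i)) = (h b - h a :: real)"
  using assms by (simp add: partition_seq_def sum_lessThan_telescope[of "\<lambda>i. h (\<tau> i)"])

lemma fine_partition_exists:
  assumes "a \<le> b" "\<delta> > 0"
  obtains N \<tau> where "partition_seq a b N \<tau>" "mesh_less \<delta> N \<tau>"
proof -
  obtain n :: nat where n: "(b - a) / \<delta> < real n" using reals_Archimedean2 by blast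
  define \<tau> where "\<tau> i = a + (b - a) * real i / real (Suc n)" for i
  have "(b - a) / real (Suc n) < \<delta>"
    using n assms by (simp add: field_simps)
  moreover have "\<tau> (Suc i) - \<tau> i = (b - a) / real (Suc n)" for i
    unfolding \<tau>_def by (simp add: diff_divide_distrib[symmetric] algebra_simps)
  ultimately have d: "\<tau> (Suc i) - \<tau> i < \<delta>" for i
    by simp
  have "partition_seq a b (Suc n) \<tau>"
    unfolding partition_seq_def \<tau>_def using assms
    by (auto intro!: divide_right_mono mult_left_mono simp del: of_nat_Suc)
  then show ?thesis using d that by (auto simp: mesh_less_def)
qed

text \<open>A partition finer than both moduli must exist for the two values to be compared. This is
  where \<open>a \<le> b\<close> enters: for \<open>b < a\<close> there are no partitions, and every
  number would qualify as an integral.\<close>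

lemma has_rs_integral_unique:
  assumes "a \<le> b" "has_rs_integral g w a b I" "has_rs_integral g w a b J"
  shows "I = J"
proof (rule ccontr)
  assume "I \<noteq> J"
  then have e: "\<bar>I - J\<bar> / 2 > 0" by simp
  let ?s = "\<lambda>N \<tau> \<xi>. \<Sum>i<N. g (\<xi> i) * (w (\<tau> (Suc i)) - w (\<tau> i))"
  obtain d1 where d1: "d1 > 0" "\<And>N \<tau> \<xi>. partition_seq a b N \<tau> \<and> mesh_less d1 N \<tau> \<and>
      (\<forall>i<N. \<xi> i \<in> {\<tau> i..\<tau> (Suc i)}) \<Longrightarrow> \<bar>?s N \<tau> \<xi> - I\<bar> < \<bar>I - J\<bar> / 2"
    using assms(2) e unfolding has_rs_integral_def by blast
  obtain d2 where d2: "d2 > 0" "\<And>N \<tau> \<xi>. partition_seq a b N \<tau> \<and> mesh_less d2 N \<tau> \<and>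
      (\<forall>i<N. \<xi> i \<in> {\<tau> i..\<tau> (Suc i)}) \<Longrightarrow> \<bar>?s N \<tau> \<xi> - J\<bar> < \<bar>I - J\<bar> / 2"
    using assms(3) e unfolding has_rs_integral_def by blast
  obtain N \<tau> where p: "partition_seq a b N \<tau>" "mesh_less (min d1 d2) N \<tau>"
    using fine_partition_exists[OF assms(1), of "min d1 d2"] d1 d2 by auto
  have "\<bar>?s N \<tau> \<tau> - I\<bar> < \<bar>I - J\<bar> / 2" "\<bar>?s N \<tau> \<tau> - J\<bar> < \<bar>I - J\<bar> / 2"
    using p by (intro d1 d2; auto simp: mesh_less_def partition_seq_def)+
  moreover have "\<bar>I - J\<bar> \<le> \<bar>?s N \<tau> \<tau> - I\<bar> + \<bar>?s N \<tau> \<tau> - J\<bar>" by linarith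
  ultimately show False by (simp add: field_simps)
qed

lemma rs_integral_eqI:
  assumes "a \<le> b" "has_rs_integral g w a b I"
  shows "rs_integral g w a b = I"
  unfolding rs_integral_def using assms has_rs_integral_unique by blast

text \<open>Tags never leave the interval, so both integrands define the same predicate of the
  value; the description operator then agrees even if no integral exists.\<close>

lemma rs_integral_cong:
  assumes "\<And>x. x \<in> {a..b} \<Longrightarrow> g x = h x"
  shows "rs_integral g w a b = rs_integral h w a b"
proof -
  have "has_rs_integral g w a b I \<longleftrightarrow> has_rs_integral h w a b I" for I
  proof -
    have *: "(\<Sum>i<N. g (\<xi> i) * (w (\<tau> (Suc i)) - w (\<tau> i))) = (\<Sum>i<N. h (\<xi> i) * (w (\<tau> (Suc i)) - w (\<tau> i)))"
      if "partition_seq a b N \<tau>" "\<forall>i<N. \<xi> i \<in> {\<tau> i..\<tau> (Suc i)}" for N \<tau> \<xi>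
    proof (rule sum.cong[OF refl])
      fix i assume "i \<in> {..<N}"
      then have "\<xi> i \<in> {a..b}" using that partition_seq_step[OF that(1), of i] by force
      then show "g (\<xi> i) * (w (\<tau> (Suc i)) - w (\<tau> i)) = h (\<xi> i) * (w (\<tau> (Suc i)) - w (\<tau> i))"
        using assms by simp
    qed
    show ?thesis unfolding has_rs_integral_def
      by (simp add: * cong: conj_cong imp_cong)
  qed
  then have "has_rs_integral g w a b = has_rs_integral h w a b" by blast
  then show ?thesis unfolding rs_integral_def by simp
qed

text \<open>On a Lipschitz path the squared increment is dominated by the step length, so the error
  budget sums to a small multiple of \<open>t\<close>. Uniform continuity of \<open>G\<close> allows
  an arbitrary tag in place of the average of the end point values.\<close>

lemma stratonovich_primitive_has_rs_integral:
  assumes prim: "stratonovich_primitive T w G S" and G: "continuous_on {0..T} G"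
    and S0: "S 0 = 0" and L: "\<And>x y. x \<in> {0..T} \<Longrightarrow> y \<in> {0..T} \<Longrightarrow> \<bar>w y - w x\<bar> \<le> L * \<bar>y - x\<bar>"
    and t: "t \<in> {0..T}"
  shows "has_rs_integral G w 0 t (S t)"
  unfolding has_rs_integral_def
proof (intro allI impI)
  fix e :: real assume "e > 0"
  \<comment> \<open>The summands pay for the step length, for the squared increment of
    \<open>w\<close>, and for exchanging the tag. The absolute value is taken since \<open>L\<close>
    is not assumed nonnegative.\<close>
  define K where "K = 1 + L\<^sup>2 + \<bar>L\<bar>"
  have K: "K \<ge> 1" unfolding K_def by simp
  define e' where "e' = e / (2 * K * (t + 1))"
  have tp: "t \<ge> 0" using t by simp
  have e': "e' > 0" using \<open>e > 0\<close> K tp by (simp add: e'_def)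
  obtain d1 where d1: "d1 > 0" "\<And>s t. 0 \<le> s \<Longrightarrow> s \<le> t \<Longrightarrow> t \<le> T \<Longrightarrow> t - s < d1 \<Longrightarrow>
        \<bar>S t - S s - (G s + G t) / 2 * (w t - w s)\<bar> \<le> e' * ((t - s) + (w t - w s)\<^sup>2)"
    by (rule stratonovich_primitiveE[OF prim e']) blast
  obtain d2 where d2: "d2 > 0"
    "\<And>x y. x \<in> {0..T} \<Longrightarrow> y \<in> {0..T} \<Longrightarrow> \<bar>y - x\<bar> < d2 \<Longrightarrow> \<bar>G y - G x\<bar> < e'"
    by (rule continuous_on_uniformD[OF G e']) blast
  \<comment> \<open>Steps of length at most 1 satisfy (\<Delta>t)^2 \<le> \<Delta>t, which is used
    to bound the squared increment.\<close>
  define d where "d = min 1 (min d1 d2)"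
  show "\<exists>\<delta>>0. \<forall>N \<tau> \<xi>. partition_seq 0 t N \<tau> \<and> mesh_less \<delta> N \<tau> \<and> (\<forall>i<N. \<xi> i \<in> {\<tau> i..\<tau> (Suc i)}) \<longrightarrow>
        \<bar>(\<Sum>i<N. G (\<xi> i) * (w (\<tau> (Suc i)) - w (\<tau> i))) - S t\<bar> < e"
  proof (intro exI[of _ d] conjI allI impI)
    fix N \<tau> \<xi>
    assume "partition_seq 0 t N \<tau> \<and> mesh_less d N \<tau> \<and> (\<forall>i<N. \<xi> i \<in> {\<tau> i..\<tau> (Suc i)})"
    then have part: "partition_seq 0 t N \<tau>" and mesh: "mesh_less d N \<tau>"
      and \<xi>: "\<And>i. i < N \<Longrightarrow> \<xi> i \<in> {\<tau> i..\<tau> (Suc i)}" by auto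
    have each: "\<bar>G (\<xi> i) * (w (\<tau> (Suc i)) - w (\<tau> i)) - (S (\<tau> (Suc i)) - S (\<tau> i))\<bar>
        \<le> e' * K * (\<tau> (Suc i) - \<tau> i)" if "i < N" for i
    proof -
      let ?a = "\<tau> i" and ?b = "\<tau> (Suc i)"
      have ab: "0 \<le> ?a" "?a \<le> ?b" "?b \<le> T" "?b - ?a < d"
        using partition_seq_step[OF part that] mesh that t by (auto simp: mesh_less_def)
      have dw: "\<bar>w ?b - w ?a\<bar> \<le> \<bar>L\<bar> * (?b - ?a)"
        using L[of ?a ?b] ab by (smt (verit) atLeastAtMost_iff mult_right_mono)
      have dw2: "(w ?b - w ?a)\<^sup>2 \<le> L\<^sup>2 * (?b - ?a)"
      proof -
        have "(w ?b - w ?a)\<^sup>2 \<le> (\<bar>L\<bar> * (?b - ?a))\<^sup>2"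
          using dw by (metis abs_ge_zero power2_abs power_mono)
        also have "\<dots> = L\<^sup>2 * (?b - ?a) * (?b - ?a)" by (simp add: power2_eq_square algebra_simps)
        also have "\<dots> \<le> L\<^sup>2 * (?b - ?a) * 1"
          using ab by (intro mult_left_mono) (auto simp: d_def)
        finally show ?thesis by simp
      qed
      have 1: "\<bar>S ?b - S ?a - (G ?a + G ?b) / 2 * (w ?b - w ?a)\<bar> \<le> e' * ((?b - ?a) + (w ?b - w ?a)\<^sup>2)"
        using d1 ab by (auto simp: d_def)
      have "\<bar>G (\<xi> i) - G ?a\<bar> < e'" "\<bar>G (\<xi> i) - G ?b\<bar> < e'"
        using ab \<xi>[OF that] by (auto simp: d_def intro!: d2)
      then have "\<bar>G (\<xi> i) - (G ?a + G ?b) / 2\<bar> \<le> e'" by (simp add: field_simps)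
      then have 2: "\<bar>(G (\<xi> i) - (G ?a + G ?b) / 2) * (w ?b - w ?a)\<bar> \<le> e' * (\<bar>L\<bar> * (?b - ?a))"
        unfolding abs_mult using dw e' by (intro mult_mono) auto
      have "\<bar>G (\<xi> i) * (w ?b - w ?a) - (S ?b - S ?a)\<bar>
          \<le> \<bar>(G (\<xi> i) - (G ?a + G ?b) / 2) * (w ?b - w ?a)\<bar> + \<bar>S ?b - S ?a - (G ?a + G ?b) / 2 * (w ?b - w ?a)\<bar>"
        unfolding left_diff_distrib by linarith
      also have "\<dots> \<le> e' * (\<bar>L\<bar> * (?b - ?a)) + e' * ((?b - ?a) + L\<^sup>2 * (?b - ?a))"
        using 2 order.trans[OF 1 mult_left_mono[of _ "(?b - ?a) + L\<^sup>2 * (?b - ?a)" e']] dw2 e' by linarith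
      also have "\<dots> = e' * K * (?b - ?a)" by (simp add: K_def algebra_simps)
      finally show ?thesis .
    qed
    have "\<bar>(\<Sum>i<N. G (\<xi> i) * (w (\<tau> (Suc i)) - w (\<tau> i))) - S t\<bar>
        = \<bar>\<Sum>i<N. G (\<xi> i) * (w (\<tau> (Suc i)) - w (\<tau> i)) - (S (\<tau> (Suc i)) - S (\<tau> i))\<bar>"
      using partition_seq_telescope[OF part, of S] S0 by (simp add: sum_subtractf)
    also have "\<dots> \<le> (\<Sum>i<N. e' * K * (\<tau> (Suc i) - \<tau> i))"
      by (rule order.trans[OF sum_abs sum_mono]) (use each in auto)
    also have "\<dots> = e' * K * t"
      using partition_seq_telescope[OF part, of "\<lambda>x. x"] by (simp add: sum_distrib_left[symmetric])
    also have "\<dots> < e"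
    proof -
      have "e' * K * t = e * (t / (2 * (t + 1)))" using K tp by (simp add: e'_def)
      also have "\<dots> < e * 1" using \<open>e > 0\<close> tp by (intro mult_strict_left_mono) (auto simp: field_simps)
      finally show ?thesis by simp
    qed
    finally show "\<bar>(\<Sum>i<N. G (\<xi> i) * (w (\<tau> (Suc i)) - w (\<tau> i))) - S t\<bar> < e" .
  qed (use d1 d2 in \<open>auto simp: d_def\<close>)
qed

text \<open>Iterating the integration by parts keeps the integrand polynomial in \<open>w(t)\<close>:
  \<open>strat_coef f f' w k j\<close> is the coefficient of \<open>w(t)\<^sup>j / j!\<close> after \<open>k\<close> integrations and
  \<open>strat_coef'\<close> its derivative in \<open>t\<close>. Both depend on the path \<open>w\<close> only through
  ordinary integrals, hence continuously in the uniform norm.\<close>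

fun strat_coef :: "(nat \<Rightarrow> real \<Rightarrow> real) \<Rightarrow> (nat \<Rightarrow> real \<Rightarrow> real) \<Rightarrow> (real \<Rightarrow> real) \<Rightarrow> nat \<Rightarrow> nat \<Rightarrow> real \<Rightarrow> real"
  and strat_coef' :: "(nat \<Rightarrow> real \<Rightarrow> real) \<Rightarrow> (nat \<Rightarrow> real \<Rightarrow> real) \<Rightarrow> (real \<Rightarrow> real) \<Rightarrow> nat \<Rightarrow> nat \<Rightarrow> real \<Rightarrow> real"
where
  "strat_coef f f' w 0 j t = of_bool (j = 0)"
| "strat_coef f f' w (Suc k) 0 t =
     - (\<Sum>i\<le>k. integral {0..t} (\<lambda>r.
          (f' (Suc k) r * strat_coef f f' w k i r + f (Suc k) r * strat_coef' f f' w k i r) * (w r ^ Suc i / fact (Suc i))))"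
| "strat_coef f f' w (Suc k) (Suc j) t = f (Suc k) t * strat_coef f f' w k j t"
| "strat_coef' f f' w 0 j t = 0"
| "strat_coef' f f' w (Suc k) 0 t =
     - (\<Sum>i\<le>k. (f' (Suc k) t * strat_coef f f' w k i t + f (Suc k) t * strat_coef' f f' w k i t) * (w t ^ Suc i / fact (Suc i)))"
| "strat_coef' f f' w (Suc k) (Suc j) t = f' (Suc k) t * strat_coef f f' w k j t + f (Suc k) t * strat_coef' f f' w k j t"

definition strat_iter :: "(nat \<Rightarrow> real \<Rightarrow> real) \<Rightarrow> (nat \<Rightarrow> real \<Rightarrow> real) \<Rightarrow> (real \<Rightarrow> real) \<Rightarrow> nat \<Rightarrow> real \<Rightarrow> real" where
  "strat_iter f f' w k t = (\<Sum>j\<le>k. strat_coef f f' w k j t * (w t ^ j / fact j))"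

text \<open>With level 0 equal to 1, the first integral, of \<open>f 1\<close> alone, is an instance
  of the general step. The dummy value 0 of \<open>iterated_rs_integral\<close> at level 0 would not
  allow this.\<close>

lemma strat_iter_0 [simp]: "strat_iter f f' w 0 t = 1"
  by (simp add: strat_iter_def)

text \<open>Divided powers make integration in the path variable a mere shift of the index; this is
  the origin of the factorials in \<open>strat_iter\<close>.\<close>

lemma DERIV_monomial_over_fact:
  "((\<lambda>x. x ^ Suc i / fact (Suc i)) has_real_derivative x ^ i / fact i) (at x)"
proof -
  have "((\<lambda>x. x ^ Suc i / fact (Suc i)) has_real_derivative (real (Suc i) * x ^ i) / fact (Suc i)) (at x)"
    by (intro DERIV_cdivide) (use DERIV_pow[of "Suc i" x UNIV] in simp)
  moreover have "(real (Suc i) * x ^ i) / fact (Suc i) = x ^ i / fact i"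
    by (simp add: fact_Suc del: of_nat_Suc)
  ultimately show ?thesis by simp
qed

text \<open>The coefficient of degree 0 is an integral over a single point, and every other term
  carries a positive power of \<open>w 0\<close>.\<close>

lemma strat_iter_Suc_0:
  assumes "w 0 = 0"
  shows "strat_iter f f' w (Suc k) 0 = 0"
  using assms by (simp add: strat_iter_def sum.atMost_Suc_shift del: sum.atMost_Suc)

section \<open>Uniform limits of integrals, products and powers\<close>

lemma uniform_limit_integral_0:
  fixes h :: "'b \<Rightarrow> real \<Rightarrow> real"
  assumes lim: "uniform_limit {0..T} h l F"
    and h: "\<forall>\<^sub>F m in F. continuous_on {0..T} (h m)" and l: "continuous_on {0..T} l"
  shows "uniform_limit {0..T} (\<lambda>m t. integral {0..t} (h m)) (\<lambda>t. integral {0..t} l) F"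
proof (rule uniform_limitI)
  fix e :: real assume "e > 0"
  define e' where "e' = e / (2 * (\<bar>T\<bar> + 1))"
  have e': "e' > 0" "e' * \<bar>T\<bar> < e"
  proof -
    show "e' > 0" using \<open>e > 0\<close> by (simp add: e'_def)
    have "e' * \<bar>T\<bar> = e * (\<bar>T\<bar> / (2 * (\<bar>T\<bar> + 1)))" by (simp add: e'_def)
    also have "\<dots> < e * 1" using \<open>e > 0\<close> by (intro mult_strict_left_mono) (auto simp: field_simps)
    finally show "e' * \<bar>T\<bar> < e" by simp
  qed
  show "\<forall>\<^sub>F m in F. \<forall>t\<in>{0..T}. dist (integral {0..t} (h m)) (integral {0..t} l) < e"
    using uniform_limitD[OF lim e'(1)] h
  proof eventually_elim
    case (elim m)
    show ?case
    proof
      fix t assume t: "t \<in> {0..T}"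
      have i: "h m integrable_on {0..t}" "l integrable_on {0..t}"
        using elim l t by (auto intro!: integrable_continuous_interval intro: continuous_on_subset)
      then have "((\<lambda>r. h m r - l r) has_integral (integral {0..t} (h m) - integral {0..t} l)) (cbox 0 t)"
        by (auto intro!: has_integral_diff)
      then have "norm (integral {0..t} (h m) - integral {0..t} l) \<le> e' * measure lborel (cbox 0 t)"
        using elim(1) t e' by (intro has_integral_bound) (auto simp: dist_real_def intro: less_imp_le)
      also have "\<dots> = e' * t" using t by simp
      also have "\<dots> \<le> e' * \<bar>T\<bar>" using t e' by (intro mult_left_mono) auto
      finally show "dist (integral {0..t} (h m)) (integral {0..t} l) < e"
        using e'(2) by (simp add: dist_real_def)
    qed
  qed
qed

lemma uniform_limit_mult_continuous:
  fixes g h :: "'b \<Rightarrow> real \<Rightarrow> real"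
  assumes "uniform_limit {a..b} g g0 F" "uniform_limit {a..b} h h0 F"
    and "continuous_on {a..b} g0" "continuous_on {a..b} h0"
  shows "uniform_limit {a..b} (\<lambda>m t. g m t * h m t) (\<lambda>t. g0 t * h0 t) F"
  using assms by (intro uniform_lim_mult compact_imp_bounded compact_continuous_image compact_Icc)

lemma uniform_limit_power_continuous:
  fixes g :: "'b \<Rightarrow> real \<Rightarrow> real"
  assumes "uniform_limit {a..b} g g0 F" "continuous_on {a..b} g0"
  shows "uniform_limit {a..b} (\<lambda>m t. g m t ^ i) (\<lambda>t. g0 t ^ i) F"
proof (induction i)
  case 0
  show ?case by (simp add: uniform_limit_const)
next
  case (Suc i)
  show ?case unfolding power_Suc
    by (intro uniform_limit_mult_continuous assms Suc.IH continuous_intros)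
qed

lemma uniform_limit_sum_finite:
  fixes g :: "'i \<Rightarrow> 'b \<Rightarrow> real \<Rightarrow> real"
  assumes "finite A" "\<And>i. i \<in> A \<Longrightarrow> uniform_limit X (g i) (l i) F"
  shows "uniform_limit X (\<lambda>m t. \<Sum>i\<in>A. g i m t) (\<lambda>t. \<Sum>i\<in>A. l i t) F"
  using assms by (induction A rule: finite_induct) (auto simp: uniform_limit_const intro!: uniform_limit_add)

section \<open>The iterated primitives as functionals of the path\<close>

context
  fixes T :: real and n :: nat and f f' :: "nat \<Rightarrow> real \<Rightarrow> real"
  assumes f': "\<And>i x. i \<in> {1..n} \<Longrightarrow> x \<in> {0..T} \<Longrightarrow> (f i has_real_derivative f' i x) (at x within {0..T})"
    and f'_cont: "\<And>i. i \<in> {1..n} \<Longrightarrow> continuous_on {0..T} (f' i)"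
begin

text \<open>In degree 0 this is the fundamental theorem of calculus, in positive degree the product
  rule. Differentiability and continuity of the derivative go through the induction together,
  because the integrand in degree 0 contains the derivatives of the previous level. Each level
  differentiates only its own \<open>f (Suc k)\<close>, and only once, so one continuous derivative
  suffices.\<close>

lemma strat_coef_has_derivative:
  assumes w: "continuous_on {0..T} w" and "k \<le> n"
  shows "t \<in> {0..T} \<Longrightarrow> (strat_coef f f' w k j has_real_derivative strat_coef' f f' w k j t) (at t within {0..T})"
    and continuous_strat_coef': "continuous_on {0..T} (strat_coef' f f' w k j)"
    and continuous_strat_coef: "continuous_on {0..T} (strat_coef f f' w k j)"
proof -
  have "(\<forall>t\<in>{0..T}. (strat_coef f f' w k j has_real_derivative strat_coef' f f' w k j t) (at t within {0..T}))
    \<and> continuous_on {0..T} (strat_coef' f f' w k j)" for j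
    using \<open>k \<le> n\<close>
  proof (induction k arbitrary: j)
    case 0
    then show ?case by simp
  next
    case (Suc k)
    have k: "Suc k \<in> {1..n}" "k \<le> n" using Suc.prems by auto
    have IH: "(strat_coef f f' w k j has_real_derivative strat_coef' f f' w k j t) (at t within {0..T})"
      if "t \<in> {0..T}" for t j using Suc.IH[OF k(2)] that by blast
    have c: "continuous_on {0..T} (strat_coef f f' w k j)" for j
      using IH by (meson DERIV_continuous_on)
    have c': "continuous_on {0..T} (strat_coef' f f' w k j)" for j
      using Suc.IH[OF k(2)] by blast
    have cf: "continuous_on {0..T} (f (Suc k))" using f'[OF k(1)] by (meson DERIV_continuous_on)
    have c1: "continuous_on {0..T} (\<lambda>r. (f' (Suc k) r * strat_coef f f' w k i r
        + f (Suc k) r * strat_coef' f f' w k i r) * (w r ^ Suc i / fact (Suc i)))" for i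
      by (intro continuous_intros c c' cf w f'_cont[OF k(1)]) simp
    show ?case
    proof (cases j)
      case 0
      show ?thesis unfolding 0 strat_coef.simps strat_coef'.simps
        by (intro conjI ballI DERIV_minus DERIV_sum integral_has_real_derivative c1
            continuous_on_minus continuous_on_sum)
    next
      case (Suc i)
      show ?thesis unfolding Suc strat_coef.simps strat_coef'.simps
      proof (intro conjI ballI)
        fix t assume t: "t \<in> {0..T}"
        show "((\<lambda>t. f (Suc k) t * strat_coef f f' w k i t) has_real_derivative
            f' (Suc k) t * strat_coef f f' w k i t + f (Suc k) t * strat_coef' f f' w k i t) (at t within {0..T})"
          using DERIV_mult'[OF f'[OF k(1) t] IH[OF t]] by (simp add: add.commute)
      qed (intro continuous_intros c c' cf f'_cont[OF k(1)])
    qed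
  qed
  note * = this
  show "t \<in> {0..T} \<Longrightarrow> (strat_coef f f' w k j has_real_derivative strat_coef' f f' w k j t) (at t within {0..T})"
    and "continuous_on {0..T} (strat_coef' f f' w k j)" using * by auto
  show "continuous_on {0..T} (strat_coef f f' w k j)"
    using * by (meson DERIV_continuous_on)
qed

lemma continuous_strat_iter:
  assumes "continuous_on {0..T} w" "k \<le> n"
  shows "continuous_on {0..T} (strat_iter f f' w k)"
  unfolding strat_iter_def by (intro continuous_intros continuous_strat_coef assms) simp

text \<open>Integration by parts is applied to each power of the path separately, with the
  coefficient as smooth factor. The correction integrals that this produces are, taken together,
  exactly the degree 0 coefficient of the next level.\<close>

lemma strat_iter_primitive:
  assumes w: "continuous_on {0..T} w" and "Suc k \<le> n"
  shows "stratonovich_primitive T w (\<lambda>t. f (Suc k) t * strat_iter f f' w k t) (strat_iter f f' w (Suc k))"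
proof -
  have "stratonovich_primitive T w (\<lambda>t. \<Sum>i\<le>k. strat_coef f f' w (Suc k) (Suc i) t * (w t ^ i / fact i))
     (\<lambda>t. \<Sum>i\<le>k. strat_coef f f' w (Suc k) (Suc i) t * (w t ^ Suc i / fact (Suc i))
        - integral {0..t} (\<lambda>r. strat_coef' f f' w (Suc k) (Suc i) r * (w r ^ Suc i / fact (Suc i))))"
  proof (intro stratonovich_primitive_sum)
    fix i
    \<comment> \<open>The second derivative is again a divided power, except for
      \<open>i = 0\<close>, where truncated subtraction would give the wrong value 1 in place of
      0.\<close>
    have q: "((\<lambda>x. x ^ i / fact i) has_real_derivative (if i = 0 then 0 else x ^ (i - 1) / fact (i - 1))) (at x)" for x :: real
      using DERIV_monomial_over_fact[of "i - 1" x] by (cases i) auto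
    show "stratonovich_primitive T w (\<lambda>t. strat_coef f f' w (Suc k) (Suc i) t * (w t ^ i / fact i))
     (\<lambda>t. strat_coef f f' w (Suc k) (Suc i) t * (w t ^ Suc i / fact (Suc i))
        - integral {0..t} (\<lambda>r. strat_coef' f f' w (Suc k) (Suc i) r * (w r ^ Suc i / fact (Suc i))))"
      by (rule stratonovich_primitive_by_parts[OF DERIV_monomial_over_fact q _
            strat_coef_has_derivative(1)[OF assms] continuous_strat_coef'[OF assms] w])
        (cases "i = 0"; auto intro!: continuous_intros)
  qed simp
  moreover have "(\<Sum>i\<le>k. strat_coef f f' w (Suc k) (Suc i) t * (w t ^ i / fact i)) = f (Suc k) t * strat_iter f f' w k t" for t
    by (simp add: strat_iter_def sum_distrib_left mult_ac)
  moreover have "(\<Sum>i\<le>k. strat_coef f f' w (Suc k) (Suc i) t * (w t ^ Suc i / fact (Suc i))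
        - integral {0..t} (\<lambda>r. strat_coef' f f' w (Suc k) (Suc i) r * (w r ^ Suc i / fact (Suc i))))
      = strat_iter f f' w (Suc k) t" for t
    unfolding strat_iter_def sum.atMost_Suc_shift
    by (simp add: sum_subtractf del: power_Suc fact_Suc)
  ultimately show ?thesis by simp
qed

text \<open>The Lipschitz bound serves to evaluate each Riemann-Stieltjes integral, and
  \<open>L\<close> does not appear in the value; it may thus vary with the path and with m.\<close>

lemma iterated_rs_integral_eq_strat_iter:
  assumes w: "continuous_on {0..T} w" and w0: "w 0 = 0"
    and L: "\<And>x y. x \<in> {0..T} \<Longrightarrow> y \<in> {0..T} \<Longrightarrow> \<bar>w y - w x\<bar> \<le> L * \<bar>y - x\<bar>"
    and "Suc k \<le> n" "t \<in> {0..T}"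
  shows "iterated_rs_integral f w (Suc k) t = strat_iter f f' w (Suc k) t"
proof -
  have *: "rs_integral (\<lambda>s. f (Suc k) s * strat_iter f f' w k s) w 0 t = strat_iter f f' w (Suc k) t"
    if "Suc k \<le> n" "t \<in> {0..T}" for k t
  proof (rule rs_integral_eqI)
    have "continuous_on {0..T} (f (Suc k))"      using that by (intro DERIV_continuous_on[OF f']) auto
    then show "has_rs_integral (\<lambda>s. f (Suc k) s * strat_iter f f' w k s) w 0 t (strat_iter f f' w (Suc k) t)"
      using that
      by (intro stratonovich_primitive_has_rs_integral[where L=L and T=T] strat_iter_primitive w L strat_iter_Suc_0 w0
          continuous_intros continuous_strat_iter) auto
  qed (use that in auto)
  show ?thesis using assms(4,5)
  proof (induction k arbitrary: t)
    case 0
    then show ?case using *[of 0 t] by simp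
  next
    case (Suc k)
    \<comment> \<open>The inner integral is replaced at all times up to \<open>t\<close>, which is
      why the induction runs over arbitrary \<open>t\<close>.\<close>
    have "iterated_rs_integral f w (Suc (Suc k)) t
        = rs_integral (\<lambda>s. f (Suc (Suc k)) s * strat_iter f f' w (Suc k) s) w 0 t"
      unfolding iterated_rs_integral.simps using Suc by (intro rs_integral_cong) auto
    then show ?case using *[OF Suc.prems] by simp
  qed
qed

text \<open>The coefficients arise from the path by sums, products, powers and ordinary integrals,
  and each of these preserves uniform convergence on a compact interval when the limits are
  continuous. Continuity of \<open>v m\<close> is asked only eventually, because in the application
  the path with index 0 is unrestricted.\<close>

lemma uniform_limit_strat_iter:
  assumes lim: "uniform_limit {0..T} v w F"
    and v: "\<forall>\<^sub>F m in F. continuous_on {0..T} (v m)" and w: "continuous_on {0..T} w" and "k \<le> n"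
  shows "uniform_limit {0..T} (\<lambda>m. strat_iter f f' (v m) k) (strat_iter f f' w k) F"
proof -
  note powlim = uniform_limit_power_continuous[OF lim w]
  have "uniform_limit {0..T} (\<lambda>m. strat_coef f f' (v m) k j) (strat_coef f f' w k j) F \<and>
        uniform_limit {0..T} (\<lambda>m. strat_coef' f f' (v m) k j) (strat_coef' f f' w k j) F" for j
    using \<open>k \<le> n\<close>
  proof (induction k arbitrary: j)
    case 0
    then show ?case by (simp add: uniform_limit_const)
  next
    case (Suc k)
    have k: "Suc k \<in> {1..n}" "k \<le> n" using Suc.prems by auto
    have IH: "uniform_limit {0..T} (\<lambda>m. strat_coef f f' (v m) k j) (strat_coef f f' w k j) F"
        "uniform_limit {0..T} (\<lambda>m. strat_coef' f f' (v m) k j) (strat_coef' f f' w k j) F" for j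
      using Suc.IH[OF k(2)] by auto
    have cf: "continuous_on {0..T} (f (Suc k))" using f'[OF k(1)] by (meson DERIV_continuous_on)
    note cont = continuous_strat_coef continuous_strat_coef' cf f'_cont[OF k(1)] w k(2)
    have 1: "uniform_limit {0..T} (\<lambda>m r. f' (Suc k) r * strat_coef f f' (v m) k i r + f (Suc k) r * strat_coef' f f' (v m) k i r)
       (\<lambda>r. f' (Suc k) r * strat_coef f f' w k i r + f (Suc k) r * strat_coef' f f' w k i r) F" for i
      by (intro uniform_limit_add uniform_limit_mult_continuous IH uniform_limit_const cont)
    have 2: "uniform_limit {0..T} (\<lambda>m r. (f' (Suc k) r * strat_coef f f' (v m) k i r + f (Suc k) r * strat_coef' f f' (v m) k i r)
         * (v m r ^ Suc i / fact (Suc i)))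
       (\<lambda>r. (f' (Suc k) r * strat_coef f f' w k i r + f (Suc k) r * strat_coef' f f' w k i r) * (w r ^ Suc i / fact (Suc i))) F" for i
      unfolding divide_inverse
      by (intro uniform_limit_mult_continuous 1 powlim uniform_limit_const cont continuous_intros)
    have c: "\<forall>\<^sub>F m in F. continuous_on {0..T} (\<lambda>r. (f' (Suc k) r * strat_coef f f' (v m) k i r + f (Suc k) r * strat_coef' f f' (v m) k i r)
         * (v m r ^ Suc i / fact (Suc i)))" for i
      using v by eventually_elim (intro continuous_intros cont, auto)
    show ?case
    proof (cases j)
      case 0
      have "uniform_limit {0..T} (\<lambda>m. strat_coef f f' (v m) (Suc k) 0) (strat_coef f f' w (Suc k) 0) F"
        unfolding strat_coef.simps
        by (intro uniform_limit_uminus uniform_limit_sum_finite uniform_limit_integral_0 2 c continuous_intros cont) auto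
      moreover have "uniform_limit {0..T} (\<lambda>m. strat_coef' f f' (v m) (Suc k) 0) (strat_coef' f f' w (Suc k) 0) F"
        unfolding strat_coef'.simps
        by (intro uniform_limit_uminus uniform_limit_sum_finite 2) auto
      ultimately show ?thesis unfolding 0 by blast
    next
      case (Suc i)
      show ?thesis unfolding Suc strat_coef.simps strat_coef'.simps
        by (intro conjI 1 uniform_limit_mult_continuous IH uniform_limit_const cont)
    qed
  qed
  then show ?thesis unfolding strat_iter_def divide_inverse
    by (intro uniform_limit_sum_finite uniform_limit_mult_continuous powlim uniform_limit_const
         continuous_strat_coef continuous_intros w \<open>k \<le> n\<close>) auto
qed

end

section \<open>Lipschitz paths of the transport process\<close>

lemma countable_dense_Icc:
  obtains D where "countable D" "D \<subseteq> {a..b}" "closure D = {a..b::real}"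
proof -
  obtain D where D: "countable D" "D \<subseteq> {a..b}" "{a..b} \<subseteq> closure D"
    by (rule separable[of "{a..b}"])
  moreover have "closure D \<subseteq> {a..b}" using D(2) by (simp add: closure_minimal)
  ultimately show ?thesis using that by blast
qed

section \<open>Borel sets and measurability in the path space\<close>

lemma mspace_C_metric: "mspace (C_metric T) = {g. g \<in> extensional {0..T} \<and> continuous_on {0..T} g}"
  unfolding C_metric_def
  by (subst compactin_mspace_cfunspace) (auto simp: compactin_subtopology)

text \<open>Closed balls are the convenient ones here: a supremum distance at most \<open>r\<close>
  is a pointwise condition, while a strict bound is not.\<close>

lemma openin_C_metric:
  assumes "T \<ge> 0"
  shows "openin (mtopology_of (C_metric T)) U \<longleftrightarrow> U \<subseteq> mspace (C_metric T) \<and>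
    (\<forall>x\<in>U. \<exists>r>0. \<forall>y\<in>mspace (C_metric T). (\<forall>t\<in>{0..T}. \<bar>y t - x t\<bar> \<le> r) \<longrightarrow> y \<in> U)"
proof -
  interpret C: Metric_space "mspace (C_metric T)" "mdist (C_metric T)" by simp
  have *: "mdist (C_metric T) x y \<le> r \<longleftrightarrow> (\<forall>t\<in>{0..T}. \<bar>y t - x t\<bar> \<le> r)"
    if "x \<in> mspace (C_metric T)" "y \<in> mspace (C_metric T)" for x y r
    using that assms unfolding C_metric_def
    by (subst cfunspace_mdist_le) (auto simp: dist_real_def abs_minus_commute)
  have "openin (mtopology_of (C_metric T)) U \<longleftrightarrow> U \<subseteq> mspace (C_metric T) \<and> (\<forall>x\<in>U. \<exists>r>0. C.mcball x r \<subseteq> U)"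
    unfolding mtopology_of_def C.openin_mtopology_mcball by blast
  also have "\<dots> \<longleftrightarrow> U \<subseteq> mspace (C_metric T) \<and>
    (\<forall>x\<in>U. \<exists>r>0. \<forall>y\<in>mspace (C_metric T). (\<forall>t\<in>{0..T}. \<bar>y t - x t\<bar> \<le> r) \<longrightarrow> y \<in> U)"
  proof (intro conj_cong refl ball_cong ex_cong1)
    fix x r assume "U \<subseteq> mspace (C_metric T)" "x \<in> U"
    then have "x \<in> mspace (C_metric T)" by blast
    then have "C.mcball x r = {y \<in> mspace (C_metric T). \<forall>t\<in>{0..T}. \<bar>y t - x t\<bar> \<le> r}"
      unfolding C.mcball_def using *[of x _ r] by blast
    then show "(C.mcball x r \<subseteq> U) \<longleftrightarrow>
        (\<forall>y\<in>mspace (C_metric T). (\<forall>t\<in>{0..T}. \<bar>y t - x t\<bar> \<le> r) \<longrightarrow> y \<in> U)" by blast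
  qed
  finally show ?thesis .
qed

lemma space_C_borel: "space (C_borel T) = mspace (C_metric T)"
  unfolding C_borel_def by (simp add: space_measure_of_conv)

lemma openin_imp_sets_C_borel:
  assumes "openin (mtopology_of (C_metric T)) U"
  shows "U \<in> sets (C_borel T)"
proof -
  have "{U. openin (mtopology_of (C_metric T)) U} \<subseteq> Pow (mspace (C_metric T))"
    using openin_subset by fastforce
  then show ?thesis unfolding C_borel_def using assms by (simp add: sets_measure_of)
qed

text \<open>A version is tied to the transport process only through its law. The path properties to
  be transferred are therefore collected in one subset of \<open>C[0,T]\<close>.\<close>

definition lipschitz_paths :: "real \<Rightarrow> real \<Rightarrow> (real \<Rightarrow> real) set" where
  "lipschitz_paths T L = {g \<in> mspace (C_metric T). g 0 = 0 \<and>
     (\<forall>x\<in>{0..T}. \<forall>y\<in>{0..T}. \<bar>g y - g x\<bar> \<le> L * \<bar>y - x\<bar>)}"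

text \<open>The set is closed: a violated condition involves at most two times and stays violated
  under small uniform perturbations.\<close>

lemma lipschitz_paths_sets:
  assumes "T \<ge> 0"
  shows "lipschitz_paths T L \<in> sets (C_borel T)"
proof -
  let ?C = "mspace (C_metric T)"
  have "openin (mtopology_of (C_metric T)) (?C - lipschitz_paths T L)"
    unfolding openin_C_metric[OF assms]
  proof (intro conjI ballI)
    fix g assume g: "g \<in> ?C - lipschitz_paths T L"
    then have "g 0 \<noteq> 0 \<or> (\<exists>x\<in>{0..T}. \<exists>y\<in>{0..T}. \<not> \<bar>g y - g x\<bar> \<le> L * \<bar>y - x\<bar>)"
      unfolding lipschitz_paths_def by blast
    then consider "g 0 \<noteq> 0" | x y where "x \<in> {0..T}" "y \<in> {0..T}" "\<bar>g y - g x\<bar> > L * \<bar>y - x\<bar>"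
      by (meson not_le)
    then show "\<exists>r>0. \<forall>h\<in>?C. (\<forall>t\<in>{0..T}. \<bar>h t - g t\<bar> \<le> r) \<longrightarrow> h \<in> ?C - lipschitz_paths T L"
    proof cases
      case 1
      show ?thesis
      proof (intro exI[of _ "\<bar>g 0\<bar> / 2"] conjI ballI impI)
        fix h assume h: "h \<in> ?C" "\<forall>t\<in>{0..T}. \<bar>h t - g t\<bar> \<le> \<bar>g 0\<bar> / 2"
        then have "\<bar>h 0 - g 0\<bar> \<le> \<bar>g 0\<bar> / 2" using assms by simp
        then have "h 0 \<noteq> 0" using 1 by auto
        then show "h \<in> ?C - lipschitz_paths T L" using h by (auto simp: lipschitz_paths_def)
      qed (use 1 in auto)
    next
      case (2 x y)
      \<comment> \<open>A quarter of the excess: the two values move by at most \<open>r\<close>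
        each, so at least half of the excess survives.\<close>
      define r where "r = (\<bar>g y - g x\<bar> - L * \<bar>y - x\<bar>) / 4"
      show ?thesis
      proof (intro exI[of _ r] conjI ballI impI)
        fix h assume h: "h \<in> ?C" "\<forall>t\<in>{0..T}. \<bar>h t - g t\<bar> \<le> r"
        then have "\<bar>h x - g x\<bar> \<le> r" "\<bar>h y - g y\<bar> \<le> r" using 2 by auto
        moreover have "4 * r = \<bar>g y - g x\<bar> - L * \<bar>y - x\<bar>" "r > 0" using 2 by (auto simp: r_def)
        moreover have "\<bar>g y - g x\<bar> \<le> \<bar>h y - h x\<bar> + \<bar>h x - g x\<bar> + \<bar>h y - g y\<bar>" by linarith
        ultimately have "\<not> \<bar>h y - h x\<bar> \<le> L * \<bar>y - x\<bar>" by linarith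
        then show "h \<in> ?C - lipschitz_paths T L" using h(1) 2(1,2) unfolding lipschitz_paths_def by blast
      qed (use 2 in \<open>auto simp: r_def\<close>)
    qed
  qed auto
  from sets.compl_sets[OF openin_imp_sets_C_borel[OF this]]
  have "?C - (?C - lipschitz_paths T L) \<in> sets (C_borel T)" by (simp add: space_C_borel)
  moreover have "?C - (?C - lipschitz_paths T L) = lipschitz_paths T L"
    by (auto simp: lipschitz_paths_def)
  ultimately show ?thesis by simp
qed

text \<open>Coefficient lists over \<open>rat\<close> form a countable type, so these polynomials
  are a countable family of candidate centres for balls in \<open>C[0,T]\<close>; the argument is
  rescaled from \<open>[0,T]\<close> to \<open>[0,1]\<close>.\<close>

definition rational_bernstein :: "real \<Rightarrow> rat list \<Rightarrow> real \<Rightarrow> real" where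
  "rational_bernstein T cs t = (\<Sum>k\<le>length cs - 1. of_rat (cs ! k) * Bernstein (length cs - 1) k (t / T))"

text \<open>Half of the tolerance goes to the Bernstein approximation and half to rounding its
  coefficients. Rounding does not accumulate with the degree, because the Bernstein basis is
  nonnegative and sums to 1.\<close>

lemma rational_bernstein_dense:
  assumes T: "T > 0" and g: "continuous_on {0..T} g" and e: "e > 0"
  obtains cs where "\<And>t. t \<in> {0..T} \<Longrightarrow> \<bar>g t - rational_bernstein T cs t\<bar> < e"
proof -
  have "continuous_on {0..1} (\<lambda>x. g (T * x))"
    using T by (intro continuous_on_compose2[OF g]) (auto intro!: continuous_intros simp: mult_left_le)
  from Bernstein_Weierstrass[OF this, of "e / 2"] e obtain n where
    n: "\<And>x. x \<in> {0..1} \<Longrightarrow> \<bar>g (T * x) - (\<Sum>k\<le>n. g (T * (k / n)) * Bernstein n k x)\<bar> < e / 2"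
    by auto
  have "\<exists>c::rat. \<bar>g (T * (k / n)) - of_rat c\<bar> < e / 2" for k :: nat
  proof -
    obtain c where "g (T * (k / n)) - e / 2 < of_rat c" "of_rat c < g (T * (k / n)) + e / 2"
      using of_rat_dense[of "g (T * (k / n)) - e / 2" "g (T * (k / n)) + e / 2"] e by auto
    then show ?thesis by (intro exI[of _ c]) linarith
  qed
  then obtain c :: "nat \<Rightarrow> rat" where c: "\<And>k. \<bar>g (T * (real k / n)) - of_rat (c k)\<bar> < e / 2" by metis
  define cs where "cs = map c [0..<Suc n]"
  have len: "length cs - 1 = n" by (simp add: cs_def)
  have cs: "cs ! k = c k" if "k \<le> n" for k
    unfolding cs_def using that by (simp del: upt_Suc)
  show ?thesis
  proof (rule that[of cs])
    fix t assume t: "t \<in> {0..T}"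
    define x where "x = t / T"
    have x: "x \<in> {0..1}" "T * x = t" using t T by (auto simp: x_def)
    have "\<bar>(\<Sum>k\<le>n. g (T * (k / n)) * Bernstein n k x) - rational_bernstein T cs t\<bar>
        = \<bar>\<Sum>k\<le>n. (g (T * (k / n)) - of_rat (c k)) * Bernstein n k x\<bar>"
      unfolding rational_bernstein_def len x_def[symmetric]
      by (simp add: cs left_diff_distrib sum_subtractf)
    also have "\<dots> \<le> (\<Sum>k\<le>n. e / 2 * Bernstein n k x)"
    proof (rule order.trans[OF sum_abs sum_mono])
      fix k
      show "\<bar>(g (T * (k / n)) - of_rat (c k)) * Bernstein n k x\<bar> \<le> e / 2 * Bernstein n k x"
        unfolding abs_mult using c[of k] Bernstein_nonneg[of x n k] x e
        by (intro mult_mono) auto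
    qed
    also have "\<dots> = e / 2" unfolding sum_distrib_left[symmetric] sum_Bernstein by simp
    finally show "\<bar>g t - rational_bernstein T cs t\<bar> < e" using n[OF x(1), unfolded x(2)] by linarith
  qed
qed

lemma path_in_mspace:
  assumes "continuous_on {0..T} g"
  shows "(\<lambda>t\<in>{0..T}. g t) \<in> mspace (C_metric T)"
proof -
  have "continuous_on {0..T} (\<lambda>t\<in>{0..T}. g t)"
    by (rule continuous_on_eq[OF assms]) simp
  then show ?thesis by (simp add: mspace_C_metric)
qed

text \<open>Separability of \<open>C[0,T]\<close> is what makes the path map Borel measurable.\<close>

lemma measurable_path:
  assumes T: "T > 0" and X: "continuous_process M T X"
  shows "(\<lambda>\<omega>. \<lambda>t\<in>{0..T}. X t \<omega>) \<in> measurable M (C_borel T)"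
proof -
  let ?C = "mspace (C_metric T)"
  let ?f = "\<lambda>\<omega>. \<lambda>t\<in>{0..T}. X t \<omega>"
  have X_meas: "\<And>t. t \<in> {0..T} \<Longrightarrow> X t \<in> borel_measurable M"
    and X_cont: "\<And>\<omega>. \<omega> \<in> space M \<Longrightarrow> continuous_on {0..T} (\<lambda>t. X t \<omega>)"
    using X by (auto simp: continuous_process_def)
  have fC: "?f \<omega> \<in> ?C" if "\<omega> \<in> space M" for \<omega> using path_in_mspace[OF X_cont[OF that]] .
  define B where "B cs j = {y \<in> ?C. \<forall>t\<in>{0..T}. \<bar>y t - rational_bernstein T cs t\<bar> \<le> 1 / real (Suc j)}" for cs j
  have B_meas: "?f -` B cs j \<inter> space M \<in> sets M" for cs j
  proof -
    obtain D where D: "countable D" "D \<subseteq> {0..T}" "closure D = {0..T}" by (rule countable_dense_Icc)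
    let ?q = "rational_bernstein T cs" and ?r = "1 / real (Suc j)"
    \<comment> \<open>By continuity, the condition over all of \<open>{0..T}\<close> is decided on a
      countable dense set, and only countably many measurable conditions remain.\<close>
    have "?f -` B cs j \<inter> space M = {\<omega>\<in>space M. \<forall>t\<in>D. \<bar>X t \<omega> - ?q t\<bar> \<le> ?r}"
    proof (intro equalityI subsetI)
      fix \<omega> assume "\<omega> \<in> ?f -` B cs j \<inter> space M"
      then show "\<omega> \<in> {\<omega>\<in>space M. \<forall>t\<in>D. \<bar>X t \<omega> - ?q t\<bar> \<le> ?r}" using D(2) by (auto simp: B_def)
    next
      fix \<omega> assume w: "\<omega> \<in> {\<omega>\<in>space M. \<forall>t\<in>D. \<bar>X t \<omega> - ?q t\<bar> \<le> ?r}"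
      have "continuous_on (closure D) (\<lambda>t. \<bar>X t \<omega> - ?q t\<bar>)"
        unfolding D(3) rational_bernstein_def Bernstein_def using w T
        by (intro continuous_intros X_cont) auto
      from continuous_le_on_closure[OF this] w have "\<forall>t\<in>{0..T}. \<bar>X t \<omega> - ?q t\<bar> \<le> ?r"
        unfolding D(3) by auto
      then show "\<omega> \<in> ?f -` B cs j \<inter> space M" using w fC by (auto simp: B_def)
    qed
    also have "\<dots> \<in> sets M"
    proof (rule sets.sets_Collect_countable_All'[OF _ D(1)])
      fix t assume "t \<in> D"
      then have [measurable]: "X t \<in> borel_measurable M" using D X_meas by blast
      show "{\<omega>\<in>space M. \<bar>X t \<omega> - ?q t\<bar> \<le> ?r} \<in> sets M" by measurable
    qed
    finally show ?thesis .
  qed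
  show ?thesis unfolding C_borel_def
  proof (rule measurable_measure_of)
    show "{U. openin (mtopology_of (C_metric T)) U} \<subseteq> Pow ?C"
      using openin_subset by fastforce
    show "?f \<in> space M \<rightarrow> ?C" using fC by auto
    fix U assume "U \<in> {U. openin (mtopology_of (C_metric T)) U}"
    then have U: "U \<subseteq> ?C" "\<And>x. x \<in> U \<Longrightarrow> \<exists>r>0. \<forall>y\<in>?C. (\<forall>t\<in>{0..T}. \<bar>y t - x t\<bar> \<le> r) \<longrightarrow> y \<in> U"
      using openin_C_metric[of T U] T by auto
    have "U = (\<Union>p\<in>{p. B (fst p) (snd p) \<subseteq> U}. B (fst p) (snd p))"
    proof (intro equalityI subsetI)
      fix x assume x: "x \<in> U"
      then obtain r where r: "r > 0" "\<And>y. y \<in> ?C \<Longrightarrow> (\<forall>t\<in>{0..T}. \<bar>y t - x t\<bar> \<le> r) \<Longrightarrow> y \<in> U"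
        using U(2) by blast
      \<comment> \<open>A ball of radius below \<open>r / 2\<close> whose centre lies within that
        radius of \<open>x\<close> contains \<open>x\<close> and stays in the
        \<open>r\<close>-neighbourhood of \<open>x\<close>. So \<open>U\<close> is a union of such
        balls, indexed by a countable set of pairs.\<close>
      obtain j where j: "1 / real (Suc j) < r / 2" using r(1) nat_approx_posE[of "r / 2"] by auto
      have "continuous_on {0..T} x" using x U(1) by (auto simp: mspace_C_metric)
      then obtain cs where cs: "\<And>t. t \<in> {0..T} \<Longrightarrow> \<bar>x t - rational_bernstein T cs t\<bar> < 1 / real (Suc j)"
        using rational_bernstein_dense[OF T, of x "1 / real (Suc j)"] by auto
      have "x \<in> B cs j" using x U(1) cs by (auto simp: B_def intro: less_imp_le)
      moreover have "B cs j \<subseteq> U"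
      proof
        fix y assume y: "y \<in> B cs j"
        show "y \<in> U"
        proof (rule r(2))
          show "\<forall>t\<in>{0..T}. \<bar>y t - x t\<bar> \<le> r"
          proof
            fix t assume t: "t \<in> {0..T}"
            have "\<bar>y t - rational_bernstein T cs t\<bar> \<le> 1 / real (Suc j)" using y t by (simp add: B_def)
            then show "\<bar>y t - x t\<bar> \<le> r" using cs[OF t] j by linarith
          qed
        qed (use y in \<open>simp add: B_def\<close>)
      qed
      ultimately show "x \<in> (\<Union>p\<in>{p. B (fst p) (snd p) \<subseteq> U}. B (fst p) (snd p))"
        by (intro UN_I[of "(cs, j)"]) auto
    qed auto
    then have "?f -` U \<inter> space M = (\<Union>p\<in>{p. B (fst p) (snd p) \<subseteq> U}. ?f -` B (fst p) (snd p) \<inter> space M)"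
      by blast
    also have "\<dots> \<in> sets M"
      by (intro sets.countable_UN') (auto intro: B_meas)
    finally show "?f -` U \<inter> space M \<in> sets M" .
  qed
qed

text \<open>If the path map of \<open>Z\<close> is not measurable, then its \<^const>\<open>distr\<close> may be the zero measure; the
  equality of laws excludes this, since the law of \<open>X\<close> is a probability measure.\<close>

lemma is_version_AE:
  assumes M: "prob_space M" and P: "prob_space P" and T: "T > 0"
    and ver: "is_version M X P Z T" and E: "E \<in> sets (C_borel T)"
    and Z: "\<And>\<omega>. \<omega> \<in> space P \<Longrightarrow> (\<lambda>t\<in>{0..T}. Z t \<omega>) \<in> E"
  shows "AE \<omega> in M. (\<lambda>t\<in>{0..T}. X t \<omega>) \<in> E"
proof -
  interpret M: prob_space M by (rule M)
  interpret P: prob_space P by (rule P)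
  let ?f = "\<lambda>\<omega>. \<lambda>t\<in>{0..T}. X t \<omega>" and ?g = "\<lambda>\<omega>. \<lambda>t\<in>{0..T}. Z t \<omega>"
  have f: "?f \<in> measurable M (C_borel T)"
    using measurable_path[OF T] ver by (auto simp: is_version_def)
  have law: "distr M (C_borel T) ?f = distr P (C_borel T) ?g"
    using ver by (simp add: is_version_def path_law_def)
  let ?\<mu> = "\<lambda>A. emeasure P (?g -` A \<inter> space P)"
  have conv: "emeasure (distr P (C_borel T) ?g) B =
      (if B \<in> sets (C_borel T) \<and> measure_space (space (C_borel T)) (sets (C_borel T)) ?\<mu> then ?\<mu> B else 0)" for B
    unfolding distr_def emeasure_measure_of_conv by (simp add: sets.sigma_sets_eq)
  have "emeasure (distr M (C_borel T) ?f) (space (C_borel T)) = emeasure M (space M)"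
    using f by (subst emeasure_distr) (auto intro!: arg_cong[of _ _ "emeasure M"] dest: measurable_space)
  then have "emeasure (distr P (C_borel T) ?g) (space (C_borel T)) = 1"
    using law M.emeasure_space_1 by simp
  then have ms: "measure_space (space (C_borel T)) (sets (C_borel T)) ?\<mu>"
    using conv[of "space (C_borel T)"] by (auto split: if_splits)
  have "?g -` E \<inter> space P = space P" using Z by auto
  then have "emeasure (distr P (C_borel T) ?g) E = 1"
    using conv[of E] ms E P.emeasure_space_1 by simp
  then have "emeasure M (?f -` E \<inter> space M) = 1"
    using law emeasure_distr[OF f E] by simp
  then have "M.prob (?f -` E \<inter> space M) = 1" by (simp add: measure_def)
  then have "AE \<omega> in M. \<omega> \<in> ?f -` E \<inter> space M"
    by (rule M.AE_prob_1)
  then show ?thesis by eventually_elim simp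
qed

lemma uniform_transport_lipschitz:
  assumes P: "poisson_process P N" and w: "\<omega> \<in> space P" and "0 \<le> s" "s \<le> t"
  shows "\<bar>uniform_transport N A m t \<omega> - uniform_transport N A m s \<omega>\<bar> \<le> sqrt (real m) * (t - s)"
proof -
  let ?h = "\<lambda>u. (-1) ^ N (u * real m) \<omega> :: real"
  have mono: "mono_on {0..} (\<lambda>t. N t \<omega>)" using P w by (simp add: poisson_process_def)
  have int: "?h integrable_on {a..b}" if "0 \<le> a" for a b
  proof (rule measurable_bounded_by_integrable_imp_integrable)
    \<comment> \<open>Monotonicity of \<open>N\<close> is known for nonnegative times only. Clamping
      the time at 0 gives a function monotone on the whole line, hence Borel, which agrees with the
      original one on \<open>{a..b}\<close>.\<close>
    have "mono (\<lambda>u. real (N (max 0 u * real m) \<omega>))"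
      by (rule monoI) (auto intro!: mono_onD[OF mono] mult_right_mono)
    then have [measurable]: "(\<lambda>u. real (N (max 0 u * real m) \<omega>)) \<in> borel_measurable borel"
      by (rule borel_measurable_mono)
    have "(\<lambda>u. nat \<lfloor>real (N (max 0 u * real m) \<omega>)\<rfloor>) \<in> measurable borel (count_space UNIV)" by measurable
    then have "(\<lambda>u. N (max 0 u * real m) \<omega>) \<in> measurable borel (count_space UNIV)" by simp
    from measurable_compose[OF this, of "\<lambda>n. (-1) ^ n :: real" borel]
    have "(\<lambda>u. (-1) ^ N (max 0 u * real m) \<omega> :: real) \<in> borel_measurable borel" by simp
    then have "(\<lambda>u. (-1) ^ N (max 0 u * real m) \<omega> :: real) \<in> borel_measurable (lebesgue_on {a..b})"
      by (intro measurable_restrict_space1 measurable_completion) simp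
    moreover have "?h \<in> borel_measurable (lebesgue_on {a..b}) \<longleftrightarrow>
        (\<lambda>u. (-1) ^ N (max 0 u * real m) \<omega> :: real) \<in> borel_measurable (lebesgue_on {a..b})"
      using that by (intro measurable_cong) (auto simp: max_def)
    ultimately show "?h \<in> borel_measurable (lebesgue_on {a..b})" by blast
    show "(\<lambda>_. 1::real) integrable_on {a..b}" by (rule integrable_const_ivl)
  qed (auto simp: power_abs)
  have "integral {0..s} ?h + integral {s..t} ?h = integral {0..t} ?h"
    using assms by (intro Henstock_Kurzweil_Integration.integral_combine int) auto
  then have "uniform_transport N A m t \<omega> - uniform_transport N A m s \<omega>
      = sqrt (real m) * (-1) ^ (of_bool (A \<omega>) :: nat) * integral {s..t} ?h"
    unfolding uniform_transport_def by (metis add_diff_cancel_left' right_diff_distrib)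
  moreover have "norm (integral (cbox s t) ?h) \<le> 1 * measure lborel (cbox s t)"
    using int[OF \<open>0 \<le> s\<close>, of t]
    by (intro has_integral_bound[of 1 ?h]) (auto simp: power_abs)
  ultimately show ?thesis using assms by (simp add: abs_mult power_abs mult_left_mono)
qed

text \<open>The transport integrand takes only the values 1 and -1, which gives the slope bound for
  every path of the original process; equality of laws carries it over to almost every path of the
  version.\<close>

lemma uniform_transport_version_lipschitz:
  assumes M: "prob_space M" and P: "prob_space P" and T: "T > 0" and N: "poisson_process P N"
    and ver: "is_version M X P (uniform_transport N A m) T"
  shows "AE \<omega> in M. X 0 \<omega> = 0 \<and>
    (\<forall>x\<in>{0..T}. \<forall>y\<in>{0..T}. \<bar>X y \<omega> - X x \<omega>\<bar> \<le> sqrt (real m) * \<bar>y - x\<bar>)"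
proof -
  have "(\<lambda>t\<in>{0..T}. uniform_transport N A m t \<omega>) \<in> lipschitz_paths T (sqrt (real m))"
    if w: "\<omega> \<in> space P" for \<omega>
  proof -
    have lip: "\<bar>uniform_transport N A m y \<omega> - uniform_transport N A m x \<omega>\<bar> \<le> sqrt (real m) * \<bar>y - x\<bar>"
      if "x \<in> {0..T}" "y \<in> {0..T}" for x y
      using uniform_transport_lipschitz[OF N w, of x y A m] uniform_transport_lipschitz[OF N w, of y x A m] that
      by (cases "x \<le> y") (auto simp: abs_minus_commute)
    have "continuous_on {0..T} (\<lambda>t. uniform_transport N A m t \<omega>)"
      using lip by (intro lipschitz_on_continuous_on[of "sqrt (real m)"] lipschitz_onI)
        (auto simp: dist_real_def abs_minus_commute)
    from path_in_mspace[OF this] show ?thesis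
      using lip T by (auto simp: lipschitz_paths_def uniform_transport_def)
  qed
  from is_version_AE[OF M P T ver lipschitz_paths_sets this] T
  have "AE \<omega> in M. (\<lambda>t\<in>{0..T}. X t \<omega>) \<in> lipschitz_paths T (sqrt (real m))" by simp
  then show ?thesis by eventually_elim (use T in \<open>auto simp: lipschitz_paths_def\<close>)
qed

section \<open>Isometry and tail bound for sums of Brownian increments\<close>

lemma space_aug_filtration [simp]: "space (aug_filtration M W s) = space M"
  by (simp add: aug_filtration_def space_measure_of_conv)

lemma sets_aug_filtration:
  "sets (aug_filtration M W s) = sigma_sets (space M)
     ({W r -` B \<inter> space M | r B. r \<in> {0..s} \<and> B \<in> sets borel} \<union> null_sets M)"
proof -
  have "null_sets M \<subseteq> Pow (space M)" using sets.sets_into_space null_setsD2 by blast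
  then show ?thesis unfolding aug_filtration_def by (intro sets_measure_of Un_least) auto
qed

lemma sets_aug_filtration_mono:
  assumes "s \<le> t"
  shows "sets (aug_filtration M W s) \<subseteq> sets (aug_filtration M W t)"
proof -
  have "{0..s} \<subseteq> {0..t}" using assms by simp
  then show ?thesis unfolding sets_aug_filtration by (intro sigma_sets_mono' Un_mono order_refl) blast
qed

lemma measurable_aug_filtration_mono:
  assumes "X \<in> measurable (aug_filtration M W s) N" "s \<le> t"
  shows "X \<in> measurable (aug_filtration M W t) N"
  using sets_aug_filtration_mono[OF assms(2), of M W]
  by (intro measurable_from_subalg[OF _ assms(1)]) (simp add: subalgebra_def)

lemma measurable_aug_filtration_self:
  assumes "r \<in> {0..s}"
  shows "W r \<in> borel_measurable (aug_filtration M W s)"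
proof (rule measurableI)
  fix B :: "real set" assume "B \<in> sets borel"
  then show "W r -` B \<inter> space (aug_filtration M W s) \<in> sets (aug_filtration M W s)"
    unfolding sets_aug_filtration space_aug_filtration using assms
    by (intro sigma_sets.Basic UnI1 CollectI) blast
qed simp

locale brownian = prob_space M for M :: "'a measure" +
  fixes T :: real and W :: "real \<Rightarrow> 'a \<Rightarrow> real"
  assumes T_pos: "0 < T" and brownian: "brownian_motion M T W"
begin

lemma W_measurable: "t \<in> {0..T} \<Longrightarrow> W t \<in> borel_measurable M"
  using brownian by (simp add: brownian_motion_def continuous_process_def)

lemma W_continuous: "\<omega> \<in> space M \<Longrightarrow> continuous_on {0..T} (\<lambda>t. W t \<omega>)"
  using brownian by (simp add: brownian_motion_def continuous_process_def)

lemma W_0: "AE \<omega> in M. W 0 \<omega> = 0"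
  using brownian by (simp add: brownian_motion_def)

lemma aug_filtration_subset:
  assumes "s \<le> T"
  shows "sets (aug_filtration M W s) \<subseteq> events"
  unfolding sets_aug_filtration
proof (intro sets.sigma_sets_subset Un_least subsetI)
  fix x assume "x \<in> {W r -` B \<inter> space M | r B. r \<in> {0..s} \<and> B \<in> sets borel}"
  then obtain r B where "r \<in> {0..s}" "B \<in> sets borel" "x = W r -` B \<inter> space M" by blast
  then show "x \<in> events" using measurable_sets[OF W_measurable, of r B] assms by auto
qed auto

lemma subalgebra_aug_filtration: "s \<le> T \<Longrightarrow> subalgebra M (aug_filtration M W s)"
  using aug_filtration_subset by (simp add: subalgebra_def)

lemma measurable_aug_filtrationD:
  "X \<in> measurable (aug_filtration M W s) N \<Longrightarrow> s \<le> T \<Longrightarrow> X \<in> measurable M N"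
  using measurable_from_subalg subalgebra_aug_filtration by blast

text \<open>Independence is available for the increments over one partition of
  \<open>{0..T}\<close>. A partition through all points of \<open>S\<close> makes
  \<open>W r - W 0\<close> a sum of increments with index below \<open>n - 1\<close> for each
  \<open>r\<close> in \<open>S\<close>, while \<open>W t - W s\<close> is the increment with index
  \<open>n - 1\<close>.\<close>

lemma cylinder_increment_indep:
  assumes st: "0 \<le> s" "s \<le> t" "t \<le> T" and S: "finite S" "S \<subseteq> {0..s}"
    and B: "\<And>r. r \<in> S \<Longrightarrow> B r \<in> sets borel" and C: "C \<in> sets borel"
  shows "prob ({\<omega>\<in>space M. \<forall>r\<in>S. W r \<omega> \<in> B r} \<inter> ((\<lambda>\<omega>. W t \<omega> - W s \<omega>) -` C \<inter> space M)) =
    prob {\<omega>\<in>space M. \<forall>r\<in>S. W r \<omega> \<in> B r} * prob ((\<lambda>\<omega>. W t \<omega> - W s \<omega>) -` C \<inter> space M)"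
proof -
  \<comment> \<open>The inserted points force the partition to start at 0 and to have
    \<open>s\<close> directly before \<open>t\<close>. Coinciding points at the end do no harm,
    since \<open>partition_seq\<close> admits repetitions.\<close>
  define S' where "S' = insert 0 (insert s S)"
  define xs where "xs = sorted_list_of_set S'"
  define n where "n = length xs"
  define ys where "ys = xs @ [t, T]"
  define \<tau> where "\<tau> i = ys ! i" for i
  have fin: "finite S'" and sub: "S' \<subseteq> {0..s}" and ne: "S' \<noteq> {}" using S st by (auto simp: S'_def)
  have set_xs: "set xs = S'" and sorted_xs: "sorted xs" using fin by (simp_all add: xs_def)
  have n: "n \<ge> 1" using ne set_xs unfolding n_def by (cases xs) auto
  have sorted_ys: "sorted ys"
    unfolding ys_def using sorted_xs set_xs sub st by (fastforce simp: sorted_append)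
  have len: "length ys = Suc (Suc n)" by (simp add: ys_def n_def)
  have \<tau>_xs: "\<tau> i = xs ! i" if "i < n" for i using that by (simp add: \<tau>_def ys_def n_def nth_append)
  have \<tau>_mono: "\<tau> i \<le> \<tau> j" if "i \<le> j" "j \<le> Suc n" for i j
    unfolding \<tau>_def using sorted_ys that len by (simp add: sorted_iff_nth_mono)
  have mem: "\<tau> i \<in> {0..s}" if "i < n" for i
    using \<tau>_xs[OF that] that set_xs sub nth_mem[of i xs] by (auto simp: n_def)
  have \<tau>0: "\<tau> 0 = 0"
  proof -
    obtain i where i: "i < n" "xs ! i = 0" using set_xs unfolding S'_def n_def by (metis in_set_conv_nth insertI1)
    then show ?thesis using \<tau>_mono[of 0 i] \<tau>_xs[of i] mem[of 0] by auto
  qed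
  have \<tau>s: "\<tau> (n - 1) = s"
  proof -
    obtain i where i: "i < n" "xs ! i = s" using set_xs unfolding S'_def n_def by (metis in_set_conv_nth insertI1 insertI2)
    then have "s \<le> \<tau> (n - 1)" using \<tau>_mono[of i "n - 1"] \<tau>_xs[of i] by auto
    then show ?thesis using mem[of "n - 1"] n by auto
  qed
  have \<tau>t: "\<tau> n = t" and \<tau>T: "\<tau> (Suc n) = T" by (simp_all add: \<tau>_def ys_def n_def nth_append)
  have part: "partition_seq 0 T (Suc n) \<tau>"
    unfolding partition_seq_def using \<tau>0 \<tau>T \<tau>_mono by auto
  define X where "X i \<omega> = W (\<tau> (Suc i)) \<omega> - W (\<tau> i) \<omega>" for i \<omega>
  have "indep_vars (\<lambda>_. borel) X {..<Suc n}"
    using brownian part unfolding brownian_motion_def X_def by blast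
  from indep_var_restrict[OF this, of "{..<n - 1}" "{n - 1}"] n
  have ind: "indep_var (PiM {..<n - 1} (\<lambda>_. borel)) (\<lambda>\<omega>. restrict (\<lambda>i. X i \<omega>) {..<n - 1})
      (PiM {n - 1} (\<lambda>_. borel)) (\<lambda>\<omega>. restrict (\<lambda>i. X i \<omega>) {n - 1})" by auto
  have "\<exists>j. j < n \<and> \<tau> j = r" if "r \<in> S" for r
    using that set_xs \<tau>_xs unfolding S'_def n_def by (metis in_set_conv_nth insertI2)
  then obtain idx where idx: "\<And>r. r \<in> S \<Longrightarrow> idx r < n" "\<And>r. r \<in> S \<Longrightarrow> \<tau> (idx r) = r" by metis
  define E where "E = {x \<in> space (PiM {..<n - 1} (\<lambda>_. borel)). \<forall>r\<in>S. (\<Sum>i<idx r. x i) \<in> B r}"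
  have E: "E \<in> sets (PiM {..<n - 1} (\<lambda>_. borel))"
    unfolding E_def
  proof (intro sets.sets_Collect_finite_All S)
    fix r assume r: "r \<in> S"
    have m: "(\<lambda>x. \<Sum>i<idx r. x i :: real) \<in> borel_measurable (PiM {..<n - 1} (\<lambda>_. borel))"
      using idx(1)[OF r] by (intro borel_measurable_sum measurable_component_singleton) auto
    have "(\<lambda>x. \<Sum>i<idx r. x i :: real) -` B r \<inter> space (PiM {..<n - 1} (\<lambda>_. borel)) \<in> sets (PiM {..<n - 1} (\<lambda>_. borel))"
      by (rule measurable_sets[OF m B[OF r]])
    also have "(\<lambda>x. \<Sum>i<idx r. x i :: real) -` B r \<inter> space (PiM {..<n - 1} (\<lambda>_. borel))
        = {x \<in> space (PiM {..<n - 1} (\<lambda>_. borel)). (\<Sum>i<idx r. x i) \<in> B r}" by auto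
    finally show "{x \<in> space (PiM {..<n - 1} (\<lambda>_. borel)). (\<Sum>i<idx r. x i) \<in> B r} \<in> sets (PiM {..<n - 1} (\<lambda>_. borel))" .
  qed
  define D where "D = {x \<in> space (PiM {n - 1} (\<lambda>_. borel :: real measure)). x (n - 1) \<in> C}"
  have D: "D \<in> sets (PiM {n - 1} (\<lambda>_. borel))"
  proof -
    have "(\<lambda>x. x (n - 1) :: real) \<in> borel_measurable (PiM {n - 1} (\<lambda>_. borel))"
      by (intro measurable_component_singleton) auto
    from measurable_sets[OF this C] show ?thesis unfolding D_def
      by (simp add: vimage_def Int_def conj_commute)
  qed
  let ?A = "{\<omega>\<in>space M. \<forall>r\<in>S. W r \<omega> \<in> B r}"
  \<comment> \<open>Increments see the path only relative to its start. This is the cylinder event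
    in that form; it agrees with \<open>?A\<close> up to a null set because \<open>W 0\<close>
    vanishes almost surely.\<close>
  let ?A' = "{\<omega>\<in>space M. \<forall>r\<in>S. W r \<omega> - W 0 \<omega> \<in> B r}"
  let ?I = "(\<lambda>\<omega>. W t \<omega> - W s \<omega>) -` C \<inter> space M"
  have sum: "(\<Sum>i<idx r. (\<lambda>i\<in>{..<n - 1}. X i \<omega>) i) = W r \<omega> - W 0 \<omega>" if "r \<in> S" for r \<omega>
  proof -
    have "(\<Sum>i<idx r. (\<lambda>i\<in>{..<n - 1}. X i \<omega>) i) = (\<Sum>i<idx r. X i \<omega>)"
      using idx(1)[OF that] by (intro sum.cong) auto
    also have "\<dots> = W (\<tau> (idx r)) \<omega> - W (\<tau> 0) \<omega>"
      unfolding X_def by (rule sum_lessThan_telescope)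
    finally show ?thesis using idx(2)[OF that] \<tau>0 by simp
  qed
  have A': "(\<lambda>\<omega>. restrict (\<lambda>i. X i \<omega>) {..<n - 1}) -` E \<inter> space M = ?A'"
    unfolding E_def using sum by (auto simp: space_PiM)
  have Xn: "X (n - 1) = (\<lambda>\<omega>. W t \<omega> - W s \<omega>)" using n \<tau>s \<tau>t by (simp add: X_def fun_eq_iff)
  have I: "(\<lambda>\<omega>. restrict (\<lambda>i. X i \<omega>) {n - 1}) -` D \<inter> space M = ?I"
    unfolding D_def Xn[symmetric] by (auto simp: space_PiM)
  have "(\<lambda>\<omega>. (restrict (\<lambda>i. X i \<omega>) {..<n - 1}, restrict (\<lambda>i. X i \<omega>) {n - 1})) -` (E \<times> D) \<inter> space M = ?A' \<inter> ?I"
    using A' I by blast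
  with indep_varD[OF ind E D] have eq: "prob (?A' \<inter> ?I) = prob ?A' * prob ?I" unfolding A' I by simp
  have W_meas: "W r \<in> borel_measurable M" if "r \<in> S \<union> {0, s, t}" for r
    using that st S by (intro W_measurable) auto
  have mA: "?A \<in> events"
  proof (intro sets.sets_Collect_finite_All S)
    fix r assume r: "r \<in> S"
    show "{\<omega> \<in> space M. W r \<omega> \<in> B r} \<in> events"
      using measurable_sets[OF W_meas B[OF r]] r by (simp add: vimage_def Int_def conj_commute)
  qed
  have mA': "?A' \<in> events"
  proof (intro sets.sets_Collect_finite_All S)
    fix r assume r: "r \<in> S"
    have "(\<lambda>\<omega>. W r \<omega> - W 0 \<omega>) \<in> borel_measurable M"
      using r by (intro borel_measurable_diff W_meas) auto
    from measurable_sets[OF this B[OF r]]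
    show "{\<omega> \<in> space M. W r \<omega> - W 0 \<omega> \<in> B r} \<in> events" by (simp add: vimage_def Int_def conj_commute)
  qed
  have mI: "?I \<in> events"
    by (rule measurable_sets[OF borel_measurable_diff[OF W_meas W_meas] C]) auto
  have AE: "AE \<omega> in M. \<omega> \<in> ?A \<longleftrightarrow> \<omega> \<in> ?A'"
    using W_0 by eventually_elim simp
  then have "prob ?A = prob ?A'"
    by (rule measure_eq_AE) (use mA mA' in auto)
  moreover have "AE \<omega> in M. \<omega> \<in> ?A \<inter> ?I \<longleftrightarrow> \<omega> \<in> ?A' \<inter> ?I"
    using AE by eventually_elim blast
  then have "prob (?A \<inter> ?I) = prob (?A' \<inter> ?I)"
    by (rule measure_eq_AE) (use mA mA' mI in auto)
  ultimately show ?thesis using eq by simp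
qed

text \<open>Cylinder events and increment events are two intersection-stable generators, so the
  product formula passes to the generated sigma-algebras. The null sets of the augmentation join the
  cylinders as generators; for them the formula reads 0 = 0.\<close>

lemma increment_indep_filtration:
  assumes st: "0 \<le> s" "s \<le> t" "t \<le> T"
  shows "indep_set (sets (aug_filtration M W s))
    (sigma_sets (space M) {(\<lambda>\<omega>. W t \<omega> - W s \<omega>) -` C \<inter> space M | C. C \<in> sets borel})"
proof -
  define cyl where "cyl S B = {\<omega>\<in>space M. \<forall>r\<in>S. W r \<omega> \<in> B r}" for S :: "real set" and B :: "real \<Rightarrow> real set"
  define Cyl where "Cyl = {cyl S B | S B. finite S \<and> S \<subseteq> {0..s} \<and> (\<forall>r\<in>S. B r \<in> sets borel)} \<union> null_sets M"
  define Inc where "Inc = {(\<lambda>\<omega>. W t \<omega> - W s \<omega>) -` C \<inter> space M | C. C \<in> sets (borel :: real measure)}"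
  have W_meas: "W r \<in> borel_measurable M" if "r \<in> {0..s} \<union> {s, t}" for r
    using that st by (intro W_measurable) auto
  have cyl_ev: "cyl S B \<in> events" if "finite S" "S \<subseteq> {0..s}" "\<forall>r\<in>S. B r \<in> sets borel" for S B
    unfolding cyl_def
  proof (intro sets.sets_Collect_finite_All that)
    fix r assume r: "r \<in> S"
    show "{\<omega> \<in> space M. W r \<omega> \<in> B r} \<in> events"
      using measurable_sets[OF W_meas, of r "B r"] r that by (auto simp add: vimage_def Int_def conj_commute)
  qed
  have Inc_ev: "Inc \<subseteq> events"
    unfolding Inc_def by (auto intro!: measurable_sets borel_measurable_diff W_meas)
  have Cyl_ev: "Cyl \<subseteq> events" unfolding Cyl_def using cyl_ev by auto
  have "indep_set Cyl Inc"
  proof (rule indep_setI)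
    fix a b assume a: "a \<in> Cyl" and b: "b \<in> Inc"
    show "prob (a \<inter> b) = prob a * prob b"
    proof (cases "a \<in> null_sets M")
      case True
      then have "a \<inter> b \<in> null_sets M" using b Inc_ev by (intro null_set_Int2) auto
      with True show ?thesis by (simp add: null_sets_def measure_def)
    next
      case False
      with a obtain S B where "a = cyl S B" "finite S" "S \<subseteq> {0..s}" "\<forall>r\<in>S. B r \<in> sets borel"
        unfolding Cyl_def by blast
      moreover from b obtain C where "C \<in> sets borel" "b = (\<lambda>\<omega>. W t \<omega> - W s \<omega>) -` C \<inter> space M"
        unfolding Inc_def by blast
      ultimately show ?thesis
        using cylinder_increment_indep[OF st, of S B C] unfolding cyl_def by simp
    qed
  qed (use Inc_ev Cyl_ev in auto)
  moreover have "Int_stable Cyl"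
  proof (rule Int_stableI)
    fix a b assume a: "a \<in> Cyl" and b: "b \<in> Cyl"
    show "a \<inter> b \<in> Cyl"
    proof (cases "a \<in> null_sets M \<or> b \<in> null_sets M")
      case True
      then have "a \<inter> b \<in> null_sets M" using a b Cyl_ev by (auto intro: null_set_Int1 null_set_Int2)
      then show ?thesis by (simp add: Cyl_def)
    next
      case False
      with a b obtain S B S' B' where *: "a = cyl S B" "finite S" "S \<subseteq> {0..s}" "\<forall>r\<in>S. B r \<in> sets borel"
          "b = cyl S' B'" "finite S'" "S' \<subseteq> {0..s}" "\<forall>r\<in>S'. B' r \<in> sets borel"
        unfolding Cyl_def by blast
      \<comment> \<open>The cylinders may constrain different times; the default \<open>UNIV\<close>
        extends both to the common set of times.\<close>
      then have "a \<inter> b = cyl (S \<union> S') (\<lambda>r. (if r \<in> S then B r else UNIV) \<inter> (if r \<in> S' then B' r else UNIV))"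
        unfolding cyl_def by auto
      moreover have "\<forall>r\<in>S \<union> S'. (if r \<in> S then B r else UNIV) \<inter> (if r \<in> S' then B' r else UNIV) \<in> sets borel"
        using * by auto
      ultimately show ?thesis unfolding Cyl_def using * by blast
    qed
  qed
  moreover have "Int_stable Inc"
  proof (rule Int_stableI)
    fix a b assume "a \<in> Inc" "b \<in> Inc"
    then obtain C C' where "C \<in> sets borel" "C' \<in> sets borel"
      "a = (\<lambda>\<omega>. W t \<omega> - W s \<omega>) -` C \<inter> space M" "b = (\<lambda>\<omega>. W t \<omega> - W s \<omega>) -` C' \<inter> space M"
      unfolding Inc_def by blast
    then show "a \<inter> b \<in> Inc" unfolding Inc_def by (intro CollectI exI[of _ "C \<inter> C'"]) auto
  qed
  ultimately have ind: "indep_set (sigma_sets (space M) Cyl) (sigma_sets (space M) Inc)"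
    by (rule indep_set_sigma_sets)
  have "{W r -` B \<inter> space M | r B. r \<in> {0..s} \<and> B \<in> sets borel} \<union> null_sets M \<subseteq> Cyl"
  proof (intro Un_least subsetI)
    fix x assume "x \<in> {W r -` B \<inter> space M | r B. r \<in> {0..s} \<and> B \<in> sets borel}"
    then obtain r B where "r \<in> {0..s}" "B \<in> sets borel" "x = W r -` B \<inter> space M" by blast
    then show "x \<in> Cyl" unfolding Cyl_def cyl_def
      by (intro UnI1 CollectI exI[of _ "{r}"] exI[of _ "\<lambda>_. B"]) auto
  qed (simp add: Cyl_def)
  then have "sets (aug_filtration M W s) \<subseteq> sigma_sets (space M) Cyl"
    unfolding sets_aug_filtration by (rule sigma_sets_mono')
  with ind show ?thesis unfolding indep_sets2_eq Inc_def by blast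
qed

lemma indep_var_increment:
  assumes st: "0 \<le> s" "s \<le> t" "t \<le> T" and X: "X \<in> borel_measurable (aug_filtration M W s)"
  shows "indep_var borel X borel (\<lambda>\<omega>. W t \<omega> - W s \<omega>)"
  unfolding indep_var_eq
proof (intro conjI)
  show "X \<in> borel_measurable M" using measurable_aug_filtrationD[OF X] st by simp
  show "(\<lambda>\<omega>. W t \<omega> - W s \<omega>) \<in> borel_measurable M"
    using st by (intro borel_measurable_diff W_measurable) auto
  have "sigma_sets (space M) {X -` A \<inter> space M | A. A \<in> sets borel} \<subseteq> sets (aug_filtration M W s)"
    using sets.sigma_sets_subset[of "{X -` A \<inter> space M | A. A \<in> sets borel}" "aug_filtration M W s"]
      measurable_sets[OF X] by auto
  with increment_indep_filtration[OF st]
  show "indep_set (sigma_sets (space M) {X -` A \<inter> space M |A. A \<in> sets borel})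
     (sigma_sets (space M) {(\<lambda>\<omega>. W t \<omega> - W s \<omega>) -` A \<inter> space M |A. A \<in> sets borel})"
    unfolding indep_sets2_eq by blast
qed

lemma increment_moments:
  assumes st: "0 \<le> s" "s \<le> t" "t \<le> T"
  shows "integrable M (\<lambda>\<omega>. W t \<omega> - W s \<omega>)" "expectation (\<lambda>\<omega>. W t \<omega> - W s \<omega>) = 0"
    "integrable M (\<lambda>\<omega>. (W t \<omega> - W s \<omega>)\<^sup>2)" "expectation (\<lambda>\<omega>. (W t \<omega> - W s \<omega>)\<^sup>2) = t - s"
proof -
  \<comment> \<open>The normal law is given for \<open>s < t\<close> only, whereas partitions with
    repeated points also produce increments of length 0.\<close>
  consider "s = t" | "s < t" using st by linarith
  then have "integrable M (\<lambda>\<omega>. W t \<omega> - W s \<omega>) \<and> expectation (\<lambda>\<omega>. W t \<omega> - W s \<omega>) = 0 \<and>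
    integrable M (\<lambda>\<omega>. (W t \<omega> - W s \<omega>)\<^sup>2) \<and> expectation (\<lambda>\<omega>. (W t \<omega> - W s \<omega>)\<^sup>2) = t - s"
  proof cases
    case 2
    define v where "v = sqrt (t - s)"
    have v: "v > 0" "v\<^sup>2 = t - s" using 2 by (auto simp: v_def)
    have D: "distributed M lborel (\<lambda>\<omega>. W t \<omega> - W s \<omega>) (normal_density 0 v)"
      using brownian st 2 unfolding brownian_motion_def v_def by blast
    have i: "integrable M (\<lambda>\<omega>. (W t \<omega> - W s \<omega>) ^ k)" for k
      using integrable_normal_moment[OF v(1), of 0 k]
        distributed_integrable[OF D, of "\<lambda>x. x ^ k"] by simp
    have e: "expectation (\<lambda>\<omega>. W t \<omega> - W s \<omega>) = 0"
      by (rule normal_distributed_expectation[OF v(1) D])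
    have "expectation (\<lambda>\<omega>. (W t \<omega> - W s \<omega>)\<^sup>2) = t - s"
      using normal_distributed_variance[OF v(1) D] unfolding e v(2) by simp
    with i[of 1] i[of 2] e show ?thesis by simp
  qed simp
  then show "integrable M (\<lambda>\<omega>. W t \<omega> - W s \<omega>)" "expectation (\<lambda>\<omega>. W t \<omega> - W s \<omega>) = 0"
    "integrable M (\<lambda>\<omega>. (W t \<omega> - W s \<omega>)\<^sup>2)" "expectation (\<lambda>\<omega>. (W t \<omega> - W s \<omega>)\<^sup>2) = t - s" by auto
qed

lemma simple_sum_measurable:
  assumes part: "partition_seq 0 t N \<tau>" "t \<le> T" and "k \<le> N"
    and meas: "\<And>i. i < N \<Longrightarrow> \<eta> i \<in> borel_measurable (aug_filtration M W (\<tau> i))"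
  shows "(\<lambda>\<omega>. \<Sum>i<k. \<eta> i \<omega> * (W (\<tau> (Suc i)) \<omega> - W (\<tau> i) \<omega>)) \<in> borel_measurable (aug_filtration M W (\<tau> k))"
proof (rule borel_measurable_sum)
  fix i assume i: "i \<in> {..<k}"
  then have le: "\<tau> i \<le> \<tau> k" "\<tau> (Suc i) \<le> \<tau> k" "0 \<le> \<tau> i" "\<tau> i \<le> \<tau> (Suc i)"
    using partition_seq_mono[OF part(1)] partition_seq_step[OF part(1), of i] \<open>k \<le> N\<close> by auto
  have "\<eta> i \<in> borel_measurable (aug_filtration M W (\<tau> k))"
    using meas[of i] le i \<open>k \<le> N\<close> by (intro measurable_aug_filtration_mono[OF _ le(1)]) auto
  then show "(\<lambda>\<omega>. \<eta> i \<omega> * (W (\<tau> (Suc i)) \<omega> - W (\<tau> i) \<omega>)) \<in> borel_measurable (aug_filtration M W (\<tau> k))"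
    using le by (intro borel_measurable_times borel_measurable_diff measurable_aug_filtration_self) auto
qed

text \<open>In the square of a sum extended by one step, the cross term contains a factor known at
  time \<open>\<tau> k\<close> times the next increment, which is independent of it and has mean 0.
  In the last term the squared increment is independent of the squared coefficient and has the step
  length as its mean. The bounds \<open>B i\<close> secure integrability.\<close>

lemma ito_isometry:
  assumes part: "partition_seq 0 t N \<tau>" "t \<le> T"
    and meas: "\<And>i. i < N \<Longrightarrow> \<eta> i \<in> borel_measurable (aug_filtration M W (\<tau> i))"
    and bdd: "\<And>i \<omega>. i < N \<Longrightarrow> \<omega> \<in> space M \<Longrightarrow> \<bar>\<eta> i \<omega>\<bar> \<le> B i"
  shows "k \<le> N \<Longrightarrow> integrable M (\<lambda>\<omega>. (\<Sum>i<k. \<eta> i \<omega> * (W (\<tau> (Suc i)) \<omega> - W (\<tau> i) \<omega>))\<^sup>2) \<and>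
    expectation (\<lambda>\<omega>. (\<Sum>i<k. \<eta> i \<omega> * (W (\<tau> (Suc i)) \<omega> - W (\<tau> i) \<omega>))\<^sup>2)
      = expectation (\<lambda>\<omega>. \<Sum>i<k. (\<eta> i \<omega>)\<^sup>2 * (\<tau> (Suc i) - \<tau> i))"
proof (induction k)
  case (Suc k)
  define V where "V \<omega> = (\<Sum>i<k. \<eta> i \<omega> * (W (\<tau> (Suc i)) \<omega> - W (\<tau> i) \<omega>))" for \<omega>
  define d where "d \<omega> = W (\<tau> (Suc k)) \<omega> - W (\<tau> k) \<omega>" for \<omega>
  have k: "k < N" "k \<le> N" using Suc.prems by auto
  have le: "0 \<le> \<tau> k" "\<tau> k \<le> \<tau> (Suc k)" "\<tau> (Suc k) \<le> T" "\<tau> k \<le> T"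
    using partition_seq_step[OF part(1) k(1)] part(2) by auto
  have d_eq: "d = (\<lambda>\<omega>. W (\<tau> (Suc k)) \<omega> - W (\<tau> k) \<omega>)" by (simp add: d_def fun_eq_iff)
  note mom = increment_moments[OF le(1-3), folded d_def]
  have IH: "integrable M (\<lambda>\<omega>. (V \<omega>)\<^sup>2)"
    "expectation (\<lambda>\<omega>. (V \<omega>)\<^sup>2) = expectation (\<lambda>\<omega>. \<Sum>i<k. (\<eta> i \<omega>)\<^sup>2 * (\<tau> (Suc i) - \<tau> i))"
    using Suc.IH k unfolding V_def by auto
  have Vm: "V \<in> borel_measurable (aug_filtration M W (\<tau> k))"
    unfolding V_def by (rule simple_sum_measurable[OF part k(2) meas])
  have \<eta>m: "\<eta> k \<in> borel_measurable (aug_filtration M W (\<tau> k))" using meas k by auto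
  have VM: "V \<in> borel_measurable M" and \<eta>M: "\<eta> k \<in> borel_measurable M"
    by (rule measurable_aug_filtrationD[OF Vm le(4)], rule measurable_aug_filtrationD[OF \<eta>m le(4)])
  have Vi: "integrable M V" by (rule square_integrable_imp_integrable[OF VM IH(1)])
  have V\<eta>i: "integrable M (\<lambda>\<omega>. V \<omega> * \<eta> k \<omega>)"
  proof (rule Bochner_Integration.integrable_bound[of M "\<lambda>\<omega>. B k * V \<omega>"])
    show "AE \<omega> in M. norm (V \<omega> * \<eta> k \<omega>) \<le> norm (B k * V \<omega>)"
    proof (rule AE_I2)
      fix \<omega> assume "\<omega> \<in> space M"
      then have "\<bar>\<eta> k \<omega>\<bar> \<le> \<bar>B k\<bar>" using bdd[OF k(1), of \<omega>] by linarith
      then show "norm (V \<omega> * \<eta> k \<omega>) \<le> norm (B k * V \<omega>)"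
        using mult_right_mono[of _ _ "\<bar>V \<omega>\<bar>", OF _ abs_ge_zero] by (simp add: abs_mult) (metis mult.commute)
    qed
  qed (use Vi VM \<eta>M in auto)
  have \<eta>2b: "(\<eta> i \<omega>)\<^sup>2 \<le> (B i)\<^sup>2" if "i < N" "\<omega> \<in> space M" for i \<omega>
    using power_mono[OF bdd[OF that] abs_ge_zero, of 2] by simp
  have \<eta>2i: "integrable M (\<lambda>\<omega>. (\<eta> i \<omega>)\<^sup>2)" if "i < N" for i
  proof (rule integrable_const_bound[of _ "(B i)\<^sup>2"])
    show "AE \<omega> in M. norm ((\<eta> i \<omega>)\<^sup>2) \<le> (B i)\<^sup>2" using \<eta>2b[OF that] by (intro AE_I2) simp
    have "\<tau> i \<le> T" using partition_seq_range[OF part(1), of i] that part(2) by simp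
    then show "(\<lambda>\<omega>. (\<eta> i \<omega>)\<^sup>2) \<in> borel_measurable M"
      using measurable_aug_filtrationD[OF meas[OF that]] by simp
  qed
  have ind1: "indep_var borel (\<lambda>\<omega>. V \<omega> * \<eta> k \<omega>) borel d"
    unfolding d_eq by (intro indep_var_increment le(1-3) borel_measurable_times Vm \<eta>m)
  have "indep_var borel (\<eta> k) borel d"
    unfolding d_eq by (intro indep_var_increment le(1-3) \<eta>m)
  from indep_var_compose[OF this, of "\<lambda>x. x\<^sup>2" borel "\<lambda>x. x\<^sup>2" borel]
  have ind2: "indep_var borel (\<lambda>\<omega>. (\<eta> k \<omega>)\<^sup>2) borel (\<lambda>\<omega>. (d \<omega>)\<^sup>2)" by (simp add: comp_def)
  have i1: "integrable M (\<lambda>\<omega>. V \<omega> * \<eta> k \<omega> * d \<omega>)"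
    and e1: "expectation (\<lambda>\<omega>. V \<omega> * \<eta> k \<omega> * d \<omega>) = 0"
    using indep_var_integrable[OF ind1 V\<eta>i mom(1)] indep_var_lebesgue_integral[OF ind1 V\<eta>i mom(1)] mom(2) by auto
  have i2: "integrable M (\<lambda>\<omega>. (\<eta> k \<omega>)\<^sup>2 * (d \<omega>)\<^sup>2)"
    and e2: "expectation (\<lambda>\<omega>. (\<eta> k \<omega>)\<^sup>2 * (d \<omega>)\<^sup>2) = expectation (\<lambda>\<omega>. (\<eta> k \<omega>)\<^sup>2) * (\<tau> (Suc k) - \<tau> k)"
    using indep_var_integrable[OF ind2 \<eta>2i[OF k(1)] mom(3)]
      indep_var_lebesgue_integral[OF ind2 \<eta>2i[OF k(1)] mom(3)] mom(4) by auto
  have sq: "(\<Sum>i<Suc k. \<eta> i \<omega> * (W (\<tau> (Suc i)) \<omega> - W (\<tau> i) \<omega>))\<^sup>2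
      = ((V \<omega>)\<^sup>2 + 2 * (V \<omega> * \<eta> k \<omega> * d \<omega>)) + (\<eta> k \<omega>)\<^sup>2 * (d \<omega>)\<^sup>2" for \<omega>
    unfolding V_def d_def sum.lessThan_Suc by (simp add: power2_eq_square algebra_simps)
  have i3: "integrable M (\<lambda>\<omega>. \<Sum>i<k. (\<eta> i \<omega>)\<^sup>2 * (\<tau> (Suc i) - \<tau> i))"
    using \<eta>2i k by (intro Bochner_Integration.integrable_sum integrable_mult_left) auto
  show ?case unfolding sq
  proof
    show "integrable M (\<lambda>\<omega>. ((V \<omega>)\<^sup>2 + 2 * (V \<omega> * \<eta> k \<omega> * d \<omega>)) + (\<eta> k \<omega>)\<^sup>2 * (d \<omega>)\<^sup>2)"
      by (intro Bochner_Integration.integrable_add IH(1) integrable_mult_right i1 i2)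
    show "expectation (\<lambda>\<omega>. ((V \<omega>)\<^sup>2 + 2 * (V \<omega> * \<eta> k \<omega> * d \<omega>)) + (\<eta> k \<omega>)\<^sup>2 * (d \<omega>)\<^sup>2)
        = expectation (\<lambda>\<omega>. \<Sum>i<Suc k. (\<eta> i \<omega>)\<^sup>2 * (\<tau> (Suc i) - \<tau> i))"
    proof -
      have "expectation (\<lambda>\<omega>. ((V \<omega>)\<^sup>2 + 2 * (V \<omega> * \<eta> k \<omega> * d \<omega>)) + (\<eta> k \<omega>)\<^sup>2 * (d \<omega>)\<^sup>2)
          = expectation (\<lambda>\<omega>. (V \<omega>)\<^sup>2 + 2 * (V \<omega> * \<eta> k \<omega> * d \<omega>)) + expectation (\<lambda>\<omega>. (\<eta> k \<omega>)\<^sup>2 * (d \<omega>)\<^sup>2)"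
        by (intro Bochner_Integration.integral_add Bochner_Integration.integrable_add IH(1) integrable_mult_right i1 i2)
      also have "expectation (\<lambda>\<omega>. (V \<omega>)\<^sup>2 + 2 * (V \<omega> * \<eta> k \<omega> * d \<omega>)) = expectation (\<lambda>\<omega>. (V \<omega>)\<^sup>2)"
        by (subst Bochner_Integration.integral_add[OF IH(1) integrable_mult_right[OF i1]]) (simp add: e1)
      finally show ?thesis
        unfolding sum.lessThan_Suc e2 IH(2)
        by (subst Bochner_Integration.integral_add[OF i3 integrable_mult_left[OF \<eta>2i[OF k(1)]]]) simp
    qed
  qed
qed simp

text \<open>Stop adding increments as soon as the quadratic weight exceeds \<open>d\<close>: the stopped sum has
  second moment at most \<open>d\<close> and differs from the original one only if the total weight exceeds \<open>d\<close>.\<close>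

lemma simple_sum_tail_bound:
  assumes part: "partition_seq 0 t N \<tau>" "t \<le> T"
    and meas: "\<And>i. i < N \<Longrightarrow> \<eta> i \<in> borel_measurable (aug_filtration M W (\<tau> i))"
    and d: "d > 0" and e: "e > 0"
  shows "prob {\<omega>\<in>space M. \<bar>\<Sum>i<N. \<eta> i \<omega> * (W (\<tau> (Suc i)) \<omega> - W (\<tau> i) \<omega>)\<bar> > e}
    \<le> d / e\<^sup>2 + prob {\<omega>\<in>space M. (\<Sum>i<N. (\<eta> i \<omega>)\<^sup>2 * (\<tau> (Suc i) - \<tau> i)) > d}"
proof -
  have step: "0 \<le> \<tau> i" "\<tau> i \<le> \<tau> (Suc i)" "\<tau> (Suc i) \<le> T" "\<tau> i \<le> T" if "i < N" for i
    using partition_seq_step[OF part(1) that] part(2) by auto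
  define Q where "Q k \<omega> = (\<Sum>i<k. (\<eta> i \<omega>)\<^sup>2 * (\<tau> (Suc i) - \<tau> i))" for k \<omega>
  \<comment> \<open>The stopping test looks at \<open>Q (Suc i)\<close>, which contains
    \<open>\<eta> i\<close> and deterministic lengths only, so it is already decided at time
    \<open>\<tau> i\<close>. Requiring a step of positive length gives the bound needed by the
    isometry although \<open>\<eta>\<close> itself may be unbounded; on degenerate steps the
    increment is 0 anyway.\<close>
  define \<zeta> where "\<zeta> i \<omega> = (if Q (Suc i) \<omega> \<le> d \<and> \<tau> i < \<tau> (Suc i) then \<eta> i \<omega> else 0)" for i \<omega>
  have Q_mono: "Q i \<omega> \<le> Q j \<omega>" if "i \<le> j" "j \<le> N" for i j \<omega>
    unfolding Q_def using that step by (intro sum_mono2) (auto intro!: mult_nonneg_nonneg)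
  have \<eta>_mono: "\<eta> l \<in> borel_measurable (aug_filtration M W (\<tau> i))" if "l \<le> i" "i < N" for l i
    using that partition_seq_mono[OF part(1), of l i] by (intro measurable_aug_filtration_mono[OF meas]) auto
  have \<zeta>_meas: "\<zeta> i \<in> borel_measurable (aug_filtration M W (\<tau> i))" if "i < N" for i
  proof -
    have "Q (Suc i) \<in> borel_measurable (aug_filtration M W (\<tau> i))"
      unfolding Q_def using \<eta>_mono that by (intro borel_measurable_sum borel_measurable_times borel_measurable_power) auto
    then show ?thesis unfolding \<zeta>_def using meas[OF that] by measurable
  qed
  have \<zeta>_bdd: "\<bar>\<zeta> i \<omega>\<bar> \<le> sqrt (d / (\<tau> (Suc i) - \<tau> i))" if i: "i < N" for i \<omega>
  proof (cases "Q (Suc i) \<omega> \<le> d \<and> \<tau> i < \<tau> (Suc i)")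
    case True
    have "0 \<le> Q i \<omega>" using Q_mono[of 0 i \<omega>] i by (simp add: Q_def)
    then have "(\<eta> i \<omega>)\<^sup>2 * (\<tau> (Suc i) - \<tau> i) \<le> d" using True by (simp add: Q_def)
    then have "(\<eta> i \<omega>)\<^sup>2 \<le> d / (\<tau> (Suc i) - \<tau> i)" using True by (simp add: field_simps)
    then show ?thesis using True by (simp add: \<zeta>_def real_le_rsqrt)
  next
    case False
    then show ?thesis using d step[OF i] by (auto simp: \<zeta>_def)
  qed
  have \<zeta>_sum: "(\<Sum>i<k. (\<zeta> i \<omega>)\<^sup>2 * (\<tau> (Suc i) - \<tau> i)) \<le> d" if "k \<le> N" for k \<omega>
    using that
  proof (induction k)
    case (Suc k)
    show ?case
    proof (cases "Q (Suc k) \<omega> \<le> d")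
      case True
      have "(\<Sum>i<Suc k. (\<zeta> i \<omega>)\<^sup>2 * (\<tau> (Suc i) - \<tau> i)) \<le> Q (Suc k) \<omega>"
        unfolding Q_def using step Suc.prems by (intro sum_mono) (auto simp: \<zeta>_def)
      then show ?thesis using True by linarith
    next
      case False
      then show ?thesis using Suc by (simp add: \<zeta>_def)
    qed
  qed (use d in simp)
  define V where "V \<omega> = (\<Sum>i<N. \<zeta> i \<omega> * (W (\<tau> (Suc i)) \<omega> - W (\<tau> i) \<omega>))" for \<omega>
  have iso: "integrable M (\<lambda>\<omega>. (V \<omega>)\<^sup>2)"
    "expectation (\<lambda>\<omega>. (V \<omega>)\<^sup>2) = expectation (\<lambda>\<omega>. \<Sum>i<N. (\<zeta> i \<omega>)\<^sup>2 * (\<tau> (Suc i) - \<tau> i))"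
    using ito_isometry[OF part \<zeta>_meas \<zeta>_bdd order_refl] unfolding V_def by auto
  have VM: "V \<in> borel_measurable M"
    unfolding V_def using partition_seq_range(2)[OF part(1) order_refl] part(2)
    by (intro measurable_aug_filtrationD[OF simple_sum_measurable[OF part order_refl \<zeta>_meas]]) auto
  have "expectation (\<lambda>\<omega>. \<Sum>i<N. (\<zeta> i \<omega>)\<^sup>2 * (\<tau> (Suc i) - \<tau> i)) \<le> expectation (\<lambda>\<omega>. d)"
  proof (intro integral_mono')
    show "(\<Sum>i<N. (\<zeta> i \<omega>)\<^sup>2 * (\<tau> (Suc i) - \<tau> i)) \<le> d" for \<omega> using \<zeta>_sum by simp
  qed (use d in auto)
  then have Ed: "expectation (\<lambda>\<omega>. (V \<omega>)\<^sup>2) \<le> d" using iso(2) by (simp add: prob_space)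
  have "prob {\<omega>\<in>space M. \<bar>V \<omega>\<bar> \<ge> e} \<le> expectation (\<lambda>\<omega>. (V \<omega>)\<^sup>2) / e\<^sup>2"
    by (rule second_moment_method[OF VM iso(1) e])
  also have "\<dots> \<le> d / e\<^sup>2" using Ed by (intro divide_right_mono) auto
  finally have P1: "prob {\<omega>\<in>space M. \<bar>V \<omega>\<bar> \<ge> e} \<le> d / e\<^sup>2" .
  have \<eta>M: "\<eta> i \<in> borel_measurable M" if "i < N" for i
    using measurable_aug_filtrationD[OF meas[OF that]] step[OF that] by auto
  have QM: "Q N \<in> borel_measurable M"
    unfolding Q_def using \<eta>M by (intro borel_measurable_sum borel_measurable_times borel_measurable_power) auto
  have mV: "{\<omega>\<in>space M. \<bar>V \<omega>\<bar> \<ge> e} \<in> events" and mQ: "{\<omega>\<in>space M. Q N \<omega> > d} \<in> events"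
    using VM QM by measurable
  have "{\<omega>\<in>space M. \<bar>\<Sum>i<N. \<eta> i \<omega> * (W (\<tau> (Suc i)) \<omega> - W (\<tau> i) \<omega>)\<bar> > e}
      \<subseteq> {\<omega>\<in>space M. \<bar>V \<omega>\<bar> \<ge> e} \<union> {\<omega>\<in>space M. Q N \<omega> > d}"
  proof
    fix \<omega> assume w: "\<omega> \<in> {\<omega>\<in>space M. \<bar>\<Sum>i<N. \<eta> i \<omega> * (W (\<tau> (Suc i)) \<omega> - W (\<tau> i) \<omega>)\<bar> > e}"
    show "\<omega> \<in> {\<omega>\<in>space M. \<bar>V \<omega>\<bar> \<ge> e} \<union> {\<omega>\<in>space M. Q N \<omega> > d}"
    proof (cases "Q N \<omega> > d")
      case False
      have "(\<Sum>i<N. \<eta> i \<omega> * (W (\<tau> (Suc i)) \<omega> - W (\<tau> i) \<omega>)) = V \<omega>"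
        unfolding V_def
      proof (rule sum.cong[OF refl])
        fix i assume i: "i \<in> {..<N}"
        have "Q (Suc i) \<omega> \<le> d" using Q_mono[of "Suc i" N \<omega>] i False by auto
        then show "\<eta> i \<omega> * (W (\<tau> (Suc i)) \<omega> - W (\<tau> i) \<omega>) = \<zeta> i \<omega> * (W (\<tau> (Suc i)) \<omega> - W (\<tau> i) \<omega>)"
          using step(2)[of i] i by (cases "\<tau> i = \<tau> (Suc i)") (auto simp: \<zeta>_def)
      qed
      then show ?thesis using w by auto
    qed (use w in auto)
  qed
  then have "prob {\<omega>\<in>space M. \<bar>\<Sum>i<N. \<eta> i \<omega> * (W (\<tau> (Suc i)) \<omega> - W (\<tau> i) \<omega>)\<bar> > e}
      \<le> prob {\<omega>\<in>space M. \<bar>V \<omega>\<bar> \<ge> e} + prob {\<omega>\<in>space M. Q N \<omega> > d}"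
    by (rule order.trans[OF finite_measure_mono[OF _ sets.Un[OF mV mQ]] measure_Un_le[OF mV mQ]])
  then show ?thesis using P1 unfolding Q_def by linarith
qed

end

section \<open>Trapezoid sums of the Stratonovich integral\<close>

lemma riemann_sum_limit:
  fixes g :: "real \<Rightarrow> real"
  assumes "a \<le> b" and g: "continuous_on {a..b} g"
  shows "(\<lambda>K. \<Sum>k<K. g (a + real k * (b - a) / real K) * ((b - a) / real K)) \<longlonglongrightarrow> integral {a..b} g"
proof (rule LIMSEQ_I)
  fix e :: real assume "e > 0"
  define e' where "e' = e / (2 * (b - a + 1))"
  have e': "e' > 0" using \<open>e > 0\<close> \<open>a \<le> b\<close> by (simp add: e'_def)
  have e'e: "e' * (b - a) < e"
  proof -
    have "e' * (b - a) = e * ((b - a) / (2 * (b - a + 1)))" by (simp add: e'_def)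
    also have "\<dots> < e * 1" using \<open>e > 0\<close> \<open>a \<le> b\<close> by (intro mult_strict_left_mono) (auto simp: field_simps)
    finally show ?thesis by simp
  qed
  obtain d where d: "d > 0" "\<And>x y. x \<in> {a..b} \<Longrightarrow> y \<in> {a..b} \<Longrightarrow> \<bar>y - x\<bar> < d \<Longrightarrow> \<bar>g y - g x\<bar> < e'"
    by (rule continuous_on_uniformD[OF g e']) blast
  obtain K0 :: nat where K0: "(b - a) / d < real K0" using reals_Archimedean2 by blast
  show "\<exists>K0. \<forall>K\<ge>K0. norm ((\<Sum>k<K. g (a + real k * (b - a) / real K) * ((b - a) / real K)) - integral {a..b} g) < e"
  proof (intro exI[of _ "Suc K0"] allI impI)
    fix K assume K: "K \<ge> Suc K0"
    define h where "h = (b - a) / real K"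
    define \<tau> where "\<tau> k = a + real k * h" for k
    have Kpos: "real K > 0" using K by simp
    have h: "0 \<le> h" "h < d"
    proof -
      show "0 \<le> h" using \<open>a \<le> b\<close> by (simp add: h_def)
      have "(b - a) / d < real K" using K0 K by linarith
      then show "h < d" using Kpos d(1) by (simp add: h_def field_simps)
    qed
    have \<tau>s: "\<tau> (Suc k) - \<tau> k = h" for k by (simp add: \<tau>_def algebra_simps)
    have part: "partition_seq a b K \<tau>"
    proof -
      have "\<tau> k \<le> \<tau> (Suc k)" for k using \<tau>s[of k] h by linarith
      moreover have "\<tau> K = b" using Kpos by (simp add: \<tau>_def h_def)
      ultimately show ?thesis unfolding partition_seq_def by (simp add: \<tau>_def)
    qed
    have each: "\<bar>g (\<tau> k) * h - (integral {a..\<tau> (Suc k)} g - integral {a..\<tau> k} g)\<bar> \<le> e' * h" if k: "k < K" for k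
    proof -
      note st = partition_seq_step[OF part k]
      have int: "g integrable_on {x..y}" if "a \<le> x" "y \<le> b" for x y
        using that by (intro integrable_continuous_interval continuous_on_subset[OF g]) auto
      have "(g has_integral (integral {a..\<tau> (Suc k)} g - integral {a..\<tau> k} g)) (cbox (\<tau> k) (\<tau> (Suc k)))"
        using integrable_integral[OF int[OF st(1,3)]]
          Henstock_Kurzweil_Integration.integral_combine[OF st(1,2) int[OF order_refl st(3)]]
        unfolding box_real by (metis add_diff_cancel_left')
      moreover have "((\<lambda>_. g (\<tau> k)) has_integral (g (\<tau> k) * h)) (cbox (\<tau> k) (\<tau> (Suc k)))"
        using has_integral_const_real[of "g (\<tau> k)" "\<tau> k" "\<tau> (Suc k)"] st \<tau>s[of k] by (simp add: mult.commute)
      ultimately have "((\<lambda>x. g (\<tau> k) - g x) has_integral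
          (g (\<tau> k) * h - (integral {a..\<tau> (Suc k)} g - integral {a..\<tau> k} g))) (cbox (\<tau> k) (\<tau> (Suc k)))"
        by (intro has_integral_diff)
      then have "norm (g (\<tau> k) * h - (integral {a..\<tau> (Suc k)} g - integral {a..\<tau> k} g))
          \<le> e' * measure lborel (cbox (\<tau> k) (\<tau> (Suc k)))"
      proof (rule has_integral_bound[rotated])
        fix x assume "x \<in> cbox (\<tau> k) (\<tau> (Suc k))"
        then have "\<tau> k \<in> {a..b}" "x \<in> {a..b}" "\<bar>\<tau> k - x\<bar> < d" using st \<tau>s[of k] h by auto
        then show "norm (g (\<tau> k) - g x) \<le> e'" using d(2)[of x "\<tau> k"] by simp
      qed (use e' in simp)
      then show ?thesis using st \<tau>s[of k] by simp
    qed
    have "\<bar>(\<Sum>k<K. g (\<tau> k) * h) - integral {a..b} g\<bar>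
       = \<bar>\<Sum>k<K. g (\<tau> k) * h - (integral {a..\<tau> (Suc k)} g - integral {a..\<tau> k} g)\<bar>"
      using partition_seq_telescope[OF part, of "\<lambda>x. integral {a..x} g"] by (simp add: sum_subtractf)
    also have "\<dots> \<le> (\<Sum>k<K. e' * h)"
      by (rule order.trans[OF sum_abs sum_mono]) (use each in auto)
    also have "\<dots> = e' * (b - a)" using Kpos by (simp add: h_def)
    finally show "norm ((\<Sum>k<K. g (a + real k * (b - a) / real K) * ((b - a) / real K)) - integral {a..b} g) < e"
      using e'e by (simp add: \<tau>_def h_def)
  qed
qed

text \<open>Index \<open>i * K + k\<close> is point k among K equal parts of interval i truncated at
  \<open>t\<close>; intervals beyond \<open>t\<close> collapse to the point \<open>t\<close>. A
  simple integrand stays constant on each block, so its integral is unchanged while the mesh tends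
  to 0 with growing K.\<close>

definition refine :: "real \<Rightarrow> (nat \<Rightarrow> real) \<Rightarrow> nat \<Rightarrow> nat \<Rightarrow> real" where
  "refine t \<tau> K l = (let a = min (\<tau> (l div K)) t; b = min (\<tau> (Suc (l div K))) t
     in a + real (l mod K) * (b - a) / real K)"

lemma refine_eq:
  assumes "k < K"
  shows "refine t \<tau> K (i * K + k) = min (\<tau> i) t + real k * (min (\<tau> (Suc i)) t - min (\<tau> i) t) / real K"
  using assms by (simp add: refine_def Let_def)

lemma refine_Suc:
  assumes "K \<ge> 1"
  shows "refine t \<tau> K (Suc l) - refine t \<tau> K l = (min (\<tau> (Suc (l div K))) t - min (\<tau> (l div K)) t) / real K"
proof -
  define i k where "i = l div K" and "k = l mod K"
  have l: "l = i * K + k" "k < K" using assms by (simp_all add: i_def k_def)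
  have K: "real K > 0" using assms by simp
  let ?a = "min (\<tau> i) t" and ?b = "min (\<tau> (Suc i)) t"
  show ?thesis
  proof (cases "Suc k < K")
    case True
    then show ?thesis using refine_eq[of "Suc k" K t \<tau> i] refine_eq[of k K t \<tau> i] l
      by (simp add: i_def[symmetric] add_divide_distrib[symmetric] diff_divide_distrib[symmetric] algebra_simps)
  next
    \<comment> \<open>At the last point of a block the successor index belongs to the next block,
      whose starting point is the end \<open>?b\<close> of this one.\<close>
    case False
    then have k: "Suc k = K" using l by simp
    have "refine t \<tau> K (Suc l) = ?b"
    proof -
      have "Suc l = Suc i * K + 0" using k l by simp
      then show ?thesis using refine_eq[of 0 K t \<tau> "Suc i"] assms by simp
    qed
    moreover have "refine t \<tau> K l = ?a + real k * (?b - ?a) / real K" using refine_eq l by simp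
    moreover have "real k = real K - 1" using k by simp
    ultimately show ?thesis using K unfolding i_def[symmetric] by (simp add: field_simps)
  qed
qed

lemma partition_seq_refine:
  assumes part: "partition_seq 0 T N \<tau>" and t: "t \<in> {0..T}" and K: "K \<ge> 1"
  shows "partition_seq 0 t (N * K) (refine t \<tau> K)"
  unfolding partition_seq_def
proof (intro conjI allI impI)
  show "refine t \<tau> K 0 = 0" using refine_eq[of 0 K t \<tau> 0] K part t by (simp add: partition_seq_def)
  show "refine t \<tau> K (N * K) = t" using refine_eq[of 0 K t \<tau> N] K part t by (simp add: partition_seq_def)
  fix l assume "l < N * K"
  then have "l div K < N" using K by (simp add: less_mult_imp_div_less)
  then have "\<tau> (l div K) \<le> \<tau> (Suc (l div K))" using part by (simp add: partition_seq_def)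
  then have "0 \<le> (min (\<tau> (Suc (l div K))) t - min (\<tau> (l div K)) t) / real K"
    by (intro divide_nonneg_nonneg) auto
  then show "refine t \<tau> K l \<le> refine t \<tau> K (Suc l)" using refine_Suc[OF K, of t \<tau> l] by simp
qed

lemma mesh_less_refine:
  assumes part: "partition_seq 0 T N \<tau>" and t: "t \<in> {0..T}" and K: "K \<ge> 1" "T / real K < \<delta>"
  shows "mesh_less \<delta> (N * K) (refine t \<tau> K)"
  unfolding mesh_less_def
proof (intro allI impI)
  fix l assume "l < N * K"
  then have l: "l div K < N" using K by (simp add: less_mult_imp_div_less)
  have "min (\<tau> (Suc (l div K))) t - min (\<tau> (l div K)) t \<le> T"
    using partition_seq_step[OF part l] t by auto
  then have "(min (\<tau> (Suc (l div K))) t - min (\<tau> (l div K)) t) / real K \<le> T / real K"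
    by (intro divide_right_mono) auto
  then show "refine t \<tau> K (Suc l) - refine t \<tau> K l < \<delta>" using refine_Suc[OF K(1), of t \<tau> l] K by simp
qed

lemma sum_refine:
  fixes h :: "nat \<Rightarrow> real"
  shows "(\<Sum>l<N * K. h l) = (\<Sum>i<N. \<Sum>k<K. h (i * K + k))"
proof (induction N)
  case (Suc N)
  have "(\<Sum>l<m + j. h l) = (\<Sum>l<m. h l) + (\<Sum>k<j. h (m + k))" for m j :: nat
    by (induction j) simp_all
  from this[of "N * K" K] Suc show ?case by (simp add: add.commute)
qed simp

text \<open>Within a block the coefficient is constant and the refined increments telescope.\<close>

lemma simple_integral_refine:
  assumes K: "K \<ge> 1"
  shows "simple_integral W N \<tau> \<xi> t \<omega> =
    (\<Sum>l<N * K. \<xi> (l div K) \<omega> * (W (refine t \<tau> K (Suc l)) \<omega> - W (refine t \<tau> K l) \<omega>))"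
proof -
  have "(\<Sum>k<K. W (refine t \<tau> K (Suc (i * K + k))) \<omega> - W (refine t \<tau> K (i * K + k)) \<omega>)
      = W (min (\<tau> (Suc i)) t) \<omega> - W (min (\<tau> i) t) \<omega>" for i
  proof -
    have "(\<Sum>k<K. W (refine t \<tau> K (i * K + Suc k)) \<omega> - W (refine t \<tau> K (i * K + k)) \<omega>)
        = W (refine t \<tau> K (i * K + K)) \<omega> - W (refine t \<tau> K (i * K + 0)) \<omega>"
      by (rule sum_lessThan_telescope)
    then show ?thesis
      using refine_eq[of 0 K t \<tau> i] refine_eq[of 0 K t \<tau> "Suc i"] K by (simp add: add.commute)
  qed
  then show ?thesis unfolding simple_integral_def sum_refine
    using K by (simp add: sum_distrib_left[symmetric])
qed

lemma simple_value_eq: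
  assumes part: "partition_seq 0 T N \<tau>" and i: "i < N" and s: "\<tau> i < s" "s \<le> \<tau> (Suc i)"
  shows "simple_value N \<tau> \<xi> s \<omega> = \<xi> i \<omega>"
proof -
  have "\<xi> l \<omega> * indicat_real {\<tau> l<..\<tau> (Suc l)} s = (if l = i then \<xi> i \<omega> else 0)" if "l \<in> {..<N}" for l
  proof (cases l i rule: linorder_cases)
    case less
    then have "\<tau> (Suc l) \<le> \<tau> i" using partition_seq_mono[OF part, of "Suc l" i] i by simp
    then show ?thesis using s less by (simp add: indicator_def)
  next
    case greater
    then have "\<tau> (Suc i) \<le> \<tau> l" using partition_seq_mono[OF part, of "Suc i" l] that by simp
    then show ?thesis using s greater by (simp add: indicator_def)
  qed (use s in \<open>simp add: indicator_def\<close>)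
  then show ?thesis unfolding simple_value_def using i by simp
qed

lemma integral_simple_value:
  assumes part: "partition_seq 0 T N \<tau>" and X: "continuous_on {0..T} (\<lambda>s. X s \<omega>)"
  shows "integral {0..T} (\<lambda>s. (simple_value N \<tau> \<xi> s \<omega> - X s \<omega>)\<^sup>2)
    = (\<Sum>i<N. integral {\<tau> i..\<tau> (Suc i)} (\<lambda>s. (X s \<omega> - \<xi> i \<omega>)\<^sup>2))"
proof -
  let ?h = "\<lambda>s. (simple_value N \<tau> \<xi> s \<omega> - X s \<omega>)\<^sup>2"
  have "k \<le> N \<Longrightarrow> (?h has_integral (\<Sum>i<k. integral {\<tau> i..\<tau> (Suc i)} (\<lambda>s. (X s \<omega> - \<xi> i \<omega>)\<^sup>2))) {0..\<tau> k}" for k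
  proof (induction k)
    case 0
    have "\<tau> 0 = 0" using part by (simp add: partition_seq_def)
    then show ?case using has_integral_refl(2)[of ?h 0] by simp
  next
    case (Suc k)
    then have k: "k < N" by simp
    note st = partition_seq_step[OF part k]
    have "(\<lambda>s. (X s \<omega> - \<xi> k \<omega>)\<^sup>2) integrable_on {\<tau> k..\<tau> (Suc k)}"
      using st by (intro integrable_continuous_interval continuous_intros continuous_on_subset[OF X]) auto
    then have "((\<lambda>s. (X s \<omega> - \<xi> k \<omega>)\<^sup>2) has_integral integral {\<tau> k..\<tau> (Suc k)} (\<lambda>s. (X s \<omega> - \<xi> k \<omega>)\<^sup>2)) {\<tau> k..\<tau> (Suc k)}"
      by (rule integrable_integral)
    then have "(?h has_integral integral {\<tau> k..\<tau> (Suc k)} (\<lambda>s. (X s \<omega> - \<xi> k \<omega>)\<^sup>2)) {\<tau> k..\<tau> (Suc k)}"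
    \<comment> \<open>The elementary intervals are open on the left, so the left end point belongs
      to an earlier piece and has to be excepted.\<close>
    proof (rule has_integral_spike_finite[of "{\<tau> k}", rotated 2])
      fix s assume "s \<in> {\<tau> k..\<tau> (Suc k)} - {\<tau> k}"
      then have "simple_value N \<tau> \<xi> s \<omega> = \<xi> k \<omega>" by (intro simple_value_eq[OF part k]) auto
      then show "?h s = (X s \<omega> - \<xi> k \<omega>)\<^sup>2" by (simp add: power2_commute)
    qed simp
    from has_integral_combine[OF st(1,2) Suc.IH this] k show ?case by simp
  qed
  from this[of N] part have "(?h has_integral (\<Sum>i<N. integral {\<tau> i..\<tau> (Suc i)} (\<lambda>s. (X s \<omega> - \<xi> i \<omega>)\<^sup>2))) {0..T}"
    by (simp add: partition_seq_def)
  then show ?thesis by (rule integral_unique)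
qed

text \<open>Path by path these are Riemann sums of the squared distance between \<open>X\<close> and
  the simple process up to time \<open>t\<close>, and the integral up to \<open>T\<close> can only
  be larger. How fine the grid must be depends on the path, hence the form of the statement.\<close>

lemma refined_square_sum_eventually_le:
  assumes part: "partition_seq 0 T N \<tau>" and t: "t \<in> {0..T}" and X: "continuous_on {0..T} (\<lambda>s. X s \<omega>)" and "d > 0"
  shows "eventually (\<lambda>K. (\<Sum>l<N * K. (if \<tau> (l div K) \<le> t then X (refine t \<tau> K l) \<omega> - \<xi> (l div K) \<omega> else 0)\<^sup>2
      * (refine t \<tau> K (Suc l) - refine t \<tau> K l))
    \<le> integral {0..T} (\<lambda>s. (simple_value N \<tau> \<xi> s \<omega> - X s \<omega>)\<^sup>2) + d) sequentially"
proof -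
  define g where "g i s = (X s \<omega> - \<xi> i \<omega>)\<^sup>2" for i s
  define a where "a i = min (\<tau> i) t" for i
  define R where "R = (\<Sum>i<N. if \<tau> i \<le> t then integral {a i..a (Suc i)} (g i) else 0)"
  define S where "S K = (\<Sum>i<N. if \<tau> i \<le> t then
      (\<Sum>k<K. g i (a i + real k * (a (Suc i) - a i) / real K) * ((a (Suc i) - a i) / real K)) else 0)" for K
  have gc: "continuous_on A (g i)" if "A \<subseteq> {0..T}" for i A
    unfolding g_def using that by (intro continuous_intros continuous_on_subset[OF X])
  have a: "0 \<le> a i" "a i \<le> a (Suc i)" "a (Suc i) \<le> T" if "i < N" for i
    using partition_seq_step[OF part that] t by (auto simp: a_def)
  have "S \<longlonglongrightarrow> R"
    unfolding S_def R_def
  proof (rule tendsto_sum)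
    fix i assume "i \<in> {..<N}"
    then have i: "i < N" by simp
    have "(\<lambda>K. \<Sum>k<K. g i (a i + real k * (a (Suc i) - a i) / real K) * ((a (Suc i) - a i) / real K))
        \<longlonglongrightarrow> integral {a i..a (Suc i)} (g i)"
      using a[OF i] by (intro riemann_sum_limit gc) auto
    then show "(\<lambda>K. if \<tau> i \<le> t then
      (\<Sum>k<K. g i (a i + real k * (a (Suc i) - a i) / real K) * ((a (Suc i) - a i) / real K)) else 0)
        \<longlonglongrightarrow> (if \<tau> i \<le> t then integral {a i..a (Suc i)} (g i) else 0)" by simp
  qed
  then have ev: "eventually (\<lambda>K. S K < R + d) sequentially"
    using \<open>d > 0\<close> by (intro order_tendstoD(2)) auto
  have "R \<le> (\<Sum>i<N. integral {\<tau> i..\<tau> (Suc i)} (g i))"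
    unfolding R_def
  proof (rule sum_mono)
    fix i assume "i \<in> {..<N}"
    then have i: "i < N" by simp
    note st = partition_seq_step[OF part i]
    have int: "g i integrable_on {x..y}" if "0 \<le> x" "y \<le> T" for x y
      using that by (intro integrable_continuous_interval gc) auto
    show "(if \<tau> i \<le> t then integral {a i..a (Suc i)} (g i) else 0) \<le> integral {\<tau> i..\<tau> (Suc i)} (g i)"
    proof (cases "\<tau> i \<le> t")
      case True
      have "integral {a i..a (Suc i)} (g i) \<le> integral {\<tau> i..\<tau> (Suc i)} (g i)"
        using a[OF i] st True by (intro integral_subset_le int) (auto simp: a_def g_def)
      then show ?thesis using True by simp
    next
      case False
      have "0 \<le> integral {\<tau> i..\<tau> (Suc i)} (g i)"
        using st by (intro Henstock_Kurzweil_Integration.integral_nonneg int) (auto simp: g_def)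
      then show ?thesis using False by simp
    qed
  qed
  also have "\<dots> = integral {0..T} (\<lambda>s. (simple_value N \<tau> \<xi> s \<omega> - X s \<omega>)\<^sup>2)"
    unfolding integral_simple_value[where X = X and \<omega> = \<omega>, OF part X] g_def ..
  finally have R: "R \<le> integral {0..T} (\<lambda>s. (simple_value N \<tau> \<xi> s \<omega> - X s \<omega>)\<^sup>2)" .
  show ?thesis using ev eventually_ge_at_top[of 1]
  proof eventually_elim
    case (elim K)
    have "(\<Sum>l<N * K. (if \<tau> (l div K) \<le> t then X (refine t \<tau> K l) \<omega> - \<xi> (l div K) \<omega> else 0)\<^sup>2
      * (refine t \<tau> K (Suc l) - refine t \<tau> K l)) = S K"
      unfolding sum_refine S_def
    proof (rule sum.cong[OF refl])
      fix i assume "i \<in> {..<N}"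
      show "(\<Sum>k<K. (if \<tau> ((i * K + k) div K) \<le> t then X (refine t \<tau> K (i * K + k)) \<omega> - \<xi> ((i * K + k) div K) \<omega> else 0)\<^sup>2
            * (refine t \<tau> K (Suc (i * K + k)) - refine t \<tau> K (i * K + k)))
          = (if \<tau> i \<le> t then (\<Sum>k<K. g i (a i + real k * (a (Suc i) - a i) / real K) * ((a (Suc i) - a i) / real K)) else 0)"
        unfolding refine_Suc[OF elim(2)] using elim(2) by (auto simp: g_def a_def refine_eq intro!: sum.cong)
    qed
    then show ?case using elim(1) R by simp
  qed
qed

text \<open>Dominated convergence of the indicators; it converts an index that depends on the path
  into one that works with high probability.\<close>

lemma (in prob_space) prob_tendsto_0_if_eventually_notin:
  assumes A: "\<And>K. A K \<in> events" and ev: "\<And>\<omega>. \<omega> \<in> space M \<Longrightarrow> eventually (\<lambda>K. \<omega> \<notin> A K) sequentially"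
  shows "(\<lambda>K. prob (A K)) \<longlonglongrightarrow> 0"
proof -
  have "(\<lambda>K. expectation (indicat_real (A K))) \<longlonglongrightarrow> expectation (\<lambda>_. 0)"
  proof (rule integral_dominated_convergence[where w = "\<lambda>_. 1"])
    show "AE \<omega> in M. (\<lambda>K. indicat_real (A K) \<omega>) \<longlonglongrightarrow> 0"
    proof (rule AE_I2)
      fix \<omega> assume "\<omega> \<in> space M"
      from ev[OF this] have "eventually (\<lambda>K. indicat_real (A K) \<omega> = 0) sequentially"
        by eventually_elim simp
      then show "(\<lambda>K. indicat_real (A K) \<omega>) \<longlonglongrightarrow> 0" by (rule tendsto_eventually)
    qed
  qed (use A in \<open>auto simp: indicator_def\<close>)
  moreover have "expectation (indicat_real (A K)) = prob (A K)" for K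
    using A by simp
  ultimately show ?thesis by simp
qed

lemma (in prob_space) prob_subset_Un_le:
  assumes "A \<subseteq> B \<union> C" "B \<in> events" "C \<in> events"
  shows "prob A \<le> prob B + prob C"
  using order.trans[OF finite_measure_mono[OF assms(1) sets.Un[OF assms(2,3)]] measure_Un_le[OF assms(2,3)]] .

text \<open>On a refined grid the left sum of \<open>X\<close> is the simple integral plus a sum
  with coefficients \<open>X - \<xi>\<close>. These are adapted but need not be bounded or square
  integrable, so the stopped tail bound is used; their quadratic weight is close to the distance
  between \<open>X\<close> and the simple process, which is small in probability.\<close>

lemma (in brownian) ito_integral_left_sums:
  assumes ito: "is_ito_integral M T W X Z" and t: "t \<in> {0..T}"
    and e: "e > 0" and p: "p > 0" and \<delta>: "\<delta> > 0"
  obtains N \<sigma> where "partition_seq 0 t N \<sigma>" "mesh_less \<delta> N \<sigma>"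
    "prob {\<omega>\<in>space M. \<bar>(\<Sum>l<N. X (\<sigma> l) \<omega> * (W (\<sigma> (Suc l)) \<omega> - W (\<sigma> l) \<omega>)) - Z t \<omega>\<bar> > e} < p"
proof -
  obtain NN \<tau>\<tau> \<xi>\<xi> where simple: "\<And>j. simple_process M T W (NN j) (\<tau>\<tau> j) (\<xi>\<xi> j)"
    and c1: "converges_in_prob M (\<lambda>j \<omega>. integral {0..T} (\<lambda>s. (simple_value (NN j) (\<tau>\<tau> j) (\<xi>\<xi> j) s \<omega> - X s \<omega>)\<^sup>2)) (\<lambda>_. 0)"
    and c2: "\<And>t. t \<in> {0..T} \<Longrightarrow> converges_in_prob M (\<lambda>j. simple_integral W (NN j) (\<tau>\<tau> j) (\<xi>\<xi> j) t) (Z t)"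
    using ito unfolding is_ito_integral_def by blast
  have Xc: "\<And>\<omega>. \<omega> \<in> space M \<Longrightarrow> continuous_on {0..T} (\<lambda>s. X s \<omega>)"
    and Xm: "\<And>s. s \<in> {0..T} \<Longrightarrow> X s \<in> borel_measurable M"
    and Xa: "\<And>s. s \<in> {0..T} \<Longrightarrow> X s \<in> borel_measurable (aug_filtration M W s)"
    using ito unfolding is_ito_integral_def continuous_process_def adapted_def by auto
  \<comment> \<open>The tail bound with weight \<open>2 * d\<close> and threshold
    \<open>e / 2\<close> then costs exactly \<open>p / 4\<close>. The other three quarters of
    \<open>p\<close> are spent on \<open>I j\<close> being far from \<open>Z t\<close>, on
    \<open>U j\<close> exceeding \<open>d\<close>, and on \<open>Q K\<close> exceeding
    \<open>U j + d\<close>.\<close>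
  define d where "d = p * e\<^sup>2 / 32"
  have d: "d > 0" using e p by (simp add: d_def)
  define U where "U j \<omega> = integral {0..T} (\<lambda>s. (simple_value (NN j) (\<tau>\<tau> j) (\<xi>\<xi> j) s \<omega> - X s \<omega>)\<^sup>2)" for j \<omega>
  define I where "I j = simple_integral W (NN j) (\<tau>\<tau> j) (\<xi>\<xi> j) t" for j
  have U_meas: "U j \<in> borel_measurable M" for j
    using c1 unfolding converges_in_prob_def U_def by blast
  have I_meas: "I j \<in> borel_measurable M" for j
    using c2[OF t] unfolding converges_in_prob_def I_def by blast
  have Z_meas: "Z t \<in> borel_measurable M"
    using c2[OF t] unfolding converges_in_prob_def by blast
  have "(\<lambda>j. prob {\<omega>\<in>space M. \<bar>U j \<omega> - 0\<bar> > d}) \<longlonglongrightarrow> 0"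
    using c1 d unfolding converges_in_prob_def U_def by blast
  moreover have "(\<lambda>j. prob {\<omega>\<in>space M. \<bar>I j \<omega> - Z t \<omega>\<bar> > e / 2}) \<longlonglongrightarrow> 0"
    using c2[OF t] e unfolding converges_in_prob_def I_def by (meson half_gt_zero)
  ultimately have "eventually (\<lambda>j. prob {\<omega>\<in>space M. \<bar>U j \<omega> - 0\<bar> > d} < p / 4 \<and>
      prob {\<omega>\<in>space M. \<bar>I j \<omega> - Z t \<omega>\<bar> > e / 2} < p / 4) sequentially"
    using p by (intro eventually_conj order_tendstoD(2)) auto
  then obtain j where j1: "prob {\<omega>\<in>space M. \<bar>U j \<omega> - 0\<bar> > d} < p / 4"
    and j2: "prob {\<omega>\<in>space M. \<bar>I j \<omega> - Z t \<omega>\<bar> > e / 2} < p / 4"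
    by (auto dest: eventually_happens)
  define N \<tau> \<xi> where "N = NN j" and "\<tau> = \<tau>\<tau> j" and "\<xi> = \<xi>\<xi> j"
  have part: "partition_seq 0 T N \<tau>"
    and \<xi>: "\<And>i. i < N \<Longrightarrow> \<xi> i \<in> borel_measurable (aug_filtration M W (\<tau> i))"
    using simple[of j] unfolding simple_process_def N_def \<tau>_def \<xi>_def by auto
  \<comment> \<open>For a piece beyond \<open>t\<close> the increments vanish whatever the
    coefficient is. The value 0 keeps it adapted: \<open>\<xi>\<close> of that piece is known only
    at a time later than \<open>t\<close>.\<close>
  define \<eta> where "\<eta> K l \<omega> = (if \<tau> (l div K) \<le> t then X (refine t \<tau> K l) \<omega> - \<xi> (l div K) \<omega> else 0)" for K l \<omega>
  define Q where "Q K \<omega> = (\<Sum>l<N * K. (\<eta> K l \<omega>)\<^sup>2 * (refine t \<tau> K (Suc l) - refine t \<tau> K l))" for K \<omega>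
  have \<eta>_meas: "\<eta> K l \<in> borel_measurable (aug_filtration M W (refine t \<tau> K l))" if "l < N * K" "K \<ge> 1" for K l
  proof (cases "\<tau> (l div K) \<le> t")
    case True
    have i: "l div K < N" using that by (simp add: less_mult_imp_div_less)
    have s: "0 \<le> refine t \<tau> K l" "refine t \<tau> K l \<le> t"
      using partition_seq_range[OF partition_seq_refine[OF part t that(2)], of l] that by auto
    have "l = (l div K) * K + l mod K" "l mod K < K" using that by auto
    then have "refine t \<tau> K l = min (\<tau> (l div K)) t
        + real (l mod K) * (min (\<tau> (Suc (l div K))) t - min (\<tau> (l div K)) t) / real K"
      using refine_eq[of "l mod K" K t \<tau> "l div K"] by simp
    moreover have "0 \<le> real (l mod K) * (min (\<tau> (Suc (l div K))) t - min (\<tau> (l div K)) t) / real K"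
      using partition_seq_step[OF part i] by (intro divide_nonneg_nonneg mult_nonneg_nonneg) auto
    ultimately have "\<tau> (l div K) \<le> refine t \<tau> K l" using True by simp
    then have "\<xi> (l div K) \<in> borel_measurable (aug_filtration M W (refine t \<tau> K l))"
      by (rule measurable_aug_filtration_mono[OF \<xi>[OF i]])
    moreover have "X (refine t \<tau> K l) \<in> borel_measurable (aug_filtration M W (refine t \<tau> K l))"
      using s t by (intro Xa) auto
    moreover have "\<eta> K l = (\<lambda>\<omega>. X (refine t \<tau> K l) \<omega> - \<xi> (l div K) \<omega>)"
      using True by (simp add: \<eta>_def fun_eq_iff)
    ultimately show ?thesis by simp
  next
    case False
    then have "\<eta> K l = (\<lambda>\<omega>. 0)" by (simp add: \<eta>_def fun_eq_iff)
    then show ?thesis by simp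
  qed
  have \<eta>_M: "\<eta> K l \<in> borel_measurable M" if "l < N * K" "K \<ge> 1" for K l
    using partition_seq_range[OF partition_seq_refine[OF part t that(2)], of l] that t
    by (intro measurable_aug_filtrationD[OF \<eta>_meas]) auto
  have Q_meas: "Q K \<in> borel_measurable M" for K
  proof (cases "K \<ge> 1")
    case True
    then show ?thesis unfolding Q_def
      by (intro borel_measurable_sum borel_measurable_times borel_measurable_power \<eta>_M) auto
  next
    case False
    then have "K = 0" by simp
    then have "Q K = (\<lambda>\<omega>. 0)" by (simp add: Q_def fun_eq_iff)
    then show ?thesis by simp
  qed
  have "(\<lambda>K. prob {\<omega>\<in>space M. Q K \<omega> > U j \<omega> + d}) \<longlonglongrightarrow> 0"
  proof (rule prob_tendsto_0_if_eventually_notin)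
    show "{\<omega>\<in>space M. Q K \<omega> > U j \<omega> + d} \<in> events" for K
      using Q_meas[of K] U_meas[of j] by measurable
    fix \<omega> assume w: "\<omega> \<in> space M"
    have "eventually (\<lambda>K. Q K \<omega> \<le> U j \<omega> + d) sequentially"
      unfolding Q_def \<eta>_def U_def N_def[symmetric] \<tau>_def[symmetric] \<xi>_def[symmetric]
      by (rule refined_square_sum_eventually_le[where X = X and \<omega> = \<omega>, OF part t Xc[OF w] d])
    then show "eventually (\<lambda>K. \<omega> \<notin> {\<omega>\<in>space M. Q K \<omega> > U j \<omega> + d}) sequentially"
      by eventually_elim auto
  qed
  then have "eventually (\<lambda>K. prob {\<omega>\<in>space M. Q K \<omega> > U j \<omega> + d} < p / 4) sequentially"
    using p by (intro order_tendstoD(2)) auto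
  moreover have "(\<lambda>K. T / real K) \<longlonglongrightarrow> 0" by (rule lim_const_over_n)
  then have "eventually (\<lambda>K. T / real K < \<delta>) sequentially" using \<delta> by (intro order_tendstoD(2)) auto
  ultimately have "eventually (\<lambda>K. prob {\<omega>\<in>space M. Q K \<omega> > U j \<omega> + d} < p / 4 \<and> T / real K < \<delta> \<and> K \<ge> 1) sequentially"
    using eventually_ge_at_top[of "1::nat"] by (intro eventually_conj)
  then obtain K where K: "prob {\<omega>\<in>space M. Q K \<omega> > U j \<omega> + d} < p / 4" "T / real K < \<delta>" "K \<ge> 1"
    by (auto dest: eventually_happens)
  define \<sigma> where "\<sigma> = refine t \<tau> K"
  have part': "partition_seq 0 t (N * K) \<sigma>" unfolding \<sigma>_def by (rule partition_seq_refine[OF part t K(3)])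
  have \<sigma>_mem: "\<sigma> l \<in> {0..T}" if "l \<le> N * K" for l
    using partition_seq_range[OF part' that] t by auto
  define V where "V \<omega> = (\<Sum>l<N * K. \<eta> K l \<omega> * (W (\<sigma> (Suc l)) \<omega> - W (\<sigma> l) \<omega>))" for \<omega>
  define L where "L \<omega> = (\<Sum>l<N * K. X (\<sigma> l) \<omega> * (W (\<sigma> (Suc l)) \<omega> - W (\<sigma> l) \<omega>))" for \<omega>
  have V_meas: "V \<in> borel_measurable M"
    unfolding V_def using \<eta>_M K \<sigma>_mem
    by (intro borel_measurable_sum borel_measurable_times borel_measurable_diff W_measurable) auto
  have LV: "L \<omega> = I j \<omega> + V \<omega>" for \<omega>
  proof -
    have "I j \<omega> + V \<omega> = (\<Sum>l<N * K. (\<xi> (l div K) \<omega> + \<eta> K l \<omega>) * (W (\<sigma> (Suc l)) \<omega> - W (\<sigma> l) \<omega>))"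
      unfolding I_def V_def N_def[symmetric] \<tau>_def[symmetric] \<xi>_def[symmetric] simple_integral_refine[OF K(3)] \<sigma>_def
      by (simp add: sum.distrib[symmetric] distrib_right)
    also have "\<dots> = L \<omega>" unfolding L_def
    proof (rule sum.cong[OF refl])
      fix l assume "l \<in> {..<N * K}"
      then have i: "l div K < N" using K by (simp add: less_mult_imp_div_less)
      show "(\<xi> (l div K) \<omega> + \<eta> K l \<omega>) * (W (\<sigma> (Suc l)) \<omega> - W (\<sigma> l) \<omega>) = X (\<sigma> l) \<omega> * (W (\<sigma> (Suc l)) \<omega> - W (\<sigma> l) \<omega>)"
      proof (cases "\<tau> (l div K) \<le> t")
        case True
        then show ?thesis by (simp add: \<eta>_def \<sigma>_def)
      next
        case False
        then have "\<sigma> (Suc l) - \<sigma> l = 0"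
          unfolding \<sigma>_def refine_Suc[OF K(3)] using partition_seq_step[OF part i] by simp
        then show ?thesis by simp
      qed
    qed
    finally show ?thesis by simp
  qed
  have mU: "{\<omega>\<in>space M. \<bar>U j \<omega> - 0\<bar> > d} \<in> events" using U_meas[of j] by measurable
  have mI: "{\<omega>\<in>space M. \<bar>I j \<omega> - Z t \<omega>\<bar> > e / 2} \<in> events" using I_meas[of j] Z_meas by measurable
  have mQ: "{\<omega>\<in>space M. Q K \<omega> > U j \<omega> + d} \<in> events" using Q_meas[of K] U_meas[of j] by measurable
  have mV: "{\<omega>\<in>space M. \<bar>V \<omega>\<bar> > e / 2} \<in> events" using V_meas by measurable
  have "prob {\<omega>\<in>space M. \<bar>L \<omega> - Z t \<omega>\<bar> > e}
      \<le> prob {\<omega>\<in>space M. \<bar>V \<omega>\<bar> > e / 2} + prob {\<omega>\<in>space M. \<bar>I j \<omega> - Z t \<omega>\<bar> > e / 2}"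
  proof (intro prob_subset_Un_le mV mI subsetI)
    fix \<omega> assume "\<omega> \<in> {\<omega>\<in>space M. \<bar>L \<omega> - Z t \<omega>\<bar> > e}"
    then have w: "\<omega> \<in> space M" "e < \<bar>V \<omega> + (I j \<omega> - Z t \<omega>)\<bar>" unfolding LV by (auto simp: algebra_simps)
    then have "e < \<bar>V \<omega>\<bar> + \<bar>I j \<omega> - Z t \<omega>\<bar>"
      using abs_triangle_ineq[of "V \<omega>" "I j \<omega> - Z t \<omega>"] by linarith
    then have "\<not> (\<bar>V \<omega>\<bar> \<le> e / 2 \<and> \<bar>I j \<omega> - Z t \<omega>\<bar> \<le> e / 2)" by (auto simp: field_simps)
    then show "\<omega> \<in> {\<omega>\<in>space M. \<bar>V \<omega>\<bar> > e / 2} \<union> {\<omega>\<in>space M. \<bar>I j \<omega> - Z t \<omega>\<bar> > e / 2}"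
      using w(1) by (auto simp: not_le)
  qed
  moreover have "prob {\<omega>\<in>space M. \<bar>V \<omega>\<bar> > e / 2} \<le> 2 * d / (e / 2)\<^sup>2 + prob {\<omega>\<in>space M. Q K \<omega> > 2 * d}"
    unfolding V_def Q_def \<sigma>_def[symmetric]
  proof (rule simple_sum_tail_bound[OF part'])
    show "\<eta> K l \<in> borel_measurable (aug_filtration M W (\<sigma> l))" if "l < N * K" for l
      unfolding \<sigma>_def by (rule \<eta>_meas[OF that K(3)])
  qed (use t d e in auto)
  moreover have "2 * d / (e / 2)\<^sup>2 = p / 4" using e by (simp add: d_def field_simps power2_eq_square)
  moreover have "prob {\<omega>\<in>space M. Q K \<omega> > 2 * d} \<le> prob {\<omega>\<in>space M. Q K \<omega> > U j \<omega> + d} + prob {\<omega>\<in>space M. \<bar>U j \<omega> - 0\<bar> > d}"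
    by (intro prob_subset_Un_le mQ mU) auto
  ultimately have "prob {\<omega>\<in>space M. \<bar>L \<omega> - Z t \<omega>\<bar> > e} < p"
    using j1 j2 K(1) by linarith
  then show ?thesis
    using that[OF part'] mesh_less_refine[OF part t K(3,2)] unfolding L_def \<sigma>_def by blast
qed

text \<open>A trapezoid sum is the left sum plus half the covariation sum. The covariation converges
  along all fine partitions, so the partition may be dictated by the Ito part.\<close>

lemma (in brownian) stratonovich_trapezoid_sums:
  assumes strat: "is_stratonovich_integral M T W X Y" and t: "t \<in> {0..T}"
    and e: "e > 0" and p: "p > 0" and \<delta>: "\<delta> > 0"
  obtains N \<sigma> where "partition_seq 0 t N \<sigma>" "mesh_less \<delta> N \<sigma>"
    "{\<omega>\<in>space M. \<bar>(\<Sum>l<N. (X (\<sigma> l) \<omega> + X (\<sigma> (Suc l)) \<omega>) / 2 * (W (\<sigma> (Suc l)) \<omega> - W (\<sigma> l) \<omega>)) - Y t \<omega>\<bar> > e} \<in> events"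
    "prob {\<omega>\<in>space M. \<bar>(\<Sum>l<N. (X (\<sigma> l) \<omega> + X (\<sigma> (Suc l)) \<omega>) / 2 * (W (\<sigma> (Suc l)) \<omega> - W (\<sigma> l) \<omega>)) - Y t \<omega>\<bar> > e} < p"
proof -
  obtain Z Q where ito: "is_ito_integral M T W X Z" and cov: "is_covariation M T X W Q"
    and Y: "AE \<omega> in M. Y t \<omega> = Z t \<omega> + Q t \<omega> / 2" and Yc: "continuous_process M T Y"
    using strat t unfolding is_stratonovich_integral_def by blast
  have p2: "p / 2 > 0" and e2: "e / 2 > 0" using p e by auto
  obtain \<delta>' where \<delta>': "\<delta>' > 0" "\<And>N \<tau>. partition_seq 0 t N \<tau> \<Longrightarrow> mesh_less \<delta>' N \<tau> \<Longrightarrow>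
      prob {\<omega>\<in>space M. \<bar>(\<Sum>i<N. (X (\<tau> (Suc i)) \<omega> - X (\<tau> i) \<omega>) * (W (\<tau> (Suc i)) \<omega> - W (\<tau> i) \<omega>)) - Q t \<omega>\<bar> > e} < p / 2"
    using cov t e p2 unfolding is_covariation_def by meson
  have "min \<delta> \<delta>' > 0" using \<delta> \<delta>'(1) by simp
  then obtain N \<sigma> where part: "partition_seq 0 t N \<sigma>" and mesh: "mesh_less (min \<delta> \<delta>') N \<sigma>"
    and P1: "prob {\<omega>\<in>space M. \<bar>(\<Sum>l<N. X (\<sigma> l) \<omega> * (W (\<sigma> (Suc l)) \<omega> - W (\<sigma> l) \<omega>)) - Z t \<omega>\<bar> > e / 2} < p / 2"
    by (rule ito_integral_left_sums[OF ito t e2 p2])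
  have mesh1: "mesh_less \<delta> N \<sigma>" and mesh2: "mesh_less \<delta>' N \<sigma>" using mesh by (auto simp: mesh_less_def)
  define A where "A \<omega> = (\<Sum>l<N. X (\<sigma> l) \<omega> * (W (\<sigma> (Suc l)) \<omega> - W (\<sigma> l) \<omega>))" for \<omega>
  define B where "B \<omega> = (\<Sum>l<N. (X (\<sigma> (Suc l)) \<omega> - X (\<sigma> l) \<omega>) * (W (\<sigma> (Suc l)) \<omega> - W (\<sigma> l) \<omega>))" for \<omega>
  define C where "C \<omega> = (\<Sum>l<N. (X (\<sigma> l) \<omega> + X (\<sigma> (Suc l)) \<omega>) / 2 * (W (\<sigma> (Suc l)) \<omega> - W (\<sigma> l) \<omega>))" for \<omega>
  have C: "C \<omega> = A \<omega> + B \<omega> / 2" for \<omega>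
    unfolding A_def B_def C_def sum_divide_distrib sum.distrib[symmetric]
    by (intro sum.cong refl) (simp add: field_simps)
  have \<sigma>: "\<sigma> l \<in> {0..T}" if "l \<le> N" for l using partition_seq_range[OF part that] t by auto
  have Xm: "X s \<in> borel_measurable M" if "s \<in> {0..T}" for s
    using ito that unfolding is_ito_integral_def continuous_process_def by auto
  have Zm: "Z t \<in> borel_measurable M"
    using ito t unfolding is_ito_integral_def continuous_process_def by auto
  have Qm: "Q t \<in> borel_measurable M" using cov t unfolding is_covariation_def by blast
  have Ym: "Y t \<in> borel_measurable M" using Yc t unfolding continuous_process_def by blast
  have Am: "A \<in> borel_measurable M" and Bm: "B \<in> borel_measurable M" unfolding A_def B_def
    by (intro borel_measurable_sum borel_measurable_times borel_measurable_diff W_measurable Xm \<sigma>; simp)+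
  have Cm: "C \<in> borel_measurable M" unfolding C using Am Bm by measurable
  have mA: "{\<omega>\<in>space M. \<bar>A \<omega> - Z t \<omega>\<bar> > e / 2} \<in> events" using Am Zm by measurable
  have mB: "{\<omega>\<in>space M. \<bar>B \<omega> - Q t \<omega>\<bar> > e} \<in> events" using Bm Qm by measurable
  have mC: "{\<omega>\<in>space M. \<bar>C \<omega> - Y t \<omega>\<bar> > e} \<in> events" using Cm Ym by measurable
  have mC': "{\<omega>\<in>space M. \<bar>C \<omega> - (Z t \<omega> + Q t \<omega> / 2)\<bar> > e} \<in> events" using Cm Zm Qm by measurable
  have "AE \<omega> in M. \<omega> \<in> {\<omega>\<in>space M. \<bar>C \<omega> - Y t \<omega>\<bar> > e} \<longleftrightarrow> \<omega> \<in> {\<omega>\<in>space M. \<bar>C \<omega> - (Z t \<omega> + Q t \<omega> / 2)\<bar> > e}"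
    using Y by eventually_elim simp
  then have "prob {\<omega>\<in>space M. \<bar>C \<omega> - Y t \<omega>\<bar> > e} = prob {\<omega>\<in>space M. \<bar>C \<omega> - (Z t \<omega> + Q t \<omega> / 2)\<bar> > e}"
    by (rule measure_eq_AE) (rule mC mC')+
  also have "\<dots> \<le> prob {\<omega>\<in>space M. \<bar>A \<omega> - Z t \<omega>\<bar> > e / 2} + prob {\<omega>\<in>space M. \<bar>B \<omega> - Q t \<omega>\<bar> > e}"
  proof (intro prob_subset_Un_le mA mB subsetI)
    \<comment> \<open>The covariation sum enters with factor 1/2, so tolerance \<open>e\<close> for
      it and \<open>e / 2\<close> for the left sum add up to \<open>e\<close>.\<close>
    fix \<omega> assume "\<omega> \<in> {\<omega>\<in>space M. \<bar>C \<omega> - (Z t \<omega> + Q t \<omega> / 2)\<bar> > e}"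
    then have w: "\<omega> \<in> space M" "\<bar>(A \<omega> - Z t \<omega>) + (B \<omega> - Q t \<omega>) / 2\<bar> > e" unfolding C by (auto simp: algebra_simps diff_divide_distrib)
    then have "e < \<bar>A \<omega> - Z t \<omega>\<bar> + \<bar>B \<omega> - Q t \<omega>\<bar> / 2"
      using abs_triangle_ineq[of "A \<omega> - Z t \<omega>" "(B \<omega> - Q t \<omega>) / 2"] by simp
    then have "\<not> (\<bar>A \<omega> - Z t \<omega>\<bar> \<le> e / 2 \<and> \<bar>B \<omega> - Q t \<omega>\<bar> \<le> e)" by (auto simp: field_simps)
    then have "\<bar>A \<omega> - Z t \<omega>\<bar> > e / 2 \<or> \<bar>B \<omega> - Q t \<omega>\<bar> > e" by (simp add: not_le)
    then show "\<omega> \<in> {\<omega>\<in>space M. \<bar>A \<omega> - Z t \<omega>\<bar> > e / 2} \<union> {\<omega>\<in>space M. \<bar>B \<omega> - Q t \<omega>\<bar> > e}" using w by auto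
  qed
  also have "\<dots> < p / 2 + p / 2"
    using P1 \<delta>'(2)[OF part mesh2] unfolding A_def B_def by (intro add_strict_mono)
  finally have "prob {\<omega>\<in>space M. \<bar>C \<omega> - Y t \<omega>\<bar> > e} < p" by simp
  then show ?thesis using that[OF part mesh1] mC unfolding C_def by blast
qed

text \<open>By Fatou's lemma the quadratic variation sums are bounded along an \<open>\<omega>\<close>-dependent subsequence,
  which is enough to identify the limit.\<close>

lemma (in brownian) stratonovich_integral_eq_primitive:
  assumes strat: "is_stratonovich_integral M T W X Y" and t: "t \<in> {0..T}"
    and prim: "AE \<omega> in M. stratonovich_primitive T (\<lambda>s. W s \<omega>) (\<lambda>s. X s \<omega>) (S \<omega>) \<and> S \<omega> 0 = 0"
  shows "AE \<omega> in M. Y t \<omega> = S \<omega> t"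
proof -
  define tr where "tr N \<sigma> \<omega> = (\<Sum>l<N. (X (\<sigma> l) \<omega> + X (\<sigma> (Suc l)) \<omega>) / 2 * (W (\<sigma> (Suc l)) \<omega> - W (\<sigma> l) \<omega>))"
    for N :: nat and \<sigma> :: "nat \<Rightarrow> real" and \<omega>
  \<comment> \<open>Summable probabilities allow Borel-Cantelli, which needs the events to be
    measurable, and turn convergence in probability into almost sure convergence; mesh and tolerance
    tend to 0 alongside.\<close>
  have "\<forall>j. \<exists>N \<sigma>. partition_seq 0 t N \<sigma> \<and> mesh_less (1 / real (Suc j)) N \<sigma> \<and>
      {\<omega>\<in>space M. \<bar>tr N \<sigma> \<omega> - Y t \<omega>\<bar> > 1 / real (Suc j)} \<in> events \<and>
      prob {\<omega>\<in>space M. \<bar>tr N \<sigma> \<omega> - Y t \<omega>\<bar> > 1 / real (Suc j)} < (1 / 2) ^ j"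
    unfolding tr_def
  proof
    fix j
    show "\<exists>N \<sigma>. partition_seq 0 t N \<sigma> \<and> mesh_less (1 / real (Suc j)) N \<sigma> \<and>
      {\<omega>\<in>space M. \<bar>(\<Sum>l<N. (X (\<sigma> l) \<omega> + X (\<sigma> (Suc l)) \<omega>) / 2 * (W (\<sigma> (Suc l)) \<omega> - W (\<sigma> l) \<omega>)) - Y t \<omega>\<bar> > 1 / real (Suc j)} \<in> events \<and>
      prob {\<omega>\<in>space M. \<bar>(\<Sum>l<N. (X (\<sigma> l) \<omega> + X (\<sigma> (Suc l)) \<omega>) / 2 * (W (\<sigma> (Suc l)) \<omega> - W (\<sigma> l) \<omega>)) - Y t \<omega>\<bar> > 1 / real (Suc j)} < (1 / 2) ^ j"
    by (rule stratonovich_trapezoid_sums[OF strat t, of "1 / real (Suc j)" "(1 / 2) ^ j" "1 / real (Suc j)"]) (simp, simp, simp, blast)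
  qed
  from choice[OF this] obtain N where "\<forall>j. \<exists>\<sigma>. partition_seq 0 t (N j) \<sigma> \<and> mesh_less (1 / real (Suc j)) (N j) \<sigma> \<and>
      {\<omega>\<in>space M. \<bar>tr (N j) \<sigma> \<omega> - Y t \<omega>\<bar> > 1 / real (Suc j)} \<in> events \<and>
      prob {\<omega>\<in>space M. \<bar>tr (N j) \<sigma> \<omega> - Y t \<omega>\<bar> > 1 / real (Suc j)} < (1 / 2) ^ j" ..
  from choice[OF this] obtain \<sigma> where "\<forall>j. partition_seq 0 t (N j) (\<sigma> j) \<and> mesh_less (1 / real (Suc j)) (N j) (\<sigma> j) \<and>
      {\<omega>\<in>space M. \<bar>tr (N j) (\<sigma> j) \<omega> - Y t \<omega>\<bar> > 1 / real (Suc j)} \<in> events \<and>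
      prob {\<omega>\<in>space M. \<bar>tr (N j) (\<sigma> j) \<omega> - Y t \<omega>\<bar> > 1 / real (Suc j)} < (1 / 2) ^ j" ..
  then have part: "\<And>j. partition_seq 0 t (N j) (\<sigma> j)"
    and mesh: "\<And>j. mesh_less (1 / real (Suc j)) (N j) (\<sigma> j)"
    and m: "\<And>j. {\<omega>\<in>space M. \<bar>tr (N j) (\<sigma> j) \<omega> - Y t \<omega>\<bar> > 1 / real (Suc j)} \<in> events"
    and P: "\<And>j. prob {\<omega>\<in>space M. \<bar>tr (N j) (\<sigma> j) \<omega> - Y t \<omega>\<bar> > 1 / real (Suc j)} < (1 / 2) ^ j"
    by blast+
  have "summable (\<lambda>j. prob {\<omega>\<in>space M. \<bar>tr (N j) (\<sigma> j) \<omega> - Y t \<omega>\<bar> > 1 / real (Suc j)})"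
    by (rule summable_comparison_test'[of "\<lambda>j. (1 / 2) ^ j" 0]) (use P in \<open>auto intro: less_imp_le\<close>)
  then have BC: "AE \<omega> in M. eventually (\<lambda>j. \<omega> \<in> space M - {\<omega>\<in>space M. \<bar>tr (N j) (\<sigma> j) \<omega> - Y t \<omega>\<bar> > 1 / real (Suc j)}) sequentially"
    by (intro borel_cantelli_AE1 m) (auto simp: less_top[symmetric])
  define q where "q j \<omega> = (\<Sum>l<N j. (W (\<sigma> j (Suc l)) \<omega> - W (\<sigma> j l) \<omega>)\<^sup>2)" for j \<omega>
  have st: "0 \<le> \<sigma> j l" "\<sigma> j l \<le> \<sigma> j (Suc l)" "\<sigma> j (Suc l) \<le> T" if "l < N j" for j l
    using partition_seq_step[OF part that] t by auto
  have qi: "integrable M (q j)" for j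
    unfolding q_def using increment_moments(3)[OF st] by (intro Bochner_Integration.integrable_sum) auto
  \<comment> \<open>The mean does not depend on the partition; this is the uniform bound that
    Fatou's lemma turns into a finite lower limit.\<close>
  have qE: "expectation (q j) = t" for j
  proof -
    have "expectation (q j) = (\<Sum>l<N j. \<sigma> j (Suc l) - \<sigma> j l)"
      unfolding q_def using increment_moments(3,4)[OF st] by (subst Bochner_Integration.integral_sum) auto
    then show ?thesis using partition_seq_telescope[OF part, of "\<lambda>x. x"] by simp
  qed
  have q0: "0 \<le> q j \<omega>" for j \<omega> unfolding q_def by (intro sum_nonneg) auto
  have "(\<integral>\<^sup>+ \<omega>. liminf (\<lambda>j. ennreal (q j \<omega>)) \<partial>M) \<le> liminf (\<lambda>j. \<integral>\<^sup>+ \<omega>. ennreal (q j \<omega>) \<partial>M)"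
    using qi by (intro nn_integral_liminf) auto
  also have "(\<lambda>j. \<integral>\<^sup>+ \<omega>. ennreal (q j \<omega>) \<partial>M) = (\<lambda>j. ennreal t)"
    using nn_integral_eq_integral[OF qi] q0 qE by simp
  also have "liminf (\<lambda>j::nat. ennreal t) = ennreal t" by (simp add: Liminf_const)
  finally have "(\<integral>\<^sup>+ \<omega>. liminf (\<lambda>j. ennreal (q j \<omega>)) \<partial>M) \<noteq> \<infinity>"
    by (metis ennreal_neq_top infinity_ennreal_def top_unique)
  then have Fatou: "AE \<omega> in M. liminf (\<lambda>j. ennreal (q j \<omega>)) \<noteq> \<infinity>"
    using qi by (intro nn_integral_PInf_AE) auto
  show ?thesis using BC Fatou prim
  proof eventually_elim
    case (elim \<omega>)
    have bc: "eventually (\<lambda>j. \<bar>tr (N j) (\<sigma> j) \<omega> - Y t \<omega>\<bar> \<le> 1 / real (Suc j)) sequentially"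
      using elim(1) by eventually_elim auto
    obtain C :: real where C: "C \<ge> 0" "liminf (\<lambda>j. ennreal (q j \<omega>)) < ennreal C"
    proof -
      obtain r where r: "liminf (\<lambda>j. ennreal (q j \<omega>)) = ennreal r" "r \<ge> 0"
        using elim(2) by (cases "liminf (\<lambda>j. ennreal (q j \<omega>))") auto
      then show ?thesis by (intro that[of "r + 1"]) (auto simp: ennreal_less_iff)
    qed
    \<comment> \<open>A finite lower limit bounds the sums only for infinitely many
      \<open>j\<close>. That is enough, since the other requirements hold eventually and a single
      common \<open>j\<close> will do.\<close>
    have fr: "frequently (\<lambda>j. q j \<omega> < C) sequentially"
    proof (rule ccontr)
      assume "\<not> frequently (\<lambda>j. q j \<omega> < C) sequentially"
      then have "eventually (\<lambda>j. ennreal C \<le> ennreal (q j \<omega>)) sequentially"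
        unfolding frequently_def by (auto elim!: eventually_mono intro!: ennreal_leI)
      then have "ennreal C \<le> liminf (\<lambda>j. ennreal (q j \<omega>))" by (rule Liminf_bounded)
      then show False using C by simp
    qed
    \<comment> \<open>\<open>C\<close> is chosen before \<open>e\<close>, so the right-hand side
      tends to 0 with \<open>e\<close>.\<close>
    have bound: "\<bar>S \<omega> t - Y t \<omega>\<bar> \<le> e * (t + C + 1)" if e: "e > 0" for e
    proof -
      have "stratonovich_primitive T (\<lambda>s. W s \<omega>) (\<lambda>s. X s \<omega>) (S \<omega>)" using elim(3) by blast
      then obtain \<delta> where \<delta>: "\<delta> > 0" "\<And>s t. 0 \<le> s \<Longrightarrow> s \<le> t \<Longrightarrow> t \<le> T \<Longrightarrow> t - s < \<delta> \<Longrightarrow>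
        \<bar>S \<omega> t - S \<omega> s - (X s \<omega> + X t \<omega>) / 2 * (W t \<omega> - W s \<omega>)\<bar> \<le> e * ((t - s) + (W t \<omega> - W s \<omega>)\<^sup>2)"
        using e by (rule stratonovich_primitiveE) blast
      have lim: "(\<lambda>j. 1 / real (Suc j)) \<longlonglongrightarrow> 0"
        using LIMSEQ_inverse_real_of_nat by (simp add: inverse_eq_divide)
      have "eventually (\<lambda>j. 1 / real (Suc j) < min e \<delta>) sequentially"
        by (rule order_tendstoD(2)[OF lim]) (use e \<delta> in auto)
      with bc have ev: "eventually (\<lambda>j. \<bar>tr (N j) (\<sigma> j) \<omega> - Y t \<omega>\<bar> \<le> e \<and> 1 / real (Suc j) < \<delta>) sequentially"
        by eventually_elim auto
      obtain j where j: "q j \<omega> < C" "\<bar>tr (N j) (\<sigma> j) \<omega> - Y t \<omega>\<bar> \<le> e" "1 / real (Suc j) < \<delta>"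
        using frequently_ex[OF frequently_eventually_frequently[OF fr ev]] by blast
      have each: "\<bar>(S \<omega> (\<sigma> j (Suc l)) - S \<omega> (\<sigma> j l))
          - (X (\<sigma> j l) \<omega> + X (\<sigma> j (Suc l)) \<omega>) / 2 * (W (\<sigma> j (Suc l)) \<omega> - W (\<sigma> j l) \<omega>)\<bar>
          \<le> e * ((\<sigma> j (Suc l) - \<sigma> j l) + (W (\<sigma> j (Suc l)) \<omega> - W (\<sigma> j l) \<omega>)\<^sup>2)" if "l < N j" for l
      proof (rule \<delta>(2))
        have "\<sigma> j (Suc l) - \<sigma> j l < 1 / real (Suc j)" using mesh[of j] that unfolding mesh_less_def by blast
        then show "\<sigma> j (Suc l) - \<sigma> j l < \<delta>" using j(3) by linarith
      qed (rule st[OF that])+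
      have diff: "S \<omega> t - tr (N j) (\<sigma> j) \<omega> = (\<Sum>l<N j. (S \<omega> (\<sigma> j (Suc l)) - S \<omega> (\<sigma> j l))
          - (X (\<sigma> j l) \<omega> + X (\<sigma> j (Suc l)) \<omega>) / 2 * (W (\<sigma> j (Suc l)) \<omega> - W (\<sigma> j l) \<omega>))"
        using partition_seq_telescope[OF part, of "S \<omega>" j] elim(3)
        by (simp add: tr_def sum_subtractf[of "\<lambda>l. S \<omega> (\<sigma> j (Suc l)) - S \<omega> (\<sigma> j l)"])
      have "\<bar>S \<omega> t - tr (N j) (\<sigma> j) \<omega>\<bar> \<le> (\<Sum>l<N j. e * ((\<sigma> j (Suc l) - \<sigma> j l) + (W (\<sigma> j (Suc l)) \<omega> - W (\<sigma> j l) \<omega>)\<^sup>2))"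
        unfolding diff by (rule order.trans[OF sum_abs sum_mono]) (use each in auto)
      also have "\<dots> = e * (t + q j \<omega>)"
        unfolding sum_distrib_left[symmetric] sum.distrib q_def
        using partition_seq_telescope[OF part, of "\<lambda>x. x" j] by simp
      also have "\<dots> \<le> e * (t + C)" using j(1) e by (intro mult_left_mono) auto
      finally have "\<bar>S \<omega> t - tr (N j) (\<sigma> j) \<omega>\<bar> \<le> e * (t + C)" .
      then have "\<bar>S \<omega> t - Y t \<omega>\<bar> \<le> e * (t + C) + e" using j(2) by linarith
      then show ?thesis by (simp add: algebra_simps)
    qed
    have "\<bar>S \<omega> t - Y t \<omega>\<bar> \<le> 0"
    proof (rule field_le_epsilon)
      fix e :: real assume "e > 0"
      have tc: "t + C + 1 > 0" using t C by simp
      then show "\<bar>S \<omega> t - Y t \<omega>\<bar> \<le> 0 + e" using bound[of "e / (t + C + 1)"] \<open>e > 0\<close> by simp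
    qed
    then show ?case by simp
  qed
qed

text \<open>The exceptional null set of the hypothesis depends on the time. A countable dense set of
  times gives a single null set, and continuity extends the equality.\<close>

lemma AE_eq_of_continuous:
  fixes T :: real
  assumes X: "AE \<omega> in M. continuous_on {0..T} (\<lambda>s. X s \<omega>)"
    and Y: "AE \<omega> in M. continuous_on {0..T} (\<lambda>s. Y s \<omega>)"
    and eq: "\<And>t. t \<in> {0..T} \<Longrightarrow> AE \<omega> in M. X t \<omega> = (Y t \<omega> :: real)"
  shows "AE \<omega> in M. \<forall>t\<in>{0..T}. X t \<omega> = Y t \<omega>"
proof -
  obtain D where D: "countable D" "D \<subseteq> {0..T}" "closure D = {0..T}" by (rule countable_dense_Icc)
  have "AE \<omega> in M. \<forall>t\<in>D. X t \<omega> = Y t \<omega>"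
    using D eq by (intro AE_ball_countable'[OF _ D(1)]) auto
  then show ?thesis using X Y
  proof eventually_elim
    case (elim \<omega>)
    have "continuous_on (closure D) (\<lambda>t. X t \<omega> - Y t \<omega>)"
      unfolding D(3) by (intro continuous_intros elim)
    from continuous_constant_on_closure[OF this, of 0] elim(1) show ?case unfolding D(3) by auto
  qed
qed

text \<open>The processes \<open>Y k\<close> are determined only up to null sets. The inductive step
  therefore accepts an integrand of the expected form for almost every path, and returns an equality
  valid for all times at once, as the next level requires.\<close>

lemma (in brownian) multiple_stratonovich_integral_eq_strat_iter:
  assumes f': "\<And>i x. i \<in> {1..n} \<Longrightarrow> x \<in> {0..T} \<Longrightarrow> (f i has_real_derivative f' i x) (at x within {0..T})"
    and f'_cont: "\<And>i. i \<in> {1..n} \<Longrightarrow> continuous_on {0..T} (f' i)"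
    and "n \<ge> 1" and strat: "is_multiple_stratonovich_integral M T W f n I"
  shows "AE \<omega> in M. \<forall>t\<in>{0..T}. I t \<omega> = strat_iter f f' (\<lambda>s. W s \<omega>) n t"
proof -
  obtain Y where Y1: "is_stratonovich_integral M T W (\<lambda>s \<omega>. f 1 s) (Y 1)"
    and Yk: "\<And>k. k \<in> {2..n} \<Longrightarrow> is_stratonovich_integral M T W (\<lambda>s \<omega>. f k s * Y (k - 1) s \<omega>) (Y k)"
    and I: "I = Y n"
    using strat unfolding is_multiple_stratonovich_integral_def by blast
  have Wc: "AE \<omega> in M. continuous_on {0..T} (\<lambda>s. W s \<omega>)" by (intro AE_I2 W_continuous)
  have step: "AE \<omega> in M. \<forall>t\<in>{0..T}. Z t \<omega> = strat_iter f f' (\<lambda>s. W s \<omega>) (Suc k) t"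
    if Z: "is_stratonovich_integral M T W X Z" and k: "Suc k \<le> n"
      and X: "AE \<omega> in M. \<forall>t\<in>{0..T}. X t \<omega> = f (Suc k) t * strat_iter f f' (\<lambda>s. W s \<omega>) k t" for X Z k
  proof (rule AE_eq_of_continuous)
    show "AE \<omega> in M. continuous_on {0..T} (\<lambda>s. Z s \<omega>)"
      using Z unfolding is_stratonovich_integral_def continuous_process_def by (intro AE_I2) blast
    show "AE \<omega> in M. continuous_on {0..T} (strat_iter f f' (\<lambda>s. W s \<omega>) (Suc k))"
      using Wc by eventually_elim (rule continuous_strat_iter[OF f' f'_cont _ k])
    fix t assume t: "t \<in> {0..T}"
    show "AE \<omega> in M. Z t \<omega> = strat_iter f f' (\<lambda>s. W s \<omega>) (Suc k) t"
    proof (rule stratonovich_integral_eq_primitive[OF Z t])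
      show "AE \<omega> in M. stratonovich_primitive T (\<lambda>s. W s \<omega>) (\<lambda>s. X s \<omega>) (strat_iter f f' (\<lambda>s. W s \<omega>) (Suc k))
          \<and> strat_iter f f' (\<lambda>s. W s \<omega>) (Suc k) 0 = 0"
        using Wc X W_0
      proof eventually_elim
        case (elim \<omega>)
        have "stratonovich_primitive T (\<lambda>s. W s \<omega>) (\<lambda>t. f (Suc k) t * strat_iter f f' (\<lambda>s. W s \<omega>) k t)
            (strat_iter f f' (\<lambda>s. W s \<omega>) (Suc k))"
          by (rule strat_iter_primitive[OF f' f'_cont elim(1) k])
        then have "stratonovich_primitive T (\<lambda>s. W s \<omega>) (\<lambda>s. X s \<omega>) (strat_iter f f' (\<lambda>s. W s \<omega>) (Suc k))"
          by (rule stratonovich_primitive_cong) (use elim(2) in auto)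
        then show ?case using strat_iter_Suc_0[of "\<lambda>s. W s \<omega>"] elim(3) by blast
      qed
    qed
  qed
  have "Suc k \<le> n \<Longrightarrow> AE \<omega> in M. \<forall>t\<in>{0..T}. Y (Suc k) t \<omega> = strat_iter f f' (\<lambda>s. W s \<omega>) (Suc k) t" for k
  proof (induction k)
    case 0
    have "AE \<omega> in M. \<forall>t\<in>{0..T}. Y 1 t \<omega> = strat_iter f f' (\<lambda>s. W s \<omega>) (Suc 0) t"
      using 0 by (intro step[OF Y1]) auto
    then show ?case by simp
  next
    case (Suc k)
    then have k: "Suc (Suc k) \<in> {2..n}" "Suc k \<le> n" by auto
    from Suc.IH[OF k(2)] have "AE \<omega> in M. \<forall>t\<in>{0..T}. f (Suc (Suc k)) t * Y (Suc (Suc k) - 1) t \<omega>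
        = f (Suc (Suc k)) t * strat_iter f f' (\<lambda>s. W s \<omega>) (Suc k) t"
      by eventually_elim simp
    then show ?case by (rule step[OF Yk[OF k(1)] Suc.prems])
  qed
  from this[of "n - 1"] \<open>n \<ge> 1\<close> show ?thesis unfolding I by simp
qed

text \<open>The supremum of an unbounded set of reals is an unspecified value, so it measures
  uniform distance only under the boundedness hypothesis.\<close>

lemma uniform_limit_iff_SUP:
  fixes g :: "nat \<Rightarrow> real \<Rightarrow> real"
  assumes "X \<noteq> {}" and bdd: "eventually (\<lambda>m. bdd_above ((\<lambda>s. \<bar>g m s - l s\<bar>) ` X)) sequentially"
  shows "uniform_limit X g l sequentially \<longleftrightarrow> (\<lambda>m. SUP s\<in>X. \<bar>g m s - l s\<bar>) \<longlonglongrightarrow> 0"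
proof
  assume lim: "uniform_limit X g l sequentially"
  show "(\<lambda>m. SUP s\<in>X. \<bar>g m s - l s\<bar>) \<longlonglongrightarrow> 0"
  proof (rule tendstoI)
    fix e :: real assume "e > 0"
    then have "eventually (\<lambda>m. \<forall>s\<in>X. dist (g m s) (l s) < e / 2) sequentially"
      by (intro uniform_limitD[OF lim]) simp
    then show "eventually (\<lambda>m. dist (SUP s\<in>X. \<bar>g m s - l s\<bar>) 0 < e) sequentially" using bdd
    proof eventually_elim
      case (elim m)
      obtain x where x: "x \<in> X" using assms(1) by blast
      have "(SUP s\<in>X. \<bar>g m s - l s\<bar>) \<le> e / 2"
        using assms(1) elim(1) by (intro cSUP_least) (auto simp: dist_real_def intro: less_imp_le)
      moreover have "0 \<le> (SUP s\<in>X. \<bar>g m s - l s\<bar>)"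
        using cSUP_upper[OF x elim(2)] by (meson abs_ge_zero order_trans)
      ultimately show ?case using \<open>e > 0\<close> by (simp add: dist_real_def)
    qed
  qed
next
  assume lim: "(\<lambda>m. SUP s\<in>X. \<bar>g m s - l s\<bar>) \<longlonglongrightarrow> 0"
  show "uniform_limit X g l sequentially"
  proof (rule uniform_limitI)
    fix e :: real assume "e > 0"
    then have "eventually (\<lambda>m. (SUP s\<in>X. \<bar>g m s - l s\<bar>) < e) sequentially"
      by (rule order_tendstoD(2)[OF lim])
    then show "eventually (\<lambda>m. \<forall>s\<in>X. dist (g m s) (l s) < e) sequentially" using bdd
    proof eventually_elim
      case (elim m)
      then show ?case using cSUP_upper[of _ X "\<lambda>s. \<bar>g m s - l s\<bar>"]
        by (auto simp: dist_real_def intro: le_less_trans)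
    qed
  qed
qed

theorem theorem2p2:
  fixes M :: "'a measure" and P :: "'b measure"
    and T :: real and n :: nat
    and W :: "real \<Rightarrow> 'a \<Rightarrow> real"
    and Wm :: "nat \<Rightarrow> real \<Rightarrow> 'a \<Rightarrow> real"
    and N :: "real \<Rightarrow> 'b \<Rightarrow> nat" and A :: "'b \<Rightarrow> bool"
    and f :: "nat \<Rightarrow> real \<Rightarrow> real"
    and I :: "real \<Rightarrow> 'a \<Rightarrow> real"
  assumes "prob_space M"
    and "T > 0" and "n \<ge> 1"
    and "brownian_motion M T W"
    and "prob_space P"
    and "poisson_process P N"
    and "A \<in> measurable P (count_space UNIV)"
    and "distr P (count_space UNIV) A = measure_pmf (bernoulli_pmf (1 / 2))"
    and "prob_space.indep_set P
           (sets (vimage_algebra (space P) A (count_space UNIV)))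
           (sets (vimage_algebra (space P) (\<lambda>\<omega>. \<lambda>t\<in>{0..}. N t \<omega>)
              (\<Pi>\<^sub>M t\<in>{0..}. count_space UNIV)))"
    and "\<And>m. m \<ge> 1 \<Longrightarrow> is_version M (Wm m) P (uniform_transport N A m) T"
    and "AE \<omega> in M. (\<lambda>m. SUP s\<in>{0..T}. \<bar>Wm m s \<omega> - W s \<omega>\<bar>) \<longlonglongrightarrow> 0"
    and "\<And>i. i \<in> {1..n} \<Longrightarrow> C1_on_interval T (f i)"
    and "is_multiple_stratonovich_integral M T W f n I"
  shows "AE \<omega> in M.
    (\<lambda>m. SUP s\<in>{0..T}. \<bar>iterated_rs_integral f (\<lambda>t. Wm m t \<omega>) n s - I s \<omega>\<bar>) \<longlonglongrightarrow> 0"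
proof -
  interpret M: brownian M T W using assms(1,2,4) by (intro brownian.intro brownian_axioms.intro)
  define f' where "f' i = (SOME g'. (\<forall>x\<in>{0..T}. (f i has_real_derivative g' x) (at x within {0..T})) \<and> continuous_on {0..T} g')" for i
  have f': "(\<forall>x\<in>{0..T}. (f i has_real_derivative f' i x) (at x within {0..T})) \<and> continuous_on {0..T} (f' i)"
    if "i \<in> {1..n}" for i
    using assms(12)[OF that] unfolding C1_on_interval_def f'_def by (rule someI_ex)
  then have f'_deriv: "\<And>i x. i \<in> {1..n} \<Longrightarrow> x \<in> {0..T} \<Longrightarrow> (f i has_real_derivative f' i x) (at x within {0..T})"
    and f'_cont: "\<And>i. i \<in> {1..n} \<Longrightarrow> continuous_on {0..T} (f' i)" by auto
  have I: "AE \<omega> in M. \<forall>t\<in>{0..T}. I t \<omega> = strat_iter f f' (\<lambda>s. W s \<omega>) n t"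
    by (rule M.multiple_stratonovich_integral_eq_strat_iter[OF f'_deriv f'_cont assms(3,13)])
  \<comment> \<open>There are only countably many \<open>m\<close>, so one null set serves all of
    them, although the Lipschitz constants differ.\<close>
  have lip: "AE \<omega> in M. \<forall>m\<in>{1..}. Wm m 0 \<omega> = 0 \<and>
      (\<forall>x\<in>{0..T}. \<forall>y\<in>{0..T}. \<bar>Wm m y \<omega> - Wm m x \<omega>\<bar> \<le> sqrt (real m) * \<bar>y - x\<bar>)"
    using uniform_transport_version_lipschitz[OF assms(1,5,2,6,10)] by (intro AE_ball_countable') auto
  have Wm_cont: "AE \<omega> in M. \<forall>m\<in>{1..}. continuous_on {0..T} (\<lambda>s. Wm m s \<omega>)"
    using assms(10) unfolding is_version_def continuous_process_def by (intro AE_I2) auto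
  have W_cont: "AE \<omega> in M. continuous_on {0..T} (\<lambda>s. W s \<omega>)" by (intro AE_I2 M.W_continuous)
  have ne: "{0..T} \<noteq> {}" using assms(2) by simp
  have bdd: "bdd_above ((\<lambda>s. \<bar>g s - h s\<bar>) ` {0..T})" if "continuous_on {0..T} g" "continuous_on {0..T} h"
    for g h :: "real \<Rightarrow> real"
    using that by (intro bounded_imp_bdd_above compact_imp_bounded compact_continuous_image continuous_intros) auto
  show ?thesis using I lip Wm_cont W_cont assms(11)
  proof eventually_elim
    case (elim \<omega>)
    have cont: "\<forall>\<^sub>F m in sequentially. continuous_on {0..T} (\<lambda>s. Wm m s \<omega>)"
      using eventually_ge_at_top[of 1] by eventually_elim (use elim(3) in auto)
    have "\<forall>\<^sub>F m in sequentially. bdd_above ((\<lambda>s. \<bar>Wm m s \<omega> - W s \<omega>\<bar>) ` {0..T})"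
      using cont by eventually_elim (intro bdd elim(4))
    then have lim: "uniform_limit {0..T} (\<lambda>m s. Wm m s \<omega>) (\<lambda>s. W s \<omega>) sequentially"
      using elim(5) uniform_limit_iff_SUP[OF ne, of "\<lambda>m s. Wm m s \<omega>" "\<lambda>s. W s \<omega>"] by blast
    have S_lim: "uniform_limit {0..T} (\<lambda>m. strat_iter f f' (\<lambda>s. Wm m s \<omega>) n) (strat_iter f f' (\<lambda>s. W s \<omega>) n) sequentially"
      by (rule uniform_limit_strat_iter[OF f'_deriv f'_cont lim cont elim(4) order_refl])
    have "\<forall>\<^sub>F m in sequentially. bdd_above ((\<lambda>s. \<bar>strat_iter f f' (\<lambda>s. Wm m s \<omega>) n s - strat_iter f f' (\<lambda>s. W s \<omega>) n s\<bar>) ` {0..T})"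
      using cont by eventually_elim (intro bdd continuous_strat_iter[OF f'_deriv f'_cont _ order_refl] elim(4))
    from uniform_limit_iff_SUP[OF ne this, THEN iffD1, OF S_lim]
    have "(\<lambda>m. SUP s\<in>{0..T}. \<bar>strat_iter f f' (\<lambda>s. Wm m s \<omega>) n s - strat_iter f f' (\<lambda>s. W s \<omega>) n s\<bar>) \<longlonglongrightarrow> 0" .
    \<comment> \<open>Both suprema agree for \<open>m \<ge> 1\<close>, on the event where
      \<open>I\<close> is the functional of \<open>W\<close> and every transport version is
      Lipschitz.\<close>
    moreover have "\<forall>\<^sub>F m in sequentially.
        (SUP s\<in>{0..T}. \<bar>strat_iter f f' (\<lambda>s. Wm m s \<omega>) n s - strat_iter f f' (\<lambda>s. W s \<omega>) n s\<bar>)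
        = (SUP s\<in>{0..T}. \<bar>iterated_rs_integral f (\<lambda>t. Wm m t \<omega>) n s - I s \<omega>\<bar>)"
      using eventually_ge_at_top[of 1] cont
    proof eventually_elim
      case (elim m)
      obtain k where n: "n = Suc k" using assms(3) by (cases n) auto
      show ?case
      proof (rule SUP_cong[OF refl])
        fix s assume s: "s \<in> {0..T}"
        have "iterated_rs_integral f (\<lambda>t. Wm m t \<omega>) n s = strat_iter f f' (\<lambda>s. Wm m s \<omega>) n s"
          unfolding n
          by (rule iterated_rs_integral_eq_strat_iter[OF f'_deriv f'_cont elim(2), where n = n and L = "sqrt (real m)"])
            (use \<open>\<forall>m\<in>{1..}. Wm m 0 \<omega> = 0 \<and>
              (\<forall>x\<in>{0..T}. \<forall>y\<in>{0..T}. \<bar>Wm m y \<omega> - Wm m x \<omega>\<bar> \<le> sqrt (real m) * \<bar>y - x\<bar>)\<close> elim(1) n s in auto)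
        then show "\<bar>strat_iter f f' (\<lambda>s. Wm m s \<omega>) n s - strat_iter f f' (\<lambda>s. W s \<omega>) n s\<bar>
            = \<bar>iterated_rs_integral f (\<lambda>t. Wm m t \<omega>) n s - I s \<omega>\<bar>"
          using \<open>\<forall>t\<in>{0..T}. I t \<omega> = strat_iter f f' (\<lambda>s. W s \<omega>) n t\<close> s by simp
      qed
    qed
    ultimately show ?case by (rule Lim_transform_eventually)
  qed
qed

end
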